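(* Let $k$ be a field of characteristic zero, $q\in k$ nonzero and not a root of unity, $c,d\in k$ with $c+d\neq0$, and $\mathcal{A}=\mathcal{A}(c,d)$ the coordinate algebra of the Podleś quantum sphere. Then $HH_n^\sigma(\mathcal{A})=0$ for all $n\ge3$ and every automorphism $\sigma$ of $\mathcal{A}$.
   Context: $\mathcal{A}(c,d)$ is the unital $k$-algebra with generators $A,B,B^*$ and relations $BA=q^2AB$, $AB^*=q^2B^*A$, $B^*B=cd+(c-d)A-A^2$, $BB^*=cd+q^2(c-d)A-q^4A^2$. Known fact (Krähmer): every automorphism of $\mathcal{A}(c,d)$ is, for some $\lambda\in k\setminus\{0\}$, either $\sigma_\lambda$: $B\mapsto\lambda B$, $A\mapsto A$, $B^*\mapsto\lambda^{-1}B^*$, or, only when $c=d$, $\tau_\lambda$: $B\mapsto\lambda B$, $A\mapsto-A$, $B^*\mapsto\lambda^{-1}B^*$. Twisted Hochschild homology: for a unital $k$-algebra $\mathcal{A}$ and an automorphism $\sigma$, let $C_n^\sigma(\mathcal{A})=\mathcal{A}^{\otimes(n+1)}/\mathrm{im}(\mathrm{id}-\sigma^{\otimes(n+1)})$, with differential $b_\sigma:C_{n+1}^\sigma(\mathcal{A})\to C_n^\sigma(\mathcal{A})$ induced by $$b_\sigma(a_0,\dots,a_{n+1})=\sum_{j=0}^{n}(-1)^j(a_0,\dots,a_ja_{j+1},\dots,a_{n+1})+(-1)^{n+1}(\sigma(a_{n+1})a_0,a_1,\dots,a_n),$$ where $(a_0,\dots,a_n)$ denotes $a_0\otimes\cdots\otimes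 a_n$. $HH_*^\sigma(\mathcal{A})$ is the homology of $(C_n^\sigma(\mathcal{A}),b_\sigma)_{n\ge0}$. *)

theory Defs
  imports "HOL-Algebra.Algebra" "HOL-Algebra.Algebraic_Closure_Type" "HOL-Library.Poly_Mapping"
begin

section \<open>Twisted Hochschild homology of a unital algebra\<close>

text \<open>
  A unital algebra over the field given by the type \<open>'k\<close> is a record of type
  \<open>('k, 'a) module\<close>: a ring with a scalar multiplication \<open>\<odot>\<close>. The locale
  \<open>algebra\<close> of the library cannot be used, since it covers commutative algebras only.
\<close>

definition algebra_automorphisms :: "('k, 'a) module \<Rightarrow> ('a \<Rightarrow> 'a) set" where
  "algebra_automorphisms A =
     {\<sigma> \<in> ring_iso A A. \<forall>r. \<forall>x\<in>carrier A. \<sigma> (r \<odot>\<^bsub>A\<^esub> x) = r \<odot>\<^bsub>A\<^esub> \<sigma> x}"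

text \<open>The linear extension of a map from a basis; \<open>'b \<Rightarrow>\<^sub>0 'k\<close> is the free vector space on \<open>'b\<close>.\<close>

definition lin_ext :: "('b \<Rightarrow> ('c \<Rightarrow>\<^sub>0 'k)) \<Rightarrow> ('b \<Rightarrow>\<^sub>0 'k) \<Rightarrow> ('c \<Rightarrow>\<^sub>0 'k::comm_ring_1)" where
  "lin_ext f x =
     (\<Sum>t\<in>Poly_Mapping.keys x. Poly_Mapping.map ((*) (Poly_Mapping.lookup x t)) (f t))"

text \<open>
  The map into a quotient \<open>H Mod N\<close> induced by \<open>f\<close>. If \<open>f\<close> is a homomorphism to \<open>H\<close> mapping a
  subgroup \<open>M\<close> into \<open>N\<close>, it sends the coset of \<open>x\<close> modulo \<open>M\<close> to the coset of \<open>f x\<close>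
  modulo \<open>N\<close>.
\<close>

definition induced :: "('b, 'm) monoid_scheme \<Rightarrow> 'b set \<Rightarrow> ('a \<Rightarrow> 'b) \<Rightarrow> 'a set \<Rightarrow> 'b set" where
  "induced H N f C = N <#>\<^bsub>H\<^esub> (f ` C)"

text \<open>The free vector space on the \<open>m\<close>-tuples of elements of \<open>A\<close>.\<close>

definition tuple_space :: "('k::comm_ring_1, 'a) module \<Rightarrow> nat \<Rightarrow> ('a list \<Rightarrow>\<^sub>0 'k) monoid" where
  "tuple_space A m =
     \<lparr>carrier = {x. Poly_Mapping.keys x \<subseteq> {as. length as = m \<and> set as \<subseteq> carrier A}},
      monoid.mult = (+), one = 0\<rparr>"

text \<open>
  The subspace spanned by the multilinearity relations. As these are stated with an arbitrary
  coefficient \<open>s\<close>, the generated additive subgroup is already a subspace.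
\<close>

definition multilinear_relations :: "('k::comm_ring_1, 'a) module \<Rightarrow> nat \<Rightarrow> ('a list \<Rightarrow>\<^sub>0 'k) set" where
  "multilinear_relations A m = generate (tuple_space A m)
     ({Poly_Mapping.single (as[i := x \<oplus>\<^bsub>A\<^esub> y]) s
         - Poly_Mapping.single (as[i := x]) s - Poly_Mapping.single (as[i := y]) s | as i x y s.
         length as = m \<and> set as \<subseteq> carrier A \<and> i < m \<and> x \<in> carrier A \<and> y \<in> carrier A} \<union>
      {Poly_Mapping.single (as[i := r \<odot>\<^bsub>A\<^esub> x]) s - Poly_Mapping.single (as[i := x]) (s * r) | as i x r s.
         length as = m \<and> set as \<subseteq> carrier A \<and> i < m \<and> x \<in> carrier A})"

definition tensor_power :: "('k::comm_ring_1, 'a) module \<Rightarrow> nat \<Rightarrow> ('a list \<Rightarrow>\<^sub>0 'k) set monoid" where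
  "tensor_power A m = tuple_space A m Mod multilinear_relations A m"

definition tensor_power_map ::
    "('k::comm_ring_1, 'a) module \<Rightarrow> ('a \<Rightarrow> 'a) \<Rightarrow> nat \<Rightarrow> ('a list \<Rightarrow>\<^sub>0 'k) set \<Rightarrow> ('a list \<Rightarrow>\<^sub>0 'k) set" where
  "tensor_power_map A \<sigma> m = induced (tuple_space A m) (multilinear_relations A m)
     (lin_ext (\<lambda>as. Poly_Mapping.single (map \<sigma> as) 1))"

definition coinvariant_relations ::
    "('k::comm_ring_1, 'a) module \<Rightarrow> ('a \<Rightarrow> 'a) \<Rightarrow> nat \<Rightarrow> ('a list \<Rightarrow>\<^sub>0 'k) set set" where
  "coinvariant_relations A \<sigma> m =
     (\<lambda>C. C \<otimes>\<^bsub>tensor_power A m\<^esub> inv\<^bsub>tensor_power A m\<^esub> (tensor_power_map A \<sigma> m C))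
       ` carrier (tensor_power A m)"

definition hochschild_chains ::
    "('k::comm_ring_1, 'a) module \<Rightarrow> ('a \<Rightarrow> 'a) \<Rightarrow> nat \<Rightarrow> ('a list \<Rightarrow>\<^sub>0 'k) set set monoid" where
  "hochschild_chains A \<sigma> n =
     tensor_power A (Suc n) Mod coinvariant_relations A \<sigma> (Suc n)"

text \<open>
  The value of the twisted differential on \<open>(a\<^sub>0, \<dots>, a\<^sub>n\<^sub>+\<^sub>1)\<close>, given as a list \<open>as\<close> of
  length \<open>n + 2\<close>.
\<close>

definition boundary_tuple ::
    "('k::comm_ring_1, 'a) module \<Rightarrow> ('a \<Rightarrow> 'a) \<Rightarrow> nat \<Rightarrow> 'a list \<Rightarrow> ('a list \<Rightarrow>\<^sub>0 'k)" where
  "boundary_tuple A \<sigma> n as =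
     (\<Sum>j\<le>n. Poly_Mapping.single
        (take j as @ [as ! j \<otimes>\<^bsub>A\<^esub> as ! Suc j] @ drop (j + 2) as) ((-1) ^ j))
     + Poly_Mapping.single
        ((\<sigma> (as ! Suc n) \<otimes>\<^bsub>A\<^esub> as ! 0) # take n (drop 1 as)) ((-1) ^ Suc n)"

text \<open>
  The differential from degree \<open>n + 1\<close> to degree \<open>n\<close>: the linear extension of
  \<open>boundary_tuple\<close> descends first to tensor powers and then to coinvariants.
\<close>

definition boundary ::
    "('k::comm_ring_1, 'a) module \<Rightarrow> ('a \<Rightarrow> 'a) \<Rightarrow> nat
      \<Rightarrow> ('a list \<Rightarrow>\<^sub>0 'k) set set \<Rightarrow> ('a list \<Rightarrow>\<^sub>0 'k) set set" where
  "boundary A \<sigma> n =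
     induced (tensor_power A (Suc n)) (coinvariant_relations A \<sigma> (Suc n))
       (induced (tuple_space A (Suc n)) (multilinear_relations A (Suc n))
         (lin_ext (boundary_tuple A \<sigma> n)))"

fun cycles ::
    "('k::comm_ring_1, 'a) module \<Rightarrow> ('a \<Rightarrow> 'a) \<Rightarrow> nat \<Rightarrow> ('a list \<Rightarrow>\<^sub>0 'k) set set set" where
  "cycles A \<sigma> 0 = carrier (hochschild_chains A \<sigma> 0)"
| "cycles A \<sigma> (Suc n) =
     kernel (hochschild_chains A \<sigma> (Suc n)) (hochschild_chains A \<sigma> n) (boundary A \<sigma> n)"

definition twisted_HH ::
    "('k::comm_ring_1, 'a) module \<Rightarrow> ('a \<Rightarrow> 'a) \<Rightarrow> nat \<Rightarrow> ('a list \<Rightarrow>\<^sub>0 'k) set set set monoid" where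
  "twisted_HH A \<sigma> n =
     (hochschild_chains A \<sigma> n)\<lparr>carrier := cycles A \<sigma> n\<rparr>
       Mod (boundary A \<sigma> n ` carrier (hochschild_chains A \<sigma> (Suc n)))"

section \<open>The coordinate algebra of a Podles quantum sphere\<close>

text \<open>
  Words form the free monoid, written additively, so that \<open>'g free_word \<Rightarrow>\<^sub>0 'k\<close> with the
  convolution product of the library is the free unital algebra on \<open>'g\<close>.
\<close>

datatype 'g free_word = Word "'g list"

instantiation free_word :: (type) monoid_add
begin

definition zero_free_word :: "'a free_word" where
  "0 = Word []"

fun plus_free_word :: "'a free_word \<Rightarrow> 'a free_word \<Rightarrow> 'a free_word" where
  "Word u + Word v = Word (u @ v)"

instance
proof
  fix a b c :: "'a free_word"
  show "a + b + c = a + (b + c)" by (cases a; cases b; cases c) simp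
  show "0 + a = a" by (cases a) (simp add: zero_free_word_def)
  show "a + 0 = a" by (cases a) (simp add: zero_free_word_def)
qed

end

datatype podles_gen = Gen_A | Gen_B | Gen_Bstar

type_synonym 'k podles_free = "podles_gen free_word \<Rightarrow>\<^sub>0 'k"

definition gen :: "podles_gen \<Rightarrow> 'k::field podles_free" where
  "gen g = Poly_Mapping.single (Word [g]) 1"

definition scalar :: "'k \<Rightarrow> 'k::field podles_free" where
  "scalar r = Poly_Mapping.single 0 r"

definition podles_relations :: "'k::field \<Rightarrow> 'k \<Rightarrow> 'k \<Rightarrow> 'k podles_free set" where
  "podles_relations q c d =
     (let A = gen Gen_A; B = gen Gen_B; Bs = gen Gen_Bstar in
      {B * A - scalar (q^2) * A * B,
       A * Bs - scalar (q^2) * Bs * A,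
       Bs * B - (scalar (c * d) + scalar (c - d) * A - A^2),
       B * Bs - (scalar (c * d) + scalar (q^2 * (c - d)) * A - scalar (q^4) * A^2)})"

definition podles_ideal :: "'k::field \<Rightarrow> 'k \<Rightarrow> 'k \<Rightarrow> 'k podles_free set" where
  "podles_ideal q c d = Idl\<^bsub>ring_of_type_algebra\<^esub> (podles_relations q c d)"

definition podles_ring :: "'k::field \<Rightarrow> 'k \<Rightarrow> 'k \<Rightarrow> 'k podles_free set ring" where
  "podles_ring q c d = ring_of_type_algebra Quot podles_ideal q c d"

definition podles_algebra :: "'k::field \<Rightarrow> 'k \<Rightarrow> 'k \<Rightarrow> ('k, 'k podles_free set) module" where
  "podles_algebra q c d = ring.extend (podles_ring q c d)
     \<lparr>module.smult = (\<lambda>r C. (podles_ideal q c d +>\<^bsub>ring_of_type_algebra\<^esub> scalar r)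
                       \<otimes>\<^bsub>podles_ring q c d\<^esub> C)\<rparr>"

end

theory Submission
  imports Defs "HOL-Library.Function_Algebras"
begin

text \<open>
  By duality it suffices to write every multilinear twisted Hochschild cocycle of degree at least 3 as
  a coboundary. The coefficient bimodule \<open>N\<close> embeds into the acyclic bimodule \<open>T\<close> of linear maps from
  the algebra to \<open>N\<close>. Linearizing the relations and then their overlaps yields a complex
  \<open>0 \<rightarrow> N \<rightarrow> T \<rightarrow> T\<^sup>3 \<rightarrow> T\<^sup>4 \<rightarrow> T\<^sup>4\<close>, exact up to the first \<open>T\<^sup>4\<close> because the monomials
  \<open>A\<^sup>i B\<^sup>j\<close>, \<open>A\<^sup>i B\<^sup>*\<^sup>j\<close> form a basis. The kernel of its last arrow is a direct summand: for
  \<open>a(x) = (c - x) (d + x)\<close> one has \<open>a' (x)\<^sup>2 + 4 a(x) = (c + d)\<^sup>2\<close>, so \<open>a\<close> and \<open>a'\<close> are coprime and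
  give a contracting homotopy. Hence dimension shifting stops after two steps.

  Passing to coinvariants is harmless, since every automorphism is diagonal in the monomial basis:
  it maps \<open>A\<close> to a normal element, and by comparing top and bottom degrees in \<open>B\<close> the normal elements are
  the scalar multiples of powers of \<open>A\<close>.
\<close>

text \<open>Exactness has a conceptual reason. Besides the bimodule structure used by the
  differential, \<open>T\<close> carries a second one, given by \<open>g t(x)\<close> and
  \<open>t(g x)\<close>, and the two commute. The elements on which its two actions agree are the
  left linear maps, that is, \<open>N\<close>. The complex begins one that computes Ext of the
  algebra, as a free left module over itself, with values in \<open>N\<close>; so only degree 0
  survives. The number \<open>(c + d)^2\<close> is the discriminant of \<open>a\<close>: the
  hypothesis on \<open>c + d\<close> says that the roots \<open>c\<close> and \<open>-d\<close> are
  distinct. Lifting along the arrows before the last one takes three contractions, each of which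
  uses up one argument of the cocycle. This is where degree 3 comes from. The obstacle with
  coinvariants is that an invariant cocycle is obtained as the coboundary of a form that has no
  reason to be invariant itself. As the twist is diagonal, a polynomial in it with nonzero value at
  1 removes the contribution of the other eigenvalues.\<close>

abbreviation "keys \<equiv> Poly_Mapping.keys"
abbreviation "lookup \<equiv> Poly_Mapping.lookup"
abbreviation "single \<equiv> Poly_Mapping.single"

section \<open>Cochains and the coinduced complex\<close>

definition lin :: "('k \<Rightarrow> 'a \<Rightarrow> 'a) \<Rightarrow> ('k \<Rightarrow> 'b \<Rightarrow> 'b) \<Rightarrow> ('a::ab_group_add \<Rightarrow> 'b::ab_group_add) \<Rightarrow> bool" where
  "lin s t f \<longleftrightarrow> (\<forall>x y. f (x + y) = f x + f y) \<and> (\<forall>r x. f (s r x) = t r (f x))"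

lemma linI: "(\<And>x y. f (x + y) = f x + f y) \<Longrightarrow> (\<And>r x. f (s r x) = t r (f x)) \<Longrightarrow> lin s t f"
  by (simp add: lin_def)

lemma lin_add: "lin s t f \<Longrightarrow> f (x + y) = f x + f y"
  and lin_scale: "lin s t f \<Longrightarrow> f (s r x) = t r (f x)"
  by (simp_all add: lin_def)

lemma lin_0: assumes "lin s t f" shows "f 0 = 0"
  using lin_add[OF assms, of 0 0] by simp

lemma lin_minus: assumes "lin s t f" shows "f (- x) = - f x"
  using lin_add[OF assms, of x "- x"] lin_0[OF assms] by (simp add: eq_neg_iff_add_eq_0 add.commute)

lemma lin_diff: assumes "lin s t f" shows "f (x - y) = f x - f y"
  using lin_add[OF assms, of x "- y"] lin_minus[OF assms, of y] by simp

lemma lin_comp: "lin s t f \<Longrightarrow> lin t u g \<Longrightarrow> lin s u (\<lambda>x. g (f x))"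
  by (simp add: lin_def)

locale twisted_algebra =
  fixes sc :: "'k::field \<Rightarrow> 'v::ab_group_add \<Rightarrow> 'v"
    and mul :: "'v \<Rightarrow> 'v \<Rightarrow> 'v" (infixl "\<star>" 70)
    and one :: 'v
    and \<sigma> :: "'v \<Rightarrow> 'v"
  assumes mul_add_left: "(u + v) \<star> w = u \<star> w + v \<star> w"
    and mul_add_right: "w \<star> (u + v) = w \<star> u + w \<star> v"
    and mul_scale_left: "sc r u \<star> v = sc r (u \<star> v)"
    and mul_scale_right: "u \<star> sc r v = sc r (u \<star> v)"
    and mul_assoc: "(u \<star> v) \<star> w = u \<star> (v \<star> w)"
    and one_left [simp]: "one \<star> v = v"
    and one_right [simp]: "v \<star> one = v"
    and twist_add: "\<sigma> (u + v) = \<sigma> u + \<sigma> v"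
    and twist_scale: "\<sigma> (sc r u) = sc r (\<sigma> u)"
    and twist_mul: "\<sigma> (u \<star> v) = \<sigma> u \<star> \<sigma> v"
begin

abbreviation "klin \<equiv> lin sc (*)"

text \<open>
  A cochain of degree \<open>m\<close> is a multilinear form on \<open>m + 1\<close> variables, the distinguished one being
  written separately. It is extended by zero to lists of the wrong length, so that equality of
  cochains is equality of functions.
\<close>

definition cochain :: "nat \<Rightarrow> ('v \<Rightarrow> 'v list \<Rightarrow> 'k) set" where
  "cochain m = {f. (\<forall>a l. length l \<noteq> m \<longrightarrow> f a l = 0) \<and> (\<forall>l. klin (\<lambda>a. f a l)) \<and>
     (\<forall>a xs ys. klin (\<lambda>b. f a (xs @ b # ys)))}"

text \<open>Cochains with values in \<open>T\<close>: \<open>x\<close> is the argument of the linear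
  map from the algebra to \<open>N\<close>, so it does not count towards the degree
  \<open>m\<close>.\<close>

definition cochain1 :: "nat \<Rightarrow> ('v \<Rightarrow> 'v \<Rightarrow> 'v list \<Rightarrow> 'k) set" where
  "cochain1 m = {G. (\<forall>x. G x \<in> cochain m) \<and> (\<forall>a l. klin (\<lambda>x. G x a l))}"

text \<open>All terms of the differential except the left action on the coefficients, up to sign.
  Only that action differs between \<open>N\<close> and \<open>T\<close>, so \<open>codiff\<close>
  and \<open>codiff1\<close> can share the rest. The recursion freezes the first argument, which
  flips the sign.\<close>

fun inner_diff :: "('v \<Rightarrow> 'v list \<Rightarrow> 'k) \<Rightarrow> 'v \<Rightarrow> 'v list \<Rightarrow> 'k" where
  "inner_diff f a [] = 0"
| "inner_diff f a [b] = f (\<sigma> b \<star> a) []"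
| "inner_diff f a (b # c # l) = f a ((b \<star> c) # l) - inner_diff (\<lambda>a l. f a (b # l)) a (c # l)"

fun codiff :: "('v \<Rightarrow> 'v list \<Rightarrow> 'k) \<Rightarrow> 'v \<Rightarrow> 'v list \<Rightarrow> 'k" where
  "codiff f a [] = 0"
| "codiff f a (b # l) = f (a \<star> b) l - inner_diff f a (b # l)"

fun codiff1 :: "('v \<Rightarrow> 'v \<Rightarrow> 'v list \<Rightarrow> 'k) \<Rightarrow> 'v \<Rightarrow> 'v \<Rightarrow> 'v list \<Rightarrow> 'k" where
  "codiff1 G x a [] = 0"
| "codiff1 G x a (b # l) = G (x \<star> b) a l - inner_diff (G x) a (b # l)"

text \<open>The standard contracting homotopy for coinduced coefficients; it is what makes
  \<open>T\<close> acyclic in positive degrees.\<close>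

definition contr :: "('v \<Rightarrow> 'v \<Rightarrow> 'v list \<Rightarrow> 'k) \<Rightarrow> 'v \<Rightarrow> 'v \<Rightarrow> 'v list \<Rightarrow> 'k" where
  "contr G x a l = G one a (x # l)"

text \<open>The embedding of \<open>N\<close> into \<open>T\<close> that sends \<open>n\<close> to
  \<open>x \<mapsto> x n\<close>.\<close>

definition coind :: "('v \<Rightarrow> 'v list \<Rightarrow> 'k) \<Rightarrow> 'v \<Rightarrow> 'v \<Rightarrow> 'v list \<Rightarrow> 'k" where
  "coind f x a l = f (a \<star> x) l"

definition lact :: "'v \<Rightarrow> ('v \<Rightarrow> 'v list \<Rightarrow> 'k) \<Rightarrow> 'v \<Rightarrow> 'v list \<Rightarrow> 'k" where
  "lact g f a l = f (a \<star> g) l"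

section \<open>Multilinearity and degree of the differentials\<close>

lemma cochainD:
  assumes "f \<in> cochain m"
  shows "length l \<noteq> m \<Longrightarrow> f a l = 0" "klin (\<lambda>a. f a l)" "klin (\<lambda>b. f a (xs @ b # ys))"
  using assms by (auto simp: cochain_def)

lemma cochain_Cons:
  assumes "f \<in> cochain (Suc m)"
  shows "(\<lambda>a l. f a (b # l)) \<in> cochain m"
proof -
  have "klin (\<lambda>c. f a (b # xs @ c # ys))" for a xs ys
    using cochainD(3)[OF assms, of a "b # xs" ys] by simp
  then show ?thesis
    using cochainD(1,2)[OF assms] by (auto simp: cochain_def)
qed

lemma cochain_head_linear:
  assumes "f \<in> cochain m"
  shows "klin (\<lambda>b. f a (b # l))"
  using cochainD(3)[OF assms, of a "[]" l] by simp

lemma cochain1D: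
  assumes "G \<in> cochain1 m"
  shows "G x \<in> cochain m" "klin (\<lambda>x. G x a l)"
  using assms by (auto simp: cochain1_def)

lemma klin_diff: "klin f \<Longrightarrow> klin g \<Longrightarrow> klin (\<lambda>x. f x - g x)"
  by (simp add: lin_def algebra_simps)

lemma klin_add: "klin f \<Longrightarrow> klin g \<Longrightarrow> klin (\<lambda>x. f x + g x)"
  by (simp add: lin_def algebra_simps)

lemma klin_scale: "klin f \<Longrightarrow> klin (\<lambda>x. r * f x)"
  by (simp add: lin_def algebra_simps)

lemma klin_zero: "klin (\<lambda>x. 0)"
  by (simp add: lin_def)

lemma klin_mul_right: "klin f \<Longrightarrow> klin (\<lambda>x. f (x \<star> y))"
  by (simp add: lin_def mul_add_left mul_scale_left)

lemma klin_mul_left: "klin f \<Longrightarrow> klin (\<lambda>x. f (y \<star> x))"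
  by (simp add: lin_def mul_add_right mul_scale_right)

lemma klin_twist: "klin f \<Longrightarrow> klin (\<lambda>x. f (\<sigma> x))"
  by (simp add: lin_def twist_add twist_scale)

lemma inner_diff_param_linear:
  assumes "\<And>a l. klin (\<lambda>x. H x a l)"
  shows "klin (\<lambda>x. inner_diff (H x) a l)"
  using assms
proof (induction l arbitrary: H)
  case (Cons b l)
  show ?case
  proof (cases l)
    case (Cons c l')
    then show ?thesis
      using Cons.IH[of "\<lambda>x a l. H x a (b # l)"] Cons.prems by (auto intro!: klin_diff)
  qed (use Cons.prems in auto)
qed (simp add: klin_zero)

lemma inner_diff_linear:
  assumes "\<And>l. klin (\<lambda>a. f a l)"
  shows "klin (\<lambda>a. inner_diff f a l)"
  using assms
proof (induction l arbitrary: f)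
  case (Cons b l)
  show ?case
  proof (cases l)
    case Nil
    then show ?thesis using Cons.prems by (auto intro!: klin_mul_left)
  next
    case (Cons c l')
    then show ?thesis
      using Cons.IH[of "\<lambda>a l. f a (b # l)"] Cons.prems by (auto intro!: klin_diff)
  qed
qed (simp add: klin_zero)

lemma inner_diff_multilinear:
  assumes "f \<in> cochain m"
  shows "klin (\<lambda>b. inner_diff f a (xs @ b # ys))"
  using assms
proof (induction xs arbitrary: f m)
  case Nil
  show ?case
  proof (cases ys)
    case Nil
    then show ?thesis
      using cochainD(2)[OF \<open>f \<in> cochain m\<close>]
      by (auto intro!: klin_mul_right klin_twist[where f = "\<lambda>x. f (x \<star> a) []"])
  next
    case (Cons c l)
    have "klin (\<lambda>b. inner_diff (\<lambda>a l. f a (b # l)) a (c # l))"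
      by (rule inner_diff_param_linear) (rule cochain_head_linear[OF \<open>f \<in> cochain m\<close>])
    then show ?thesis
      using Cons cochain_head_linear[OF \<open>f \<in> cochain m\<close>]
      by (auto intro!: klin_diff klin_mul_right[where f = "\<lambda>x. f a (x # l)"])
  qed
next
  case (Cons x xs)
  have head: "klin (\<lambda>b. f a ((x \<star> b) # ys))"
    using cochain_head_linear[OF Cons.prems, of a ys] by (rule klin_mul_left)
  have mid: "klin (\<lambda>b. f a (z # zs @ b # ys))" for z zs
    using cochainD(3)[OF Cons.prems, of a "z # zs" ys] by simp
  have "klin (\<lambda>b. inner_diff (\<lambda>a l. f a (x # l)) a (xs @ b # ys))"
  proof (cases m)
    \<comment> \<open>A cochain of degree 0 vanishes on nonempty lists, so freezing an argument
      gives the zero cochain, which again has degree 0.\<close>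
    case 0
    then have "(\<lambda>a l. f a (x # l)) \<in> cochain 0"
      using cochainD[OF Cons.prems] by (auto simp: cochain_def klin_zero)
    then show ?thesis by (rule Cons.IH)
  next
    case (Suc k)
    then show ?thesis using Cons.IH cochain_Cons Cons.prems by blast
  qed
  then show ?case
    using head mid by (cases xs) (auto intro!: klin_diff)
qed

lemma inner_diff_length:
  assumes "\<And>a l. length l \<noteq> m \<Longrightarrow> f a l = 0" "length l \<noteq> Suc m"
  shows "inner_diff f a l = 0"
  using assms
proof (induction l arbitrary: f m)
  case (Cons b l)
  show ?case
  proof (cases l)
    case Nil
    then show ?thesis using Cons.prems by simp
  next
    case (Cons c l')
    have "inner_diff (\<lambda>a l. f a (b # l)) a l = 0"
    proof (cases m)
      case 0
      then show ?thesis
        using Cons.IH[of 0 "\<lambda>a l. f a (b # l)"] Cons.IH[of "Suc (length l)" "\<lambda>a l. f a (b # l)"]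
          Cons.prems by simp
    next
      case (Suc k)
      then show ?thesis using Cons.IH[of k "\<lambda>a l. f a (b # l)"] Cons.prems by simp
    qed
    then show ?thesis using Cons Cons.prems by simp
  qed
qed simp

text \<open>The twisted right action multiplies \<open>a\<close> from the left and
  \<open>lact\<close> multiplies it from the right, so the two commute by associativity.\<close>

lemma inner_diff_lact: "inner_diff (lact g f) a l = inner_diff f (a \<star> g) l"
proof (induction l arbitrary: f)
  case (Cons b l)
  then show ?case
    using Cons.IH[of "\<lambda>a l. f a (b # l)"]
    by (cases l) (simp_all add: lact_def mul_assoc)
qed simp

lemma coind_eq_lact: "coind f x = lact x f"
  by (simp add: fun_eq_iff coind_def lact_def)

lemma inner_diff_add: "inner_diff (\<lambda>a l. f a l + h a l) a l = inner_diff f a l + inner_diff h a l"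
proof (induction l arbitrary: f h)
  case (Cons b l)
  then show ?case
    using Cons.IH[of "\<lambda>a l. f a (b # l)" "\<lambda>a l. h a (b # l)"] by (cases l) simp_all
qed simp

lemma inner_diff_scale: "inner_diff (\<lambda>a l. r * f a l) a l = r * inner_diff f a l"
proof (induction l arbitrary: f)
  case (Cons b l)
  then show ?case
    using Cons.IH[of "\<lambda>a l. f a (b # l)"] by (cases l) (simp_all add: algebra_simps)
qed simp

text \<open>Every face of a list with at least two entries still has an entry, so values at the
  empty list do not enter. The homotopy identity \<open>codiff1_contr\<close> is available only away
  from the empty list.\<close>

lemma inner_diff_cong:
  assumes "2 \<le> length l" "\<And>a l. l \<noteq> [] \<Longrightarrow> f a l = g a l"
  shows "inner_diff f a l = inner_diff g a l"
  using assms
proof (induction l arbitrary: f g)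
  case (Cons b l)
  then obtain c l' where l: "l = c # l'" by (cases l) auto
  show ?case
  proof (cases l')
    case Nil
    then show ?thesis using Cons.prems l by simp
  next
    case (Cons e l'')
    then show ?thesis
      using Cons.IH[of "\<lambda>a l. f a (b # l)" "\<lambda>a l. g a (b # l)"] Cons.prems l by simp
  qed
qed simp

lemma codiff_cochain:
  assumes "f \<in> cochain m"
  shows "codiff f \<in> cochain (Suc m)"
proof -
  have "codiff f a l = 0" if "length l \<noteq> Suc m" for a l
    using that cochainD(1)[OF assms] inner_diff_length[of m f l a] by (cases l) auto
  moreover have "klin (\<lambda>a. codiff f a l)" for l
    using cochainD(2)[OF assms] inner_diff_linear[of f l]
    by (cases l) (auto intro!: klin_diff klin_zero klin_mul_right)
  moreover have "klin (\<lambda>b. codiff f a (xs @ b # ys))" for a xs ys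
  proof (cases xs)
    case Nil
    then show ?thesis
      using cochainD(2)[OF assms] inner_diff_multilinear[OF assms, of a "[]" ys]
      by (auto intro!: klin_diff klin_mul_left)
  next
    case (Cons x xs')
    then show ?thesis
      using cochainD(3)[OF assms] inner_diff_multilinear[OF assms, of a "x # xs'" ys]
      by (auto intro!: klin_diff)
  qed
  ultimately show ?thesis by (auto simp: cochain_def)
qed

lemma codiff1_cochain1:
  assumes "G \<in> cochain1 m"
  shows "codiff1 G \<in> cochain1 (Suc m)"
proof -
  note Gx = cochain1D(1)[OF assms] and Glin = cochain1D(2)[OF assms]
  have "codiff1 G x a l = 0" if "length l \<noteq> Suc m" for x a l
    using that cochainD(1)[OF Gx] inner_diff_length[of m "G x" l a] by (cases l) auto
  moreover have "klin (\<lambda>a. codiff1 G x a l)" for x l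
    using cochainD(2)[OF Gx] inner_diff_linear[of "G x" l]
    by (cases l) (auto intro!: klin_diff klin_zero)
  moreover have "klin (\<lambda>b. codiff1 G x a (xs @ b # ys))" for x a xs ys
  proof (cases xs)
    case Nil
    then show ?thesis
      using Glin inner_diff_multilinear[OF Gx, of x a "[]" ys]
      by (auto intro!: klin_diff klin_mul_left)
  next
    case (Cons y xs')
    then show ?thesis
      using cochainD(3)[OF Gx] inner_diff_multilinear[OF Gx, of x a "y # xs'" ys]
      by (auto intro!: klin_diff)
  qed
  moreover have "klin (\<lambda>x. codiff1 G x a l)" for a l
    using Glin inner_diff_param_linear[of G a l]
    by (cases l) (auto intro!: klin_diff klin_zero klin_mul_right)
  ultimately show ?thesis by (auto simp: cochain1_def cochain_def)
qed

section \<open>Acyclicity of coinduced cochains\<close>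

lemma coind_cochain1:
  assumes "f \<in> cochain m"
  shows "coind f \<in> cochain1 m"
  using cochainD[OF assms]
  by (auto simp: cochain1_def cochain_def coind_def intro!: klin_mul_left klin_mul_right)

lemma contr_cochain1:
  assumes "G \<in> cochain1 (Suc m)"
  shows "contr G \<in> cochain1 m"
proof -
  note c = cochain1D(1)[OF assms, of one]
  show ?thesis
    using cochain_Cons[OF c] cochain_head_linear[OF c]
    by (auto simp: cochain1_def contr_def[abs_def])
qed

lemma codiff1_coind: "codiff1 (coind f) = coind (codiff f)"
proof (intro ext)
  fix x a l
  show "codiff1 (coind f) x a l = coind (codiff f) x a l"
    by (cases l) (simp_all add: coind_eq_lact inner_diff_lact, simp_all add: lact_def mul_assoc)
qed

text \<open>All terms of the two summands cancel except one: the left action on \<open>one\<close>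
  in the second summand, which turns \<open>G one\<close> into \<open>G x\<close>.\<close>

lemma codiff1_contr:
  assumes "l \<noteq> []"
  shows "codiff1 (contr G) x a l + contr (codiff1 G) x a l = G x a l"
proof -
  obtain b l' where "l = b # l'" using assms by (cases l) auto
  then show ?thesis by (simp add: contr_def[abs_def])
qed

lemma codiff1_contr':
  assumes "G \<in> cochain1 (Suc m)" "codiff1 G = 0"
  shows "codiff1 (contr G) = G"
proof (intro ext)
  fix x a l
  show "codiff1 (contr G) x a l = G x a l"
  proof (cases l)
    case Nil
    then show ?thesis using cochainD(1)[OF cochain1D(1)[OF assms(1)]] by simp
  next
    case (Cons b l')
    then show ?thesis using codiff1_contr[of l G x a] assms(2) by (simp add: contr_def)
  qed
qed

lemma codiff1_add: "codiff1 (G + H) = codiff1 G + codiff1 H"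
proof (intro ext)
  show "codiff1 (G + H) x a l = (codiff1 G + codiff1 H) x a l" for x a l
    using inner_diff_add[of "G x" "H x"] by (cases l) (auto simp: plus_fun_def)
qed

lemma codiff1_diff: "codiff1 (G - H) = codiff1 G - codiff1 H"
  using codiff1_add[of "G - H" H] by (simp add: algebra_simps)

text \<open>Write \<open>d\<close> for \<open>codiff1\<close>. Instead of pairing double faces, the
  homotopy identity is used twice: it reduces \<open>contr (d (d H)) = 0\<close> to
  \<open>d (d (contr H)) = 0\<close> on a shorter list, so induction on the length applies.\<close>

lemma codiff1_squared: "codiff1 (codiff1 G) = 0"
proof -
  have "codiff1 (codiff1 G) x a l = 0" for x a l
  proof (induction l arbitrary: G x a rule: length_induct)
    case (1 l)
    then have IH: "codiff1 (codiff1 G) x a l' = 0" if "length l' < length l" for G x a l'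
      using that by blast
    show ?case
    proof (cases l)
      case (Cons b l')
      show ?thesis
      proof (cases l')
        case Nil
        then show ?thesis using Cons by simp
      next
        case l': (Cons c l'')
        show ?thesis
        proof (cases l'')
          case Nil
          then show ?thesis using Cons l' by (simp add: mul_assoc twist_mul)
        next
          case l'': (Cons e l3)
          text \<open>Translate \<open>x\<close> to \<open>one\<close>, where the contraction lowers the number of arguments.\<close>
          define H where "H y = G (x \<star> y)" for y
          have step: "codiff1 (\<lambda>y. K (x \<star> y)) = (\<lambda>y. codiff1 K (x \<star> y))" for K
          proof (intro ext)
            show "codiff1 (\<lambda>y. K (x \<star> y)) y a l = codiff1 K (x \<star> y) a l" for y a l
              by (cases l) (auto simp: mul_assoc)
          qed
          have "codiff1 (codiff1 H) = (\<lambda>y. codiff1 (codiff1 G) (x \<star> y))"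
            unfolding H_def[abs_def] step ..
          then have 1: "codiff1 (codiff1 G) x a l = codiff1 (codiff1 H) one a (b # l')"
            by (simp only: one_right Cons)
          have ne: "l' \<noteq> []" using l' by simp
          have 2: "codiff1 (contr (codiff1 H)) b a l' + codiff1 (codiff1 H) one a (b # l') = codiff1 H b a l'"
            using codiff1_contr[OF ne, of "codiff1 H" b a] unfolding contr_def[of "codiff1 (codiff1 H)"] .
          have eq: "(contr (codiff1 H) + codiff1 (contr H)) x a l = H x a l" if "l \<noteq> []" for x a l
            using codiff1_contr[OF that, of H x a] by (simp only: plus_fun_apply add.commute)
          have "inner_diff ((contr (codiff1 H) + codiff1 (contr H)) b) a l' = inner_diff (H b) a l'"
            by (rule inner_diff_cong) (simp add: l' l'', rule eq)
          then have "codiff1 (contr (codiff1 H) + codiff1 (contr H)) b a l' = codiff1 H b a l'"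
            using eq[of l'' "b \<star> c" a] l'' unfolding l' by (simp only: codiff1.simps list.distinct not_False_eq_True)
          then have 3: "codiff1 (contr (codiff1 H)) b a l' + codiff1 (codiff1 (contr H)) b a l' = codiff1 H b a l'"
            unfolding codiff1_add plus_fun_apply .
          have 4: "codiff1 (codiff1 (contr H)) b a l' = 0"
            using IH Cons by (simp only: list.size lessI)
          from 1 2 3 4 show ?thesis by (metis add_left_cancel)
        qed
      qed
    qed simp
  qed
  then show ?thesis by (simp add: fun_eq_iff)
qed

end

section \<open>The small complex of the Podles algebra\<close>

definition fscale :: "'k::field \<Rightarrow> ('v \<Rightarrow> 'v list \<Rightarrow> 'k) \<Rightarrow> 'v \<Rightarrow> 'v list \<Rightarrow> 'k" where
  "fscale r f a l = r * f a l"

text \<open>The element \<open>w j\<close> stands for \<open>B^j\<close> if \<open>j \<ge> 0\<close>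
  and for \<open>S^(-j)\<close> otherwise. The last two assumptions say that the algebra is a free
  left module over the polynomials in \<open>A\<close> with basis \<open>w j\<close>:
  \<open>algebra_induct\<close> gives generation and \<open>algebra_extend\<close> freeness. The
  inhomogeneous term \<open>x\<close> in the latter serves to solve the recursions of the exactness
  proofs.\<close>

locale podles_twisted = twisted_algebra sc mul one \<sigma>
  for sc :: "'k::field \<Rightarrow> 'v::ab_group_add \<Rightarrow> 'v" and mul (infixl "\<star>" 70) and one \<sigma> +
  fixes A B S :: 'v and w :: "int \<Rightarrow> 'v" and q c d :: 'k
  assumes q_nonzero: "q \<noteq> 0"
    and cd_nonzero: "c + d \<noteq> 0"
    and sc_sc: "sc r (sc r' u) = sc (r * r') u"
    and sc_1: "sc 1 u = u"
    and BA: "B \<star> A = sc (q^2) (A \<star> B)"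
    and AS: "A \<star> S = sc (q^2) (S \<star> A)"
    and SB: "S \<star> B = sc (c * d) one + sc (c - d) A - A \<star> A"
    and BS: "B \<star> S = sc (c * d) one + sc (q^2 * (c - d)) A - sc (q^4) (A \<star> A)"
    and w_0: "w 0 = one"
    and w_pos: "j \<ge> 0 \<Longrightarrow> w (j + 1) = B \<star> w j"
    and w_neg: "j \<le> 0 \<Longrightarrow> w (j - 1) = S \<star> w j"
    and algebra_induct: "\<lbrakk>\<And>u v. P u \<Longrightarrow> P v \<Longrightarrow> P (u + v); \<And>r u. P u \<Longrightarrow> P (sc r u);
      \<And>u. P u \<Longrightarrow> P (A \<star> u); \<And>j. P (w j)\<rbrakk> \<Longrightarrow> P u"
    and algebra_extend: "\<lbrakk>lin fscale fscale (p :: ('v \<Rightarrow> 'v list \<Rightarrow> 'k) \<Rightarrow> 'v \<Rightarrow> 'v list \<Rightarrow> 'k); lin sc fscale x\<rbrakk> \<Longrightarrow>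
      \<exists>\<phi>. lin sc fscale \<phi> \<and> (\<forall>u. \<phi> (A \<star> u) = p (\<phi> u) + x u) \<and> (\<forall>j. \<phi> (w j) = v j)"
begin

lemma mul_diff_right: "t \<star> (u - v) = t \<star> u - t \<star> v"
  using mul_add_right[of t "u - v" v] by (simp add: algebra_simps)

lemma mul_diff_left: "(u - v) \<star> t = u \<star> t - v \<star> t"
  using mul_add_left[of "u - v" v t] by (simp add: algebra_simps)

lemma BA': "B \<star> (A \<star> u) = sc (q^2) (A \<star> (B \<star> u))"
  by (metis BA mul_assoc mul_scale_left)

lemma AS': "A \<star> (S \<star> u) = sc (q^2) (S \<star> (A \<star> u))"
  by (metis AS mul_assoc mul_scale_left)

lemma SB': "S \<star> (B \<star> u) = sc (c * d) u + sc (c - d) (A \<star> u) - A \<star> (A \<star> u)"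
  by (simp add: mul_assoc[symmetric] SB mul_add_left mul_diff_left mul_scale_left)

lemma BS': "B \<star> (S \<star> u) = sc (c * d) u + sc (q^2 * (c - d)) (A \<star> u) - sc (q^4) (A \<star> (A \<star> u))"
  by (simp add: mul_assoc[symmetric] BS mul_add_left mul_diff_left mul_scale_left)

text \<open>Rewriting with \<open>AS\<close> and with \<open>SB\<close> resolves
  \<open>A S B\<close> in two ways. This rule closes that critical pair, so that
  \<open>mul_normal\<close> brings the words that occur below to a common form.\<close>

lemma SAB': "S \<star> (A \<star> (B \<star> u)) = sc (1 / q^2) (A \<star> (S \<star> (B \<star> u)))"
  by (simp add: AS' q_nonzero sc_sc sc_1)

lemma SAB: "S \<star> (A \<star> B) = sc (1 / q^2) (A \<star> (S \<star> B))"
  using SAB'[of one] by simp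

lemmas mul_normal = SAB SAB' BA AS SB BS BA' AS' SB' BS' mul_assoc mul_add_right mul_add_left mul_diff_right
  mul_diff_left mul_scale_left mul_scale_right

definition scl :: "'k \<Rightarrow> ('v \<Rightarrow> 'v \<Rightarrow> 'v list \<Rightarrow> 'k) \<Rightarrow> 'v \<Rightarrow> 'v \<Rightarrow> 'v list \<Rightarrow> 'k" where
  "scl r G x = fscale r (G x)"

definition lmul :: "'v \<Rightarrow> ('v \<Rightarrow> 'v \<Rightarrow> 'v list \<Rightarrow> 'k) \<Rightarrow> 'v \<Rightarrow> 'v \<Rightarrow> 'v list \<Rightarrow> 'k" where
  "lmul g G x = lact g (G x)"

definition rmul :: "'v \<Rightarrow> ('v \<Rightarrow> 'v \<Rightarrow> 'v list \<Rightarrow> 'k) \<Rightarrow> 'v \<Rightarrow> 'v \<Rightarrow> 'v list \<Rightarrow> 'k" where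
  "rmul g G x = G (g \<star> x)"

text \<open>
  With \<open>(g x)(u) = g \<cdot> x(u)\<close> (\<open>lmul\<close>) and \<open>(x g)(u) = x(g u)\<close> (\<open>rmul\<close>), the maps \<open>rel\<close> are the
  linearized defining relations at a derivation with values \<open>x\<close>, \<open>y\<close>, \<open>z\<close> on the generators, and
  the maps \<open>syz\<close> come from the overlaps \<open>B\<^sup>*BA\<close>, \<open>BB\<^sup>*A\<close> (multiplied by \<open>q\<^sup>2\<close>), \<open>BB\<^sup>*B\<close> and
  \<open>B\<^sup>*BB\<^sup>*\<close>. The maps \<open>split\<close> are \<open>(c + d)\<^sup>2\<close> times the homotopy built from \<open>a' a' + 4 a = (c + d)\<^sup>2\<close>.
\<close>

definition rel1 where "rel1 x y = rmul A y + lmul B x - scl (q^2) (rmul B x + lmul A y)"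
definition rel2 where "rel2 x z = rmul S x + lmul A z - scl (q^2) (rmul A z + lmul S x)"
definition rel3 where "rel3 x y z = rmul B z + lmul S y - scl (c - d) x + rmul A x + lmul A x"
definition rel4 where "rel4 x y z = rmul S y + lmul B z - scl (q^2 * (c - d)) x + scl (q^4) (rmul A x + lmul A x)"

definition syz1 where "syz1 r1 r2 r3 = rmul A r3 - lmul A r3 + rmul B r2 - lmul S r1"
definition syz2 where "syz2 r1 r2 r4 = scl (q^2) (rmul A r4 - lmul A r4) - rmul S r1 + lmul B r2"
definition syz3 where "syz3 r1 r3 r4 = rmul B r4 - lmul B r3 - scl (c - d) r1 + scl (q^2) (lmul A r1) + rmul A r1"
definition syz4 where "syz4 r2 r3 r4 = rmul S r3 - lmul S r4 + scl (c - d) r2 - lmul A r2 - scl (q^2) (rmul A r2)"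

definition split1 where "split1 s1 s3 = scl (2 * q^2) (lmul A s3) - scl (c - d) s3 - scl 4 (lmul B s1)"
definition split2 where "split2 s4 = scl (c - d) s4 - scl 2 (lmul A s4)"
definition split3 where "split3 s1 = scl (c - d) s1 - scl 2 (lmul A s1)"
definition split4 where "split4 s2 s4 = scl (c - d) s2 - scl (2 * q^2) (lmul A s2) - scl 4 (lmul B s4)"

lemmas op_defs = scl_def lmul_def rmul_def fscale_def lact_def
lemmas rel_defs = rel1_def rel2_def rel3_def rel4_def
lemmas syz_defs = syz1_def syz2_def syz3_def syz4_def
lemmas split_defs = split1_def split2_def split3_def split4_def

lemma cochain1_linear:
  assumes "G \<in> cochain1 m"
  shows "G (u + v) a l = G u a l + G v a l" "G (u - v) a l = G u a l - G v a l"
    "G (sc r u) a l = r * G u a l"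
    "G u (a + b) l = G u a l + G u b l" "G u (a - b) l = G u a l - G u b l" "G u (sc r a) l = r * G u a l"
  using lin_add[OF cochain1D(2)[OF assms]] lin_diff[OF cochain1D(2)[OF assms]]
    lin_scale[OF cochain1D(2)[OF assms]] lin_add[OF cochainD(2)[OF cochain1D(1)[OF assms]]]
    lin_diff[OF cochainD(2)[OF cochain1D(1)[OF assms]]] lin_scale[OF cochainD(2)[OF cochain1D(1)[OF assms]]]
  by auto

lemma cochain1_lin: "G \<in> cochain1 m \<longleftrightarrow> (\<forall>x. G x \<in> cochain m) \<and> lin sc fscale G"
  by (auto simp: cochain1_def lin_def fun_eq_iff fscale_def)

lemma cochain_fscale: "f \<in> cochain m \<Longrightarrow> fscale r f \<in> cochain m"
  and cochain_add: "f \<in> cochain m \<Longrightarrow> f' \<in> cochain m \<Longrightarrow> f + f' \<in> cochain m"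
  and cochain_diff: "f \<in> cochain m \<Longrightarrow> f' \<in> cochain m \<Longrightarrow> f - f' \<in> cochain m"
  and cochain_zero: "0 \<in> cochain m"
  and cochain_lact: "f \<in> cochain m \<Longrightarrow> lact g f \<in> cochain m"
  by (auto simp: cochain_def fscale_def[abs_def] lact_def[abs_def] intro!: klin_diff klin_add klin_scale klin_zero klin_mul_right)

lemma cochain1_scl: "G \<in> cochain1 m \<Longrightarrow> scl r G \<in> cochain1 m"
  and cochain1_add: "G \<in> cochain1 m \<Longrightarrow> H \<in> cochain1 m \<Longrightarrow> G + H \<in> cochain1 m"
  and cochain1_diff: "G \<in> cochain1 m \<Longrightarrow> H \<in> cochain1 m \<Longrightarrow> G - H \<in> cochain1 m"
  and cochain1_zero: "0 \<in> cochain1 m"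
  and cochain1_lmul: "G \<in> cochain1 m \<Longrightarrow> lmul g G \<in> cochain1 m"
  and cochain1_rmul: "G \<in> cochain1 m \<Longrightarrow> rmul g G \<in> cochain1 m"
  by (auto simp: cochain1_def scl_def lmul_def rmul_def fscale_def lact_def
      intro!: cochain_fscale cochain_add cochain_diff cochain_zero cochain_lact klin_add klin_diff klin_scale klin_zero klin_mul_left)

lemmas cochain1_closed = cochain1_scl cochain1_add cochain1_diff cochain1_zero cochain1_lmul cochain1_rmul
lemmas cochain_closed = cochain_fscale cochain_add cochain_diff cochain_zero cochain_lact

lemma codiff1_scl: "codiff1 (scl r G) = scl r (codiff1 G)"
proof (intro ext)
  show "codiff1 (scl r G) x a l = scl r (codiff1 G) x a l" for x a l
    using inner_diff_scale[of r "G x" a]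
    by (cases l) (auto simp: scl_def fscale_def[abs_def] algebra_simps)
qed

lemma codiff1_lmul: "codiff1 (lmul g G) = lmul g (codiff1 G)"
proof (intro ext)
  show "codiff1 (lmul g G) x a l = lmul g (codiff1 G) x a l" for x a l
    using inner_diff_lact[of g "G x" a]
    by (cases l) (auto simp: lmul_def lact_def[of g "codiff1 _ _"] lact_def[of g "G (_ \<star> _)"])
qed

lemma codiff1_rmul: "codiff1 (rmul g G) = rmul g (codiff1 G)"
proof (intro ext)
  show "codiff1 (rmul g G) x a l = rmul g (codiff1 G) x a l" for x a l
    by (cases l) (auto simp: rmul_def mul_assoc)
qed

lemmas codiff1_ops = codiff1_scl codiff1_lmul codiff1_rmul codiff1_add codiff1_diff

section \<open>Composites in the small complex and its homotopy\<close>

lemma rel_bimodule_derivation: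
  assumes "G \<in> cochain1 m"
  defines "x \<equiv> rmul A G - lmul A G" and "y \<equiv> rmul B G - lmul B G" and "z \<equiv> rmul S G - lmul S G"
  shows "rel1 x y = 0" "rel2 x z = 0" "rel3 x y z = 0" "rel4 x y z = 0"
  unfolding fun_eq_iff x_def y_def z_def rel_defs
  by (simp_all add: op_defs mul_normal cochain1_linear[OF assms(1)] algebra_simps)

text \<open>An overlap reduces in two ways, and \<open>syz\<close> is the linearized comparison of
  the two reductions; hence it vanishes on linearized relations that come from actual values on the
  generators.\<close>

lemma syz_rel:
  assumes "x \<in> cochain1 m" "y \<in> cochain1 m" "z \<in> cochain1 m"
  shows "syz1 (rel1 x y) (rel2 x z) (rel3 x y z) = 0" "syz2 (rel1 x y) (rel2 x z) (rel4 x y z) = 0"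
    "syz3 (rel1 x y) (rel3 x y z) (rel4 x y z) = 0" "syz4 (rel2 x z) (rel3 x y z) (rel4 x y z) = 0"
  unfolding fun_eq_iff rel_defs syz_defs
  by (simp_all add: op_defs mul_normal cochain1_linear[OF assms(1)] cochain1_linear[OF assms(2)]
      cochain1_linear[OF assms(3)] algebra_simps)

text \<open>The \<open>s\<close> obey further syzygies of the same shape as the relations, for
  instance \<open>rel3 s1 s3 s4 = 0\<close>. In the first line, \<open>4 S B s1\<close> contributes
  \<open>4 a(A) s1\<close>, and this identity turns the remaining terms into
  \<open>a'(A) a'(A) s1\<close>; the sum is the discriminant times \<open>s1\<close>. The other
  lines use analogous identities.\<close>

lemma syz_split:
  assumes "r1 \<in> cochain1 m" "r2 \<in> cochain1 m" "r3 \<in> cochain1 m" "r4 \<in> cochain1 m"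
  defines "s1 \<equiv> syz1 r1 r2 r3" and "s2 \<equiv> syz2 r1 r2 r4" and "s3 \<equiv> syz3 r1 r3 r4" and "s4 \<equiv> syz4 r2 r3 r4"
  shows "syz1 (split1 s1 s3) (split2 s4) (split3 s1) = scl ((c + d)^2) s1"
    "syz2 (split1 s1 s3) (split2 s4) (split4 s2 s4) = scl ((c + d)^2) s2"
    "syz3 (split1 s1 s3) (split3 s1) (split4 s2 s4) = scl ((c + d)^2) s3"
    "syz4 (split2 s4) (split3 s1) (split4 s2 s4) = scl ((c + d)^2) s4"
  unfolding fun_eq_iff s1_def s2_def s3_def s4_def syz_defs split_defs
  by (simp_all add: op_defs mul_normal cochain1_linear[OF assms(1)] cochain1_linear[OF assms(2)]
      cochain1_linear[OF assms(3)] cochain1_linear[OF assms(4)] algebra_simps power2_eq_square power4_eq_xxxx) (simp_all add: field_simps q_nonzero)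

end

section \<open>Exactness of the small complex\<close>

lemma int_recursion_exists:
  "\<exists>v :: int \<Rightarrow> 'a. v 0 = b \<and> (\<forall>j\<ge>0. v (j + 1) = f j (v j)) \<and> (\<forall>j\<le>0. v (j - 1) = g j (v j))"
proof -
  define up where "up = rec_nat b (\<lambda>n. f (int n))"
  define down where "down = rec_nat b (\<lambda>n. g (- int n))"
  have up: "up 0 = b" "up (Suc n) = f (int n) (up n)" for n by (simp_all add: up_def)
  have down: "down 0 = b" "down (Suc n) = g (- int n) (down n)" for n by (simp_all add: down_def)
  define v where "v j = (if j \<ge> 0 then up (nat j) else down (nat (- j)))" for j
  have "v (j + 1) = f j (v j)" if "j \<ge> 0" for j
    using that up(2)[of "nat j"] by (simp add: v_def nat_add_distrib)
  moreover have "v (j - 1) = g j (v j)" if "j \<le> 0" for j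
  proof -
    have "nat (1 - j) = Suc (nat (- j))" using that by simp
    then show ?thesis using that down(2)[of "nat (- j)"] up(1) down(1) by (auto simp: v_def)
  qed
  ultimately show ?thesis using up(1) by (intro exI[of _ v]) (simp add: v_def)
qed

lemma if_mem: "x \<in> I \<Longrightarrow> y \<in> I \<Longrightarrow> (if b then x else y) \<in> I"
  by simp

context podles_twisted
begin

lemma rel_diff:
  "rel1 (x - x') (y - y') = rel1 x y - rel1 x' y'" "rel2 (x - x') (z - z') = rel2 x z - rel2 x' z'"
  "rel3 (x - x') (y - y') (z - z') = rel3 x y z - rel3 x' y' z'"
  "rel4 (x - x') (y - y') (z - z') = rel4 x y z - rel4 x' y' z'"
  by (simp_all add: fun_eq_iff rel_defs op_defs algebra_simps)

lemma syz_diff: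
  "syz1 (r1 - r1') (r2 - r2') (r3 - r3') = syz1 r1 r2 r3 - syz1 r1' r2' r3'"
  "syz2 (r1 - r1') (r2 - r2') (r4 - r4') = syz2 r1 r2 r4 - syz2 r1' r2' r4'"
  "syz3 (r1 - r1') (r3 - r3') (r4 - r4') = syz3 r1 r3 r4 - syz3 r1' r3' r4'"
  "syz4 (r2 - r2') (r3 - r3') (r4 - r4') = syz4 r2 r3 r4 - syz4 r2' r3' r4'"
  by (simp_all add: fun_eq_iff syz_defs op_defs algebra_simps)

text \<open>Meant for the error \<open>e\<close> of an equation for \<open>B\<close> and the error
  \<open>e'\<close> of an equation for \<open>S\<close>. A recursion along the \<open>w j\<close>
  can enforce the first only for \<open>j \<ge> 0\<close> and the second only for
  \<open>j \<le> 0\<close>. The other indices follow because \<open>B\<close> and \<open>S\<close>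
  exchange the two errors, and \<open>A\<close> then carries the vanishing to the whole
  algebra.\<close>

lemma cochain1_vanish:
  assumes "e \<in> cochain1 m" "e' \<in> cochain1 m"
    and A: "\<And>u. e u = 0 \<Longrightarrow> e (A \<star> u) = 0" "\<And>u. e' u = 0 \<Longrightarrow> e' (A \<star> u) = 0"
    and B: "\<And>u. e u = 0 \<Longrightarrow> e' (B \<star> u) = 0" and S: "\<And>u. e' u = 0 \<Longrightarrow> e (S \<star> u) = 0"
    and w: "\<And>j. j \<ge> 0 \<Longrightarrow> e (w j) = 0" "\<And>j. j \<le> 0 \<Longrightarrow> e' (w j) = 0"
  shows "e = 0" "e' = 0"
proof -
  have *: "h u = 0" if "h \<in> cochain1 m" "\<And>u. h u = 0 \<Longrightarrow> h (A \<star> u) = 0" "\<And>j. h (w j) = 0" for h u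
  proof (induction u rule: algebra_induct)
    case (1 u v)
    then show ?case using cochain1_linear(1)[OF that(1)] by (simp add: fun_eq_iff)
  next
    case (2 r u)
    then show ?case using cochain1_linear(3)[OF that(1)] by (simp add: fun_eq_iff)
  qed (rule that(2), assumption, rule that(3))
  have "e (w j) = 0" for j
  proof (cases "j \<ge> 0")
    case False
    have "e (w (i - 1)) = 0" if "i \<le> 0" for i
      unfolding w_neg[OF that] using S[OF w(2)[OF that]] .
    from this[of "j + 1"] False show ?thesis by simp
  qed (use w in auto)
  then have "e u = 0" for u using *[OF assms(1) A(1)] by blast
  then show "e = 0" by (intro ext[of e]) (simp only: zero_fun_apply)
  have "e' (w j) = 0" for j
  proof (cases "j \<le> 0")
    case False
    have "e' (w (i + 1)) = 0" if "i \<ge> 0" for i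
      unfolding w_pos[OF that] using B[OF w(1)[OF that]] .
    from this[of "j - 1"] False show ?thesis by simp
  qed (use w in auto)
  then have "e' u = 0" for u using *[OF assms(2) A(2)] by blast
  then show "e' = 0" by (intro ext[of e']) (simp only: zero_fun_apply)
qed

lemma algebra_extend_cochain:
  assumes "lin fscale fscale p" "\<And>f. f \<in> cochain m \<Longrightarrow> p f \<in> cochain m" "x \<in> cochain1 m"
    and "\<And>j. v j \<in> cochain m"
  shows "\<exists>\<phi>\<in>cochain1 m. (\<forall>u. \<phi> (A \<star> u) = p (\<phi> u) + x u) \<and> (\<forall>j. \<phi> (w j) = v j)"
proof -
  have "lin sc fscale x" using assms(3) cochain1_lin by blast
  from algebra_extend[OF assms(1) this, of v] obtain \<phi> where
    \<phi>: "lin sc fscale \<phi>" "\<And>u. \<phi> (A \<star> u) = p (\<phi> u) + x u" "\<And>j. \<phi> (w j) = v j"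
    by blast
  have "\<phi> u \<in> cochain m" for u
  proof (induction u rule: algebra_induct)
    case (3 u)
    then show ?case
      unfolding \<phi>(2) by (intro cochain_add assms(2) cochain1D(1)[OF assms(3)])
  next
    case (1 u v)
    then show ?case unfolding lin_add[OF \<phi>(1)] by (rule cochain_add)
  next
    case (2 r u)
    then show ?case unfolding lin_scale[OF \<phi>(1)] by (rule cochain_fscale)
  next
    case (4 j)
    show ?case unfolding \<phi>(3) by (rule assms(4))
  qed
  then show ?thesis using \<phi> cochain1_lin by blast
qed

lemma lin_fscale_lact: "lin fscale fscale (\<lambda>f. fscale r (lact g f))"
  by (simp add: lin_def fun_eq_iff fscale_def lact_def algebra_simps)

text \<open>Left linearity over the generators is left linearity over the algebra, and a left linear
  map is determined by its value at \<open>one\<close>.\<close>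

lemma exact0:
  assumes "G \<in> cochain1 m" "rmul A G = lmul A G" "rmul B G = lmul B G" "rmul S G = lmul S G"
  shows "G = coind (G one)"
proof -
  have step: "\<forall>a l. G (g \<star> u) a l = G one (a \<star> (g \<star> u)) l"
    if "rmul g G = lmul g G" "\<forall>a l. G u a l = G one (a \<star> u) l" for g u
  proof (intro allI)
    fix a l
    have "G (g \<star> u) a l = G u (a \<star> g) l"
      using fun_cong[OF fun_cong[OF fun_cong[OF that(1), of u], of a], of l]
      by (simp add: rmul_def lmul_def lact_def)
    then show "G (g \<star> u) a l = G one (a \<star> (g \<star> u)) l" using that(2) by (simp add: mul_assoc)
  qed
  have "\<forall>a l. G u a l = G one (a \<star> u) l" for u
  proof (induction u rule: algebra_induct)
    case (4 j)
    show ?case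
    proof (induction j rule: int_induct[where k = 0])
      case base then show ?case by (simp add: w_0)
    next
      case (step1 i) then show ?case using step[OF assms(3)] w_pos by simp
    next
      case (step2 i) then show ?case using step[OF assms(4)] w_neg by simp
    qed
  qed (use step[OF assms(2)] in \<open>simp_all add: cochain1_linear[OF assms(1)] mul_add_right mul_scale_right\<close>)
  then show ?thesis by (simp add: fun_eq_iff coind_def)
qed

text \<open>The prescribed derivation determines \<open>G\<close> along the basis: \<open>x\<close>
  governs a step by \<open>A\<close>, \<open>y\<close> a step by \<open>B\<close> upwards from
  \<open>w 0\<close>, and \<open>z\<close> a step by \<open>S\<close> downwards. What these steps do
  not impose is controlled by the homogeneous relations between the errors.\<close>

lemma exact1:
  assumes xyz: "x \<in> cochain1 m" "y \<in> cochain1 m" "z \<in> cochain1 m"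
    and rels: "rel1 x y = 0" "rel2 x z = 0" "rel3 x y z = 0" "rel4 x y z = 0"
  obtains G where "G \<in> cochain1 m" "rmul A G - lmul A G = x" "rmul B G - lmul B G = y" "rmul S G - lmul S G = z"
proof -
  obtain v where v: "v 0 = 0" "\<And>j. j \<ge> 0 \<Longrightarrow> v (j + 1) = lact B (v j) + y (w j)"
    "\<And>j. j \<le> 0 \<Longrightarrow> v (j - 1) = lact S (v j) + z (w j)"
    using int_recursion_exists[where b = 0 and f = "\<lambda>j f. lact B f + y (w j)" and g = "\<lambda>j f. lact S f + z (w j)"]
    by blast
  have "v j \<in> cochain m" for j
  proof (induction j rule: int_induct[where k = 0])
    case base then show ?case unfolding v(1) by (rule cochain_zero)
  next
    case (step1 i) then show ?case
      unfolding v(2)[OF step1(1)] by (intro cochain_add cochain_lact cochain1D(1)[OF xyz(2)])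
  next
    case (step2 i) then show ?case
      unfolding v(3)[OF step2(1)] by (intro cochain_add cochain_lact cochain1D(1)[OF xyz(3)])
  qed
  then have "\<exists>G\<in>cochain1 m. (\<forall>u. G (A \<star> u) = fscale 1 (lact A (G u)) + x u) \<and> (\<forall>j. G (w j) = v j)"
    by (intro algebra_extend_cochain lin_fscale_lact xyz(1) cochain_closed)
  then obtain G where G: "G \<in> cochain1 m" "\<And>u. G (A \<star> u) = fscale 1 (lact A (G u)) + x u" "\<And>j. G (w j) = v j"
    by blast
  have GA: "rmul A G - lmul A G = x"
    using G(2) by (simp add: fun_eq_iff op_defs)
  define eB eS where "eB = rmul B G - lmul B G - y" and "eS = rmul S G - lmul S G - z"
  have mem: "eB \<in> cochain1 m" "eS \<in> cochain1 m"
    using G(1) xyz by (auto simp: eB_def eS_def intro!: cochain1_closed)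
  note rG = rel_bimodule_derivation[OF G(1), unfolded GA]
  \<comment> \<open>The derivation of \<open>G\<close> satisfies the linearized relations, and so do
    \<open>x\<close>, \<open>y\<close>, \<open>z\<close>. Both have the same
    \<open>A\<close>-component, so the differences satisfy them with 0 in its place.\<close>
  have "rel1 0 eB = 0" "rel2 0 eS = 0" "rel3 0 eB eS = 0" "rel4 0 eB eS = 0"
    using rel_diff[of x x] rels rG by (auto simp: eB_def eS_def)
  then have e: "eB (A \<star> u) = fscale (q^2) (lact A (eB u))" "lact A (eS u) = fscale (q^2) (eS (A \<star> u))"
    "eS (B \<star> u) + lact S (eB u) = 0" "eB (S \<star> u) + lact B (eS u) = 0" for u
    by (simp_all add: fun_eq_iff rel_defs op_defs)
  have l0: "lact g 0 = 0" for g by (simp add: fun_eq_iff lact_def)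
  have f0: "fscale r f = 0 \<longleftrightarrow> f = 0" if "r \<noteq> 0" for r :: 'k and f :: "'v \<Rightarrow> 'v list \<Rightarrow> 'k"
    using that by (auto simp: fun_eq_iff fscale_def)
  have eA: "eB (A \<star> u) = 0" if "eB u = 0" for u using e(1)[of u] that l0 f0 q_nonzero by simp
  have eA': "eS (A \<star> u) = 0" if "eS u = 0" for u
  proof -
    have "fscale (q^2) (eS (A \<star> u)) = 0" using e(2)[of u] that l0 by simp
    then show ?thesis using f0 q_nonzero by simp
  qed
  have eB: "eS (B \<star> u) = 0" if "eB u = 0" for u using e(3)[of u] that l0 by simp
  have eS: "eB (S \<star> u) = 0" if "eS u = 0" for u using e(4)[of u] that l0 by simp
  have ew: "eB (w j) = 0" if "j \<ge> 0" for j
    unfolding eB_def rmul_def lmul_def minus_apply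
    using v(2)[OF that] w_pos[OF that] G(3)[of j] G(3)[of "j + 1"] by (simp add: zero_fun_def)
  have ew': "eS (w j) = 0" if "j \<le> 0" for j
    unfolding eS_def rmul_def lmul_def minus_apply
    using v(3)[OF that] w_neg[OF that] G(3)[of j] G(3)[of "j - 1"] by (simp add: zero_fun_def)
  have "eB = 0" "eS = 0"
    by (rule cochain1_vanish[OF mem eA eA' eB eS ew ew']; assumption)+
  then have "rmul B G - lmul B G = y" "rmul S G - lmul S G = z" by (simp_all add: eB_def eS_def)
  then show ?thesis using that G(1) GA by blast
qed

text \<open>A preimage may be altered by the derivation of any \<open>G\<close>, and a suitable
  \<open>G\<close> makes its \<open>A\<close>-component zero. So \<open>x = 0\<close> is tried,
  after which \<open>rel1\<close> and \<open>rel2\<close> become recursions along \<open>A\<close>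
  for \<open>y\<close> and \<open>z\<close>.\<close>

lemma exact2:
  assumes r: "r1 \<in> cochain1 m" "r2 \<in> cochain1 m" "r3 \<in> cochain1 m" "r4 \<in> cochain1 m"
    and syz: "syz1 r1 r2 r3 = 0" "syz2 r1 r2 r4 = 0" "syz3 r1 r3 r4 = 0" "syz4 r2 r3 r4 = 0"
  obtains x y z where "x \<in> cochain1 m" "y \<in> cochain1 m" "z \<in> cochain1 m"
    "rel1 x y = r1" "rel2 x z = r2" "rel3 x y z = r3" "rel4 x y z = r4"
proof -
  \<comment> \<open>Half of the values on the \<open>w j\<close> are set to 0. For
    \<open>j < 0\<close> the value of \<open>y\<close> at \<open>w j = S w (j + 1)\<close> is then
    forced by \<open>rel4\<close> at \<open>w (j + 1)\<close>, where \<open>z\<close> vanishes. The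
    values of \<open>z\<close> for \<open>j > 0\<close> come from \<open>rel3\<close> in the same
    way.\<close>
  have "\<exists>y\<in>cochain1 m. (\<forall>u. y (A \<star> u) = fscale (q^2) (lact A (y u)) + r1 u) \<and>
      (\<forall>j. y (w j) = (if j \<ge> 0 then 0 else r4 (w (j + 1))))"
    by (intro algebra_extend_cochain lin_fscale_lact r cochain_closed) (assumption | rule if_mem[OF cochain_zero cochain1D(1)[OF r(4)]])+
  then obtain y where y: "y \<in> cochain1 m" "\<And>u. y (A \<star> u) = fscale (q^2) (lact A (y u)) + r1 u"
    "\<And>j. y (w j) = (if j \<ge> 0 then 0 else r4 (w (j + 1)))"
    by blast
  have "\<exists>z\<in>cochain1 m. (\<forall>u. z (A \<star> u) = fscale (1 / q^2) (lact A (z u)) + scl (- 1 / q^2) r2 u) \<and>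
      (\<forall>j. z (w j) = (if j \<le> 0 then 0 else r3 (w (j - 1))))"
    by (intro algebra_extend_cochain lin_fscale_lact r cochain_closed cochain1_scl)
      (assumption | rule if_mem[OF cochain_zero cochain1D(1)[OF r(3)]])+
  then obtain z where z: "z \<in> cochain1 m"
    "\<And>u. z (A \<star> u) = fscale (1 / q^2) (lact A (z u)) + scl (- 1 / q^2) r2 u"
    "\<And>j. z (w j) = (if j \<le> 0 then 0 else r3 (w (j - 1)))"
    by blast
  have rels: "rel1 0 y = r1" "rel2 0 z = r2"
    using y(2) z(2) q_nonzero by (simp_all add: fun_eq_iff rel_defs op_defs field_simps)
  define e3 e4 where "e3 = r3 - rel3 0 y z" and "e4 = r4 - rel4 0 y z"
  have mem: "e3 \<in> cochain1 m" "e4 \<in> cochain1 m"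
    using r y(1) z(1) by (auto simp: e3_def e4_def rel_defs intro!: cochain1_closed)
  note sr = syz_rel[OF cochain1_zero y(1) z(1), unfolded rels]
  have "syz1 0 0 e3 = 0" "syz2 0 0 e4 = 0" "syz3 0 e3 e4 = 0" "syz4 0 e3 e4 = 0"
    using syz_diff(1)[of r1 r1 r2 r2] syz_diff(2)[of r1 r1 r2 r2] syz_diff(3)[of r1 r1] syz_diff(4)[of r2 r2] syz sr
    by (auto simp: e3_def e4_def)
  then have e: "e3 (A \<star> u) = lact A (e3 u)" "e4 (A \<star> u) = lact A (e4 u)"
    "e4 (B \<star> u) = lact B (e3 u)" "e3 (S \<star> u) = lact S (e4 u)" for u
    using q_nonzero by (simp_all add: fun_eq_iff syz_defs op_defs)
  have l0: "lact g 0 = 0" for g by (simp add: fun_eq_iff lact_def)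
  have eA: "e3 (A \<star> u) = 0" if "e3 u = 0" for u using that by (simp add: e l0)
  have eA': "e4 (A \<star> u) = 0" if "e4 u = 0" for u using that by (simp add: e l0)
  have eB: "e4 (B \<star> u) = 0" if "e3 u = 0" for u using that by (simp add: e l0)
  have eS: "e3 (S \<star> u) = 0" if "e4 u = 0" for u using that by (simp add: e l0)
  have ew: "e3 (w j) = 0" if "j \<ge> 0" for j
    using that w_pos[OF that] y(3)[of j] z(3)[of "j + 1"]
    by (simp add: e3_def rel3_def rmul_def lmul_def scl_def l0) (simp add: fun_eq_iff fscale_def lact_def)
  have ew': "e4 (w j) = 0" if "j \<le> 0" for j
    using that w_neg[OF that] z(3)[of j] y(3)[of "j - 1"]
    by (simp add: e4_def rel4_def rmul_def lmul_def scl_def l0) (simp add: fun_eq_iff fscale_def lact_def)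
  have "e3 = 0" "e4 = 0"
    by (rule cochain1_vanish[OF mem eA eA' eB eS ew ew']; assumption)+
  then have "rel3 0 y z = r3" "rel4 0 y z = r4" by (simp_all add: e3_def e4_def)
  then show ?thesis using that cochain1_zero y(1) z(1) rels by blast
qed

section \<open>The diagram chase\<close>

lemma coind_zero: "coind f = 0 \<Longrightarrow> f = 0"
proof (intro ext)
  fix a l
  assume "coind f = 0"
  then have "coind f one a l = 0" by simp
  then show "f a l = 0 a l" by (simp add: coind_def)
qed

lemma coind_diff: "coind f - coind g = coind (f - g)"
  by (simp add: fun_eq_iff coind_def)

lemma codiff1_rel:
  "codiff1 (rel1 x y) = rel1 (codiff1 x) (codiff1 y)" "codiff1 (rel2 x z) = rel2 (codiff1 x) (codiff1 z)"
  "codiff1 (rel3 x y z) = rel3 (codiff1 x) (codiff1 y) (codiff1 z)"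
  "codiff1 (rel4 x y z) = rel4 (codiff1 x) (codiff1 y) (codiff1 z)"
  by (simp_all add: rel_defs codiff1_ops)

lemma codiff1_syz:
  "codiff1 (syz1 r1 r2 r3) = syz1 (codiff1 r1) (codiff1 r2) (codiff1 r3)"
  "codiff1 (syz2 r1 r2 r4) = syz2 (codiff1 r1) (codiff1 r2) (codiff1 r4)"
  "codiff1 (syz3 r1 r3 r4) = syz3 (codiff1 r1) (codiff1 r3) (codiff1 r4)"
  "codiff1 (syz4 r2 r3 r4) = syz4 (codiff1 r2) (codiff1 r3) (codiff1 r4)"
  by (simp_all add: syz_defs codiff1_ops)

lemma codiff1_split:
  "codiff1 (split1 s1 s3) = split1 (codiff1 s1) (codiff1 s3)" "codiff1 (split2 s4) = split2 (codiff1 s4)"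
  "codiff1 (split3 s1) = split3 (codiff1 s1)" "codiff1 (split4 s2 s4) = split4 (codiff1 s2) (codiff1 s4)"
  by (simp_all add: split_defs codiff1_ops)

lemma rel_closed:
  assumes "x \<in> cochain1 m" "y \<in> cochain1 m" "z \<in> cochain1 m"
  shows "rel1 x y \<in> cochain1 m" "rel2 x z \<in> cochain1 m" "rel3 x y z \<in> cochain1 m" "rel4 x y z \<in> cochain1 m"
  using assms by (auto simp: rel_defs intro!: cochain1_closed)

lemma syz_closed:
  assumes "r1 \<in> cochain1 m" "r2 \<in> cochain1 m" "r3 \<in> cochain1 m" "r4 \<in> cochain1 m"
  shows "syz1 r1 r2 r3 \<in> cochain1 m" "syz2 r1 r2 r4 \<in> cochain1 m" "syz3 r1 r3 r4 \<in> cochain1 m" "syz4 r2 r3 r4 \<in> cochain1 m"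
  using assms by (auto simp: syz_defs intro!: cochain1_closed)

lemma split_closed:
  assumes "s1 \<in> cochain1 m" "s2 \<in> cochain1 m" "s3 \<in> cochain1 m" "s4 \<in> cochain1 m"
  shows "split1 s1 s3 \<in> cochain1 m" "split2 s4 \<in> cochain1 m" "split3 s1 \<in> cochain1 m" "split4 s2 s4 \<in> cochain1 m"
  using assms by (auto simp: split_defs intro!: cochain1_closed)

lemma syz_scl: 
  "syz1 (scl r r1) (scl r r2) (scl r r3) = scl r (syz1 r1 r2 r3)"
  "syz2 (scl r r1) (scl r r2) (scl r r4) = scl r (syz2 r1 r2 r4)"
  "syz3 (scl r r1) (scl r r3) (scl r r4) = scl r (syz3 r1 r3 r4)"
  "syz4 (scl r r2) (scl r r3) (scl r r4) = scl r (syz4 r2 r3 r4)"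
  by (simp_all add: fun_eq_iff syz_defs op_defs algebra_simps)

lemma split_zero: "split1 0 0 = 0" "split2 0 = 0" "split3 0 = 0" "split4 0 0 = 0"
  by (simp_all add: fun_eq_iff split_defs op_defs)

lemma scl_zero: "scl r 0 = 0" by (simp add: fun_eq_iff op_defs)

text \<open>Write \<open>d\<close> for \<open>codiff1\<close>. The zigzag runs
  \<open>coind f = d g0\<close>, derivation of \<open>g0\<close> equal to \<open>d g1\<close>,
  relations of \<open>g1\<close> equal to \<open>d r\<close>; every equality contracts away one
  argument. The syzygies \<open>s\<close> of \<open>r\<close> need not vanish, but
  \<open>d s = 0\<close>. Hence subtracting from \<open>r\<close> their image under the homotopy
  kills the syzygies without changing \<open>d r\<close>, and exactness leads back to
  \<open>N\<close>.\<close>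

theorem codiff_exact:
  assumes f: "f \<in> cochain (Suc (Suc (Suc k)))" "codiff f = 0"
  obtains g where "g \<in> cochain (Suc (Suc k))" "f = codiff g"
proof -
  define i where "i = coind f"
  have i: "i \<in> cochain1 (Suc (Suc (Suc k)))" "codiff1 i = 0"
    using f coind_cochain1 codiff1_coind[of f] by (auto simp: i_def) (auto simp: coind_def fun_eq_iff)
  have di: "rmul g i - lmul g i = 0" for g
    by (simp add: fun_eq_iff op_defs i_def coind_def mul_assoc)
  define g0 where "g0 = contr i"
  have g0: "g0 \<in> cochain1 (Suc (Suc k))" "codiff1 g0 = i"
    using contr_cochain1 codiff1_contr' i by (auto simp: g0_def)
  define der where "der g G = rmul g G - lmul g G" for g G
  have der: "der g G \<in> cochain1 m" if "G \<in> cochain1 m" for g G m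
    using that by (auto simp: der_def intro!: cochain1_closed)
  have codiff1_der: "codiff1 (der g G) = der g (codiff1 G)" for g G by (simp add: der_def codiff1_ops)
  have der_diff: "der g (G - H) = der g G - der g H" for g G H
    by (simp add: der_def fun_eq_iff op_defs)
  have rel_der: "rel1 (der A G) (der B G) = 0" "rel2 (der A G) (der S G) = 0"
    "rel3 (der A G) (der B G) (der S G) = 0" "rel4 (der A G) (der B G) (der S G) = 0"
    if "G \<in> cochain1 m" for G m
    using rel_bimodule_derivation[OF that] by (simp_all add: der_def)
  define g1 where "g1 g = contr (der g g0)" for g
  have g1: "g1 g \<in> cochain1 (Suc k)" "codiff1 (g1 g) = der g g0" for g
    using contr_cochain1[OF der[OF g0(1)]] codiff1_contr'[OF der[OF g0(1)]] di
    by (auto simp: g1_def codiff1_der g0(2)) (simp_all add: der_def)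
  note relg1 = rel_closed[OF g1(1)[of A] g1(1)[of B] g1(1)[of S]]
  have codiff1_relg1: "codiff1 (rel1 (g1 A) (g1 B)) = 0" "codiff1 (rel2 (g1 A) (g1 S)) = 0"
    "codiff1 (rel3 (g1 A) (g1 B) (g1 S)) = 0" "codiff1 (rel4 (g1 A) (g1 B) (g1 S)) = 0"
    using rel_der[OF g0(1)] by (simp_all add: codiff1_rel g1(2))
  define r1 r2 r3 r4 where "r1 = contr (rel1 (g1 A) (g1 B))" and "r2 = contr (rel2 (g1 A) (g1 S))"
    and "r3 = contr (rel3 (g1 A) (g1 B) (g1 S))" and "r4 = contr (rel4 (g1 A) (g1 B) (g1 S))"
  have r: "r1 \<in> cochain1 k" "r2 \<in> cochain1 k" "r3 \<in> cochain1 k" "r4 \<in> cochain1 k"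
    using relg1[THEN contr_cochain1] by (simp_all add: r1_def r2_def r3_def r4_def)
  have codiff1_r: "codiff1 r1 = rel1 (g1 A) (g1 B)" "codiff1 r2 = rel2 (g1 A) (g1 S)"
    "codiff1 r3 = rel3 (g1 A) (g1 B) (g1 S)" "codiff1 r4 = rel4 (g1 A) (g1 B) (g1 S)"
    using codiff1_contr'[OF relg1(1) codiff1_relg1(1)] codiff1_contr'[OF relg1(2) codiff1_relg1(2)]
      codiff1_contr'[OF relg1(3) codiff1_relg1(3)] codiff1_contr'[OF relg1(4) codiff1_relg1(4)]
    by (simp_all add: r1_def r2_def r3_def r4_def)
  define s1 s2 s3 s4 where "s1 = syz1 r1 r2 r3" and "s2 = syz2 r1 r2 r4" and "s3 = syz3 r1 r3 r4"
    and "s4 = syz4 r2 r3 r4"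
  have s: "s1 \<in> cochain1 k" "s2 \<in> cochain1 k" "s3 \<in> cochain1 k" "s4 \<in> cochain1 k"
    using syz_closed[OF r] by (simp_all add: s1_def s2_def s3_def s4_def)
  have codiff1_s: "codiff1 s1 = 0" "codiff1 s2 = 0" "codiff1 s3 = 0" "codiff1 s4 = 0"
    using syz_rel[OF g1(1) g1(1) g1(1)] by (simp_all add: s1_def s2_def s3_def s4_def codiff1_syz codiff1_r)
  \<comment> \<open>Cancels the factor in \<open>syz_split\<close>; this is where
    \<open>c + d \<noteq> 0\<close> enters.\<close>
  define e where "e = 1 / (c + d)^2"
  define r1' r2' r3' r4' where "r1' = r1 - scl e (split1 s1 s3)" and "r2' = r2 - scl e (split2 s4)"
    and "r3' = r3 - scl e (split3 s1)" and "r4' = r4 - scl e (split4 s2 s4)"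
  have r': "r1' \<in> cochain1 k" "r2' \<in> cochain1 k" "r3' \<in> cochain1 k" "r4' \<in> cochain1 k"
    using r split_closed[OF s] by (auto simp: r1'_def r2'_def r3'_def r4'_def intro!: cochain1_closed)
  have codiff1_r': "codiff1 r1' = codiff1 r1" "codiff1 r2' = codiff1 r2" "codiff1 r3' = codiff1 r3" "codiff1 r4' = codiff1 r4"
    by (simp_all add: r1'_def r2'_def r3'_def r4'_def codiff1_diff codiff1_scl codiff1_split codiff1_s split_zero scl_zero)
  have e_cancel: "scl e (scl ((c + d)^2) G) = G" for G
    using cd_nonzero by (simp add: fun_eq_iff op_defs e_def)
  note ss = syz_split[OF r, folded s1_def s2_def s3_def s4_def]
  have syz': "syz1 r1' r2' r3' = 0" "syz2 r1' r2' r4' = 0" "syz3 r1' r3' r4' = 0" "syz4 r2' r3' r4' = 0"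
    unfolding r1'_def r2'_def r3'_def r4'_def syz_diff syz_scl ss e_cancel
    by (simp_all add: s1_def s2_def s3_def s4_def)
  obtain x y z where xyz: "x \<in> cochain1 k" "y \<in> cochain1 k" "z \<in> cochain1 k"
    "rel1 x y = r1'" "rel2 x z = r2'" "rel3 x y z = r3'" "rel4 x y z = r4'"
    using exact2[OF r' syz'] by blast
  define x' y' z' where "x' = g1 A - codiff1 x" and "y' = g1 B - codiff1 y" and "z' = g1 S - codiff1 z"
  have xyz': "x' \<in> cochain1 (Suc k)" "y' \<in> cochain1 (Suc k)" "z' \<in> cochain1 (Suc k)"
    using g1(1) codiff1_cochain1 xyz by (auto simp: x'_def y'_def z'_def intro!: cochain1_diff)
  have "rel1 x' y' = 0" "rel2 x' z' = 0" "rel3 x' y' z' = 0" "rel4 x' y' z' = 0"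
    unfolding x'_def y'_def z'_def rel_diff codiff1_rel[symmetric] xyz codiff1_r' codiff1_r by simp_all
  from exact1[OF xyz' this] obtain h where h: "h \<in> cochain1 (Suc k)" "der A h = x'" "der B h = y'" "der S h = z'"
    unfolding der_def by blast
  \<comment> \<open>The derivation of \<open>h\<close> is \<open>g1\<close> up to coboundaries, so
    the derivation of \<open>codiff1 h\<close> is that of \<open>g0\<close>. The corrected lift
    \<open>g\<close> therefore has zero derivation, that is, it comes from \<open>N\<close>.\<close>
  define g where "g = g0 - codiff1 h"
  have g: "g \<in> cochain1 (Suc (Suc k))"
    using g0(1) codiff1_cochain1[OF h(1)] by (auto simp: g_def intro!: cochain1_diff)
  have "der A g = 0" "der B g = 0" "der S g = 0"
    unfolding g_def der_diff codiff1_der[symmetric] h x'_def y'_def z'_def codiff1_diff codiff1_squared g1(2)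
    by simp_all
  then have "g = coind (g one)"
    using exact0[OF g] by (simp add: der_def)
  moreover have "codiff1 g = i"
    by (simp add: g_def codiff1_diff codiff1_squared g0(2))
  ultimately have "coind (codiff (g one)) = coind f"
    using codiff1_coind[of "g one"] by (simp add: i_def)
  then have "f = codiff (g one)"
    using coind_zero[of "f - codiff (g one)"] by (simp add: coind_diff[symmetric])
  then show ?thesis using that cochain1D(1)[OF g] by blast
qed

end

section \<open>A basis of normal monomials\<close>

lemma poly_mapping_sum_single: "x = (\<Sum>t\<in>keys x. single t (lookup x t))"
  by (rule poly_mapping_eqI)
    (auto simp: lookup_sum lookup_single when_def in_keys_iff intro!: sum.neutral[symmetric])

lemma poly_mapping_induct:
  assumes "\<And>x y. P x \<Longrightarrow> P y \<Longrightarrow> P (x + y)" "\<And>t r. P (single t r)"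
  shows "P (x :: 'b \<Rightarrow>\<^sub>0 'r::comm_monoid_add)"
proof -
  have "P (\<Sum>t\<in>I. single t (lookup x t))" if "finite I" for I
    using that
  proof induction
    case empty
    then show ?case using assms(2)[of undefined 0] by simp
  qed (use assms in auto)
  from this[OF finite_keys[of x]] show ?thesis using poly_mapping_sum_single[of x] by simp
qed

definition smul :: "'r::comm_ring_1 \<Rightarrow> ('b \<Rightarrow>\<^sub>0 'r) \<Rightarrow> 'b \<Rightarrow>\<^sub>0 'r" where
  "smul r x = Poly_Mapping.map ((*) r) x"

lemma lookup_smul [simp]: "lookup (smul r x) t = r * lookup x t"
  by (simp add: smul_def Poly_Mapping.map.rep_eq when_def)

lemma smul_simps:
  "smul r (x + y) = smul r x + smul r y" "smul (r + s) x = smul r x + smul s x"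
  "smul r (smul s x) = smul (r * s) x" "smul 1 x = x" "smul 0 x = 0" "smul r 0 = 0"
  "smul r (- x) = - smul r x" "smul r (x - y) = smul r x - smul r y"
  "smul r (single t s) = single t (r * s)"
  by (rule poly_mapping_eqI, simp add: lookup_add lookup_minus lookup_single algebra_simps when_def)+

text \<open>Left multiplication by \<open>B\<close> or \<open>S\<close> shifts the index by one and
  transforms the coefficient. The map \<open>h\<close> sees the new index because the transformation
  depends on the side of 0.\<close>

definition shift_map :: "int \<Rightarrow> (int \<Rightarrow> 'r::zero \<Rightarrow> 'r) \<Rightarrow> (int \<Rightarrow>\<^sub>0 'r) \<Rightarrow> int \<Rightarrow>\<^sub>0 'r" where
  "shift_map s h u = Abs_poly_mapping (\<lambda>j. h j (lookup u (j - s)))"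

lemma lookup_shift_map:
  assumes "\<And>j. h j 0 = 0"
  shows "lookup (shift_map s h u) j = h j (lookup u (j - s))"
proof -
  have "{j. h j (lookup u (j - s)) \<noteq> 0} \<subseteq> (\<lambda>i. i + s) ` keys u"
  proof
    fix j assume "j \<in> {j. h j (lookup u (j - s)) \<noteq> 0}"
    then have "j - s \<in> keys u" using assms by (auto simp: in_keys_iff)
    then show "j \<in> (\<lambda>i. i + s) ` keys u" by (intro image_eqI[of _ _ "j - s"]) auto
  qed
  then have "finite {j. h j (lookup u (j - s)) \<noteq> 0}"
    using finite_surj[OF finite_keys] by blast
  then show ?thesis by (simp add: shift_map_def)
qed

definition scaleV :: "'k::field \<Rightarrow> (int \<Rightarrow>\<^sub>0 'k poly) \<Rightarrow> int \<Rightarrow>\<^sub>0 'k poly" where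
  "scaleV r = smul [:r:]"

definition opA :: "(int \<Rightarrow>\<^sub>0 'k::field poly) \<Rightarrow> int \<Rightarrow>\<^sub>0 'k poly" where
  "opA = smul [:0, 1:]"

text \<open>An element \<open>u\<close> stands for the sum over \<open>j\<close> of \<open>(lookup u j)(A) w\<^sub>j\<close>, where \<open>w\<^sub>j\<close> is \<open>B\<^sup>j\<close> or \<open>B\<^sup>*\<^sup>-\<^sup>j\<close>.\<close>

definition wV :: "int \<Rightarrow> int \<Rightarrow>\<^sub>0 'k::field poly" where
  "wV j = single j 1"

definition oneV :: "int \<Rightarrow>\<^sub>0 'k::field poly" where
  "oneV = wV 0"

lemma scaleV_simps:
  "scaleV r (x + y) = scaleV r x + scaleV r y" "scaleV (r + s) x = scaleV r x + scaleV s x"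
  "scaleV r (scaleV s x) = scaleV (r * s) x" "scaleV 1 x = x" "scaleV 0 x = 0" "scaleV r 0 = 0"
  by (simp_all add: scaleV_def smul_simps pCons_one mult.commute flip: smul_simps(2))

lemma lookup_scaleV [simp]: "lookup (scaleV r x) t = Polynomial.smult r (lookup x t)"
  by (simp add: scaleV_def)

lemma lookup_opA [simp]: "lookup (opA x) t = pCons 0 (lookup x t)"
  by (simp add: opA_def)

lemma lin_opA: "lin scaleV scaleV opA"
  by (simp add: lin_def scaleV_def opA_def smul_simps mult.commute)

lemma V_induct:
  assumes "\<And>u v. P u \<Longrightarrow> P v \<Longrightarrow> P (u + v)" "\<And>r u. P u \<Longrightarrow> P (scaleV r u)"
    "\<And>u. P u \<Longrightarrow> P (opA u)" "\<And>j. P (wV j)"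
  shows "P (u :: int \<Rightarrow>\<^sub>0 'k::field poly)"
proof (induction u rule: poly_mapping_induct)
  case (2 j p)
  show ?case
  proof (induction p)
    case 0
    then show ?case using assms(2)[OF assms(4), of 0 0] by (simp add: scaleV_simps)
  next
    case (pCons a p)
    have "single j (pCons a p) = scaleV a (wV j) + opA (single j p)"
      by (simp add: scaleV_def wV_def opA_def smul_simps single_add[symmetric])
    then show ?case using assms pCons.IH by simp
  qed
qed (use assms in blast)

text \<open>On \<open>p(A) w j\<close> the map is forced by recursion over the coefficients of
  \<open>p\<close>, since \<open>pCons a h\<close> is \<open>a + A h\<close>; the recursion runs
  separately for every \<open>j\<close>.\<close>

lemma V_extend:
  fixes s :: "'k::field \<Rightarrow> 'w::ab_group_add \<Rightarrow> 'w" and v :: "int \<Rightarrow> 'w"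
  assumes s: "\<And>r x y. s r (x + y) = s r x + s r y" "\<And>r r' x. s (r + r') x = s r x + s r' x"
      "\<And>r r' x. s r (s r' x) = s (r * r') x" "\<And>x. s 1 x = x"
    and p: "lin s s p" and x: "lin scaleV s x"
  shows "\<exists>\<phi>. lin scaleV s \<phi> \<and> (\<forall>u. \<phi> (opA u) = p (\<phi> u) + x u) \<and> (\<forall>j. \<phi> (wV j) = v j)"
proof -
  have s0: "s 0 y = 0" for y using s(2)[of 0 0 y] by simp
  have s0': "s r 0 = 0" for r using s(1)[of r 0 0] by simp
  define f where "f j = rec_list 0 (\<lambda>a as y. s a (v j) + p y + x (single j (Poly as)))" for j
  have f: "f j [] = 0" "f j (a # as) = s a (v j) + p (f j as) + x (single j (Poly as))" for j a as
    by (simp_all add: f_def)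
  define g where "g j h = f j (Polynomial.coeffs h)" for j h
  have g_0: "g j 0 = 0" for j by (simp add: g_def f)
  \<comment> \<open>The coefficient list of \<open>pCons 0 0\<close> is empty, so the recursion
    equation of \<open>f\<close> does not cover this case; both sides are 0 there.\<close>
  have g: "g j (pCons a h) = s a (v j) + p (g j h) + x (single j h)" for j a h
    by (cases "a = 0 \<and> h = 0") (auto simp: g_def f cCons_def s0 lin_0[OF p] lin_0[OF x])
  have g_add: "g j (h + h') = g j h + g j h'" for j h h'
  proof (induction h arbitrary: h')
    case (pCons a h)
    show ?case
      by (cases h') (simp add: g pCons.IH s lin_add[OF p] lin_add[OF x] single_add)
  qed (simp add: g_0)
  have g_smult: "g j (Polynomial.smult r h) = s r (g j h)" for j r h
  proof (induction h)
    case (pCons a h)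
    have "single j (Polynomial.smult r h) = scaleV r (single j h)"
      by (simp add: scaleV_def smul_simps)
    then show ?case
      by (simp add: g pCons.IH s lin_scale[OF p] lin_scale[OF x])
  qed (simp add: g_0 s0')
  define \<phi> where "\<phi> u = (\<Sum>j\<in>keys u. g j (lookup u j))" for u
  have \<phi>_eq: "\<phi> u = (\<Sum>j\<in>J. g j (lookup u j))" if "finite J" "keys u \<subseteq> J" for u J
    unfolding \<phi>_def using that by (intro sum.mono_neutral_left) (auto simp: in_keys_iff g_0)
  have \<phi>_add: "\<phi> (u + u') = \<phi> u + \<phi> u'" for u u'
    using \<phi>_eq[of "keys u \<union> keys u'"] keys_add[of u u']
    by (simp add: lookup_add g_add sum.distrib)
  have \<phi>_single: "\<phi> (single j h) = g j h" for j h
    using \<phi>_eq[of "{j}" "single j h"] by simp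
  have "\<phi> (scaleV r u) = s r (\<phi> u)" for r u
  proof (induction u rule: poly_mapping_induct)
    case (2 j h)
    have "scaleV r (single j h) = single j (Polynomial.smult r h)"
      by (simp add: scaleV_def smul_simps)
    then show ?case by (simp add: \<phi>_single g_smult)
  qed (simp add: scaleV_simps \<phi>_add s)
  moreover have "\<phi> (opA u) = p (\<phi> u) + x u" for u
  proof (induction u rule: poly_mapping_induct)
    case (2 j h)
    have "opA (single j h) = single j (pCons 0 h)"
      by (simp add: opA_def smul_simps)
    then show ?case by (simp add: \<phi>_single g s0)
  qed (simp add: lin_add[OF lin_opA] \<phi>_add lin_add[OF p] lin_add[OF x])
  moreover have "\<phi> (wV j) = v j" for j
    using g[of j 1 0] by (simp add: wV_def \<phi>_single g_0 lin_0[OF p] lin_0[OF x] s one_pCons)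
  ultimately show ?thesis using \<phi>_add by (intro exI[of _ \<phi>]) (simp add: lin_def)
qed

section \<open>Left multiplication by the generators on normal forms\<close>

locale podles_model =
  fixes q c d :: "'k::field"
  assumes q_nonzero: "q \<noteq> 0"
begin

text \<open>The polynomial \<open>a\<close>, so that \<open>S B = a(A)\<close> and
  \<open>B S = a(q^2 A)\<close>.\<close>

definition pa :: "'k poly" where "pa = [:c * d, c - d, - 1:]"

definition dil :: "'k \<Rightarrow> 'k poly \<Rightarrow> 'k poly" where "dil r p = pcompose p [:0, r:]"

text \<open>The letter \<open>B\<close> passes \<open>p(A)\<close> as \<open>p(q^2 A)\<close>. Then
  it either lengthens a power of \<open>B\<close> or meets a leading \<open>S\<close>, leaving
  \<open>B S = a(q^2 A)\<close>. The index \<open>j\<close> is that of the result, so the first case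
  is \<open>j \<ge> 1\<close>; for \<open>opS\<close>, by the same count, the cancelling case is
  \<open>j \<ge> 0\<close>.\<close>

definition opB :: "(int \<Rightarrow>\<^sub>0 'k poly) \<Rightarrow> int \<Rightarrow>\<^sub>0 'k poly" where
  "opB = shift_map 1 (\<lambda>j p. (if j \<ge> 1 then 1 else dil (q^2) pa) * dil (q^2) p)"

definition opS :: "(int \<Rightarrow>\<^sub>0 'k poly) \<Rightarrow> int \<Rightarrow>\<^sub>0 'k poly" where
  "opS = shift_map (- 1) (\<lambda>j p. (if j \<ge> 0 then pa else 1) * dil (1 / q^2) p)"

lemma dil_simps [simp]:
  "dil r 0 = 0" "dil r 1 = 1" "dil r (p + p') = dil r p + dil r p'" "dil r (p * p') = dil r p * dil r p'"
  "dil r (Polynomial.smult a p) = Polynomial.smult a (dil r p)" "dil r (- p) = - dil r p" "dil r (p - p') = dil r p - dil r p'"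
  by (simp_all add: dil_def pcompose_add pcompose_mult pcompose_smult pcompose_1 pcompose_uminus pcompose_diff)

lemma dil_dil: "dil r (dil s p) = dil (r * s) p"
  by (simp add: dil_def pcompose_assoc[symmetric] pcompose_pCons mult.commute)

lemma dil_1: "dil 1 p = p"
  by (simp add: dil_def)

lemma dil_pCons: "dil r (pCons a p) = pCons a (Polynomial.smult r (dil r p))"
  by (simp add: dil_def pcompose_pCons)

lemma coeff_dil: "Polynomial.coeff (dil r p) i = r ^ i * Polynomial.coeff p i"
proof (induction p arbitrary: i)
  case (pCons a p)
  then show ?case by (cases i) (simp_all add: dil_pCons)
qed simp

lemma lookup_opB: "lookup (opB u) j =
    (if j \<ge> 1 then 1 else dil (q^2) pa) * dil (q^2) (lookup u (j - 1))"
  by (simp add: opB_def lookup_shift_map)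

lemma lookup_opS: "lookup (opS u) j =
    (if j \<ge> 0 then pa else 1) * dil (1 / q^2) (lookup u (j + 1))"
  by (simp add: opS_def lookup_shift_map)

lemma lin_opB: "lin scaleV scaleV opB" and lin_opS: "lin scaleV scaleV opS"
  by (auto intro!: linI poly_mapping_eqI simp: lookup_opB lookup_opS lookup_add algebra_simps)

lemma opB_opA: "opB (opA u) = scaleV (q^2) (opA (opB u))"
  by (rule poly_mapping_eqI) (simp add: lookup_opB dil_pCons)

lemma opA_opS: "opA (opS u) = scaleV (q^2) (opS (opA u))"
  by (rule poly_mapping_eqI) (simp add: lookup_opS dil_pCons q_nonzero)

lemma dil_cancel: "dil (1 / q^2) (dil (q^2) p) = p" "dil (q^2) (dil (1 / q^2) p) = p"
  by (simp_all add: dil_dil q_nonzero dil_1)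

lemma opS_opB: "opS (opB u) = scaleV (c * d) u + scaleV (c - d) (opA u) - opA (opA u)"
proof -
  have "lookup (opS (opB u)) j = pa * lookup u j" for j
    by (simp add: lookup_opS lookup_opB dil_cancel)
  then show ?thesis
    by (intro poly_mapping_eqI) (simp add: lookup_add lookup_minus pa_def)
qed

lemma opB_opS: "opB (opS u) = scaleV (c * d) u + scaleV (q^2 * (c - d)) (opA u) - scaleV (q^4) (opA (opA u))"
proof -
  have "lookup (opB (opS u)) j = dil (q^2) pa * lookup u j" for j
    by (simp add: lookup_opS lookup_opB dil_cancel)
  then show ?thesis
    by (intro poly_mapping_eqI) (simp add: lookup_add lookup_minus pa_def dil_pCons power2_eq_square power4_eq_xxxx mult.assoc)
qed

lemma opB_wV: "j \<ge> 0 \<Longrightarrow> opB (wV j) = wV (j + 1)"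
  by (rule poly_mapping_eqI) (simp add: lookup_opB wV_def lookup_single when_def algebra_simps)

lemma opS_wV: "j \<le> 0 \<Longrightarrow> opS (wV j) = wV (j - 1)"
  by (rule poly_mapping_eqI) (simp add: lookup_opS wV_def lookup_single when_def algebra_simps)

end

section \<open>The free algebra and its ideals\<close>

lemma ring_of_type_algebra_simps [simp]:
  "carrier (ring_of_type_algebra :: 'a::ring_1 ring) = UNIV"
  "monoid.mult (ring_of_type_algebra :: 'a::ring_1 ring) = (*)"
  "monoid.one (ring_of_type_algebra :: 'a::ring_1 ring) = 1"
  "ring.zero (ring_of_type_algebra :: 'a::ring_1 ring) = 0"
  "ring.add (ring_of_type_algebra :: 'a::ring_1 ring) = (+)"
  by (simp_all add: ring_of_type_algebra_def fun_eq_iff)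

lemma ring_of_type_algebra_ring: "ring (ring_of_type_algebra :: 'a::ring_1 ring)"
proof -
  have "\<exists>y. x + y = 0" for x :: 'a
    using add.right_inverse by blast
  then show ?thesis
    unfolding ring_of_type_algebra_def using add.right_inverse
    by unfold_locales (auto simp: algebra_simps Units_def)
qed

lemma a_inv_ring_of_type_algebra [simp]: "a_inv (ring_of_type_algebra :: 'a::ring_1 ring) x = - x"
proof -
  interpret R: ring "ring_of_type_algebra :: 'a ring" by (rule ring_of_type_algebra_ring)
  show ?thesis using R.minus_equality[of "- x" x] by simp
qed

lemma ideal_ring_of_type_algebraI:
  assumes "0 \<in> I" "\<And>x y. x \<in> I \<Longrightarrow> y \<in> I \<Longrightarrow> x + y \<in> I" "\<And>x y. x \<in> I \<Longrightarrow> y * x \<in> I"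
    "\<And>x y. x \<in> I \<Longrightarrow> x * y \<in> I"
  shows "ideal I (ring_of_type_algebra :: 'a::ring_1 ring)"
proof (rule idealI[OF ring_of_type_algebra_ring])
  interpret R: ring "ring_of_type_algebra :: 'a ring" by (rule ring_of_type_algebra_ring)
  have "- x \<in> I" if "x \<in> I" for x using assms(3)[OF that, of "- 1"] by simp
  then show "subgroup I (add_monoid (ring_of_type_algebra :: 'a ring))"
    using assms by (intro R.add.subgroupI) (auto simp: a_inv_def[symmetric])
qed (use assms in auto)

lemma scalar_add: "scalar (r + s) = scalar r + scalar s"
  and scalar_mult: "scalar r * scalar s = scalar (r * s)"
  and scalar_1: "scalar 1 = 1"
  by (simp_all add: scalar_def single_add mult_single)

lemma scalar_central: "scalar r * x = x * scalar r"
  by (induction x rule: poly_mapping_induct)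
    (simp_all add: distrib_left distrib_right scalar_def mult_single mult.commute)

lemma single_Word_Cons: "single (Word (g # gs)) r = gen g * single (Word gs) r"
  by (simp add: gen_def mult_single)

lemma single_Word_Nil: "single (Word []) r = scalar r"
  by (simp add: scalar_def zero_free_word_def)

section \<open>The normal monomials form a basis of the quotient\<close>

context podles_model
begin

fun gact :: "podles_gen \<Rightarrow> (int \<Rightarrow>\<^sub>0 'k poly) \<Rightarrow> int \<Rightarrow>\<^sub>0 'k poly" where
  "gact Gen_A = opA" | "gact Gen_B = opB" | "gact Gen_Bstar = opS"

fun wact :: "podles_gen free_word \<Rightarrow> (int \<Rightarrow>\<^sub>0 'k poly) \<Rightarrow> int \<Rightarrow>\<^sub>0 'k poly" where
  "wact (Word gs) v = foldr gact gs v"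

definition act :: "'k podles_free \<Rightarrow> (int \<Rightarrow>\<^sub>0 'k poly) \<Rightarrow> int \<Rightarrow>\<^sub>0 'k poly" where
  "act x v = (\<Sum>t\<in>keys x. scaleV (lookup x t) (wact t v))"

lemma lin_gact: "lin scaleV scaleV (gact g)"
  by (cases g) (simp_all add: lin_opA lin_opB lin_opS)

lemma lin_wact: "lin scaleV scaleV (wact t)"
proof (cases t)
  case (Word gs)
  have "lin scaleV scaleV (foldr gact gs)"
  proof (induction gs)
    case Nil show ?case by (simp add: lin_def)
  next
    case (Cons g gs)
    from lin_comp[OF this lin_gact[of g]] show ?case by (simp add: comp_def)
  qed
  then show ?thesis unfolding Word by (simp add: lin_def)
qed

lemma wact_add: "wact (t + t') v = wact t (wact t' v)"
  by (cases t; cases t') simp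

lemma act_superset:
  assumes "finite J" "keys x \<subseteq> J"
  shows "act x v = (\<Sum>t\<in>J. scaleV (lookup x t) (wact t v))"
  unfolding act_def using assms by (intro sum.mono_neutral_left) (auto simp: in_keys_iff scaleV_simps)

lemma act_add: "act (x + y) v = act x v + act y v"
  using act_superset[of "keys x \<union> keys y"] keys_add[of x y]
  by (simp add: lookup_add scaleV_simps sum.distrib)

lemma act_single: "act (single t r) v = scaleV r (wact t v)"
  using act_superset[of "{t}" "single t r" v] by simp

lemma lin_act: "lin scaleV scaleV (act x)"
proof (induction x rule: poly_mapping_induct)
  case (1 x y)
  then show ?case by (simp add: lin_def act_add scaleV_simps)
next
  case (2 t r)
  show ?case using lin_wact[of t]
    by (simp add: lin_def act_single scaleV_simps mult.commute)
qed

lemma act_mult: "act (x * y) v = act x (act y v)"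
proof (induction x rule: poly_mapping_induct)
  case (1 x x')
  then show ?case by (simp add: act_add distrib_right)
next
  case (2 t r)
  show ?case
  proof (induction y rule: poly_mapping_induct)
    case (1 y y')
    then show ?case by (simp add: act_add distrib_left lin_add[OF lin_act])
  next
    case (2 t' r')
    show ?case
      by (simp add: act_single mult_single wact_add lin_scale[OF lin_wact] scaleV_simps)
  qed
qed

lemma act_gen: "act (gen g) v = gact g v"
  by (simp add: gen_def act_single scaleV_simps)

lemma act_scalar: "act (scalar r) v = scaleV r v"
  by (simp add: scalar_def act_single zero_free_word_def)

lemma act_0: "act 0 v = 0"
  by (simp add: act_def)

lemma act_diff: "act (x - y) v = act x v - act y v"
  using act_add[of "x - y" y v] by (simp add: algebra_simps)

abbreviation "ideal_pod \<equiv> podles_ideal q c d"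

lemma podles_ideal_ideal: "ideal ideal_pod ring_of_type_algebra"
  and podles_relations_ideal: "podles_relations q c d \<subseteq> ideal_pod"
  using ring.genideal_ideal[OF ring_of_type_algebra_ring, of "podles_relations q c d"]
    ring.genideal_self[OF ring_of_type_algebra_ring, of "podles_relations q c d"]
  by (simp_all add: podles_ideal_def)

lemma ideal_pod_closed:
  "x \<in> ideal_pod \<Longrightarrow> y \<in> ideal_pod \<Longrightarrow> x + y \<in> ideal_pod"
  "x \<in> ideal_pod \<Longrightarrow> z * x \<in> ideal_pod" "x \<in> ideal_pod \<Longrightarrow> x * z \<in> ideal_pod" "0 \<in> ideal_pod"
proof -
  interpret ideal ideal_pod ring_of_type_algebra by (rule podles_ideal_ideal)
  show "x \<in> ideal_pod \<Longrightarrow> y \<in> ideal_pod \<Longrightarrow> x + y \<in> ideal_pod"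
    using additive_subgroup.a_closed[OF is_additive_subgroup] by simp
  show "x \<in> ideal_pod \<Longrightarrow> z * x \<in> ideal_pod" using I_l_closed[of x z] by simp
  show "x \<in> ideal_pod \<Longrightarrow> x * z \<in> ideal_pod" using I_r_closed[of x z] by simp
  show "0 \<in> ideal_pod" using additive_subgroup.zero_closed[OF is_additive_subgroup] by simp
qed

lemma ideal_pod_uminus: "x \<in> ideal_pod \<Longrightarrow> - x \<in> ideal_pod"
  using ideal_pod_closed(2)[of x "- 1"] by simp

definition eqv (infix "\<doteq>" 50) where "x \<doteq> y \<longleftrightarrow> x - y \<in> ideal_pod"

lemma eqv_refl [simp]: "x \<doteq> x" by (simp add: eqv_def ideal_pod_closed)

lemma eqv_sym: "x \<doteq> y \<Longrightarrow> y \<doteq> x"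
  using ideal_pod_uminus[of "x - y"] by (simp add: eqv_def)

lemma eqv_trans [trans]: "x \<doteq> y \<Longrightarrow> y \<doteq> z \<Longrightarrow> x \<doteq> z"
  using ideal_pod_closed(1)[of "x - y" "y - z"] by (simp add: eqv_def)

lemma eqv_add: "x \<doteq> y \<Longrightarrow> x' \<doteq> y' \<Longrightarrow> x + x' \<doteq> y + y'"
  using ideal_pod_closed(1)[of "x - y" "x' - y'"] by (simp add: eqv_def algebra_simps)

lemma eqv_mult: "x \<doteq> y \<Longrightarrow> x' \<doteq> y' \<Longrightarrow> x * x' \<doteq> y * y'"
  using ideal_pod_closed(1)[OF ideal_pod_closed(3)[of "x - y" x'] ideal_pod_closed(2)[of "x' - y'" y]]
  by (simp add: eqv_def algebra_simps)

lemma eqv_relations: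
  "gen Gen_B * gen Gen_A \<doteq> scalar (q^2) * gen Gen_A * gen Gen_B"
  "gen Gen_A * gen Gen_Bstar \<doteq> scalar (q^2) * gen Gen_Bstar * gen Gen_A"
  "gen Gen_Bstar * gen Gen_B \<doteq> scalar (c * d) + scalar (c - d) * gen Gen_A - (gen Gen_A)^2"
  "gen Gen_B * gen Gen_Bstar \<doteq> scalar (c * d) + scalar (q^2 * (c - d)) * gen Gen_A - scalar (q^4) * (gen Gen_A)^2"
  using podles_relations_ideal by (auto simp: podles_relations_def Let_def eqv_def)

text \<open>The elements that act as zero form an ideal containing the relations. So the action
  descends to the quotient, and \<open>act_psi\<close> then gives linear independence of the normal
  monomials.\<close>

lemma act_ideal:
  assumes "x \<in> ideal_pod"
  shows "act x v = 0"
proof -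
  define I where "I = {x. \<forall>v. act x v = 0}"
  have "ideal I ring_of_type_algebra"
    by (rule ideal_ring_of_type_algebraI) (auto simp: I_def act_0 act_add act_mult lin_0[OF lin_act])
  moreover have "podles_relations q c d \<subseteq> I"
    by (auto simp: podles_relations_def Let_def I_def act_add act_diff act_mult act_gen act_scalar
        power2_eq_square[of "gen _"] opB_opA opA_opS opS_opB opB_opS)
  ultimately have "ideal_pod \<subseteq> I"
    unfolding podles_ideal_def by (intro ring.genideal_minimal[OF ring_of_type_algebra_ring])
  then show ?thesis using assms by (auto simp: I_def)
qed

lemma psi_exists: "\<exists>\<psi>. lin scaleV (\<lambda>r x. scalar r * x) \<psi> \<and> (\<forall>u. \<psi> (opA u) = gen Gen_A * \<psi> u) \<and>
    (\<forall>j. \<psi> (wV j) = (if j \<ge> 0 then gen Gen_B ^ nat j else gen Gen_Bstar ^ nat (- j)))"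
proof -
  have "lin (\<lambda>r x. scalar r * x) (\<lambda>r x. scalar r * x) (\<lambda>x. gen Gen_A * x)"
    by (simp add: lin_def distrib_left mult.assoc[symmetric] scalar_central)
  moreover have "lin scaleV (\<lambda>r x. scalar r * x) (\<lambda>_. 0)"
    by (simp add: lin_def)
  ultimately show ?thesis
    using V_extend[of "\<lambda>r x. scalar r * x" "\<lambda>x. gen Gen_A * x" "\<lambda>_. 0"
        "\<lambda>j. if j \<ge> 0 then gen Gen_B ^ nat j else gen Gen_Bstar ^ nat (- j)"]
    by (simp add: distrib_left distrib_right scalar_add scalar_mult scalar_1 mult.assoc[symmetric] split del: if_split)
qed

text \<open>Writes a normal form as an element of the free algebra. The three conditions determine
  it, as the model is generated from the \<open>wV j\<close> by linear combinations and
  \<open>opA\<close>.\<close>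

definition psi :: "(int \<Rightarrow>\<^sub>0 'k poly) \<Rightarrow> 'k podles_free" where
  "psi = (SOME \<psi>. lin scaleV (\<lambda>r x. scalar r * x) \<psi> \<and> (\<forall>u. \<psi> (opA u) = gen Gen_A * \<psi> u) \<and>
    (\<forall>j. \<psi> (wV j) = (if j \<ge> 0 then gen Gen_B ^ nat j else gen Gen_Bstar ^ nat (- j))))"

lemma psi_spec: "lin scaleV (\<lambda>r x. scalar r * x) psi \<and> (\<forall>u. psi (opA u) = gen Gen_A * psi u) \<and>
    (\<forall>j. psi (wV j) = (if j \<ge> 0 then gen Gen_B ^ nat j else gen Gen_Bstar ^ nat (- j)))"
  unfolding psi_def by (rule someI_ex[OF psi_exists])

lemma lin_psi: "lin scaleV (\<lambda>r x. scalar r * x) psi"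
  and psi_opA: "psi (opA u) = gen Gen_A * psi u"
  and psi_wV: "psi (wV j) = (if j \<ge> 0 then gen Gen_B ^ nat j else gen Gen_Bstar ^ nat (- j))"
  using psi_spec by auto

lemma act_psi: "act (psi u) oneV = u"
proof (induction u rule: V_induct)
  case (4 j)
  have B: "act (gen Gen_B ^ n) oneV = wV (int n)" for n
  proof (induction n)
    case 0 show ?case by (simp add: act_scalar scalar_1[symmetric] scaleV_simps oneV_def)
  next
    case (Suc n) then show ?case by (simp add: act_mult act_gen opB_wV add.commute)
  qed
  have S: "act (gen Gen_Bstar ^ n) oneV = wV (- int n)" for n
  proof (induction n)
    case 0 show ?case by (simp add: act_scalar scalar_1[symmetric] scaleV_simps oneV_def)
  next
    case (Suc n)
    then have "act (gen Gen_Bstar ^ Suc n) oneV = wV (- int n - 1)"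
      by (simp add: act_mult act_gen opS_wV)
    moreover have "- int n - 1 = - int (Suc n)" by simp
    ultimately show ?case by metis
  qed
  show ?case by (simp add: psi_wV B S)
qed (simp_all add: lin_add[OF lin_psi] lin_scale[OF lin_psi] psi_opA act_add act_mult act_scalar act_gen)

lemma psi_wV_B: "psi (opB (wV j)) \<doteq> gen Gen_B * psi (wV j)"
proof (cases "j \<ge> 0")
  case True
  then show ?thesis by (simp add: opB_wV psi_wV nat_add_distrib)
next
  case False
  \<comment> \<open>For negative \<open>j\<close> the letter \<open>B\<close> meets a leading
    \<open>S\<close>, and the fourth relation has to be used.\<close>
  then have "wV j = opS (wV (j + 1))" using opS_wV[of "j + 1"] by simp
  then have eq: "opB (wV j) = scaleV (c * d) (wV (j + 1)) + scaleV (q^2 * (c - d)) (opA (wV (j + 1))) - scaleV (q^4) (opA (opA (wV (j + 1))))"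
    by (metis opB_opS)
  have "psi (opB (wV j)) = (scalar (c * d) + scalar (q^2 * (c - d)) * gen Gen_A - scalar (q^4) * (gen Gen_A)^2) * psi (wV (j + 1))"
    unfolding eq
    by (simp add: lin_add[OF lin_psi] lin_diff[OF lin_psi] lin_scale[OF lin_psi] psi_opA left_diff_distrib
        distrib_right mult.assoc power2_eq_square[of "gen _"])
  moreover have "psi (wV j) = gen Gen_Bstar * psi (wV (j + 1))"
  proof -
    have "nat (- j) = Suc (nat (- (j + 1)))" using False by simp
    then show ?thesis using False by (simp add: psi_wV)
  qed
  ultimately show ?thesis
    using eqv_mult[OF eqv_sym[OF eqv_relations(4)] eqv_refl] by (simp add: mult.assoc)
qed

lemma psi_wV_S: "psi (opS (wV j)) \<doteq> gen Gen_Bstar * psi (wV j)"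
proof (cases "j \<le> 0")
  case True
  then have "nat (1 - j) = Suc (nat (- j))" by simp
  then show ?thesis using True by (auto simp: opS_wV psi_wV)
next
  case False
  then have "wV j = opB (wV (j - 1))" using opB_wV[of "j - 1"] by simp
  then have eq: "opS (wV j) = scaleV (c * d) (wV (j - 1)) + scaleV (c - d) (opA (wV (j - 1))) - opA (opA (wV (j - 1)))"
    by (metis opS_opB)
  have "psi (opS (wV j)) = (scalar (c * d) + scalar (c - d) * gen Gen_A - (gen Gen_A)^2) * psi (wV (j - 1))"
    unfolding eq
    by (simp add: lin_add[OF lin_psi] lin_diff[OF lin_psi] lin_scale[OF lin_psi] psi_opA left_diff_distrib
        distrib_right mult.assoc power2_eq_square[of "gen _"])
  moreover have "psi (wV j) = gen Gen_B * psi (wV (j - 1))"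
  proof -
    have "nat j = Suc (nat (j - 1))" using False by simp
    then show ?thesis using False by (simp add: psi_wV)
  qed
  ultimately show ?thesis
    using eqv_mult[OF eqv_sym[OF eqv_relations(3)] eqv_refl] by (simp add: mult.assoc)
qed

lemma scalar_gen_left: "scalar r * (gen g * x) = gen g * (scalar r * x)"
  by (metis scalar_central mult.assoc)

text \<open>The spanning half of the basis theorem: modulo the ideal, the span of the normal
  monomials is stable under left multiplication by the generators.\<close>

lemma psi_gact: "psi (gact g u) \<doteq> gen g * psi u"
proof (induction u rule: V_induct)
  case (1 u v)
  then show ?case using eqv_add by (simp add: lin_add[OF lin_gact] lin_add[OF lin_psi] distrib_left)
next
  case (2 r u)
  then show ?case
    using eqv_mult[OF eqv_refl[of "scalar r"]] by (simp add: lin_scale[OF lin_gact] lin_scale[OF lin_psi] scalar_gen_left[symmetric])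
next
  case (3 u)
  have *: "x * (gen g * psi u) \<doteq> x * psi (gact g u)" for x
    using eqv_mult[OF eqv_refl eqv_sym[OF 3]] .
  show ?case
  proof (cases g)
    case Gen_A
    then show ?thesis using psi_opA by simp
  next
    case Gen_B
    have "psi (gact g (opA u)) = scalar (q^2) * gen Gen_A * psi (gact g u)"
      using Gen_B by (simp add: opB_opA lin_scale[OF lin_psi] psi_opA mult.assoc)
    also have "\<dots> \<doteq> (scalar (q^2) * gen Gen_A * gen g) * psi u"
      using eqv_sym[OF *[of "scalar (q^2) * gen Gen_A"]] by (simp only: mult.assoc)
    also have "\<dots> \<doteq> (gen g * gen Gen_A) * psi u"
      using Gen_B eqv_mult[OF eqv_sym[OF eqv_relations(1)] eqv_refl] by simp
    finally show ?thesis by (simp add: psi_opA mult.assoc)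
  next
    case Gen_Bstar
    \<comment> \<open>The second relation is needed backwards, to move \<open>A\<close> to the left
      of \<open>S\<close>, so \<open>q^2\<close> has to be inverted.\<close>
    have inv: "scalar (1 / q^2) * scalar (q^2) = 1"
      using q_nonzero by (simp add: scalar_mult scalar_1)
    have "opS (opA u) = scaleV (1 / q^2) (opA (opS u))"
      using q_nonzero by (simp add: opA_opS scaleV_simps)
    then have "psi (gact g (opA u)) = scalar (1 / q^2) * gen Gen_A * psi (gact g u)"
      using Gen_Bstar by (simp add: lin_scale[OF lin_psi] psi_opA mult.assoc)
    also have "\<dots> \<doteq> scalar (1 / q^2) * gen Gen_A * (gen g * psi u)"
      using eqv_sym[OF *] .
    also have "\<dots> = scalar (1 / q^2) * ((gen Gen_A * gen g) * psi u)" by (simp add: mult.assoc)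
    also have "\<dots> \<doteq> scalar (1 / q^2) * ((scalar (q^2) * gen g * gen Gen_A) * psi u)"
      using Gen_Bstar eqv_mult[OF eqv_refl eqv_mult[OF eqv_relations(2) eqv_refl]] by simp
    also have "\<dots> = (scalar (1 / q^2) * scalar (q^2)) * (gen g * gen Gen_A * psi u)" by (simp add: mult.assoc)
    also have "\<dots> = gen g * psi (opA u)" unfolding inv by (simp add: psi_opA mult.assoc)
    finally show ?thesis .
  qed
next
  case (4 j)
  then show ?case using psi_wV_B psi_wV_S psi_opA by (cases g) auto
qed

lemma psi_act: "psi (act x oneV) \<doteq> x"
proof (induction x rule: poly_mapping_induct)
  case (1 x y)
  then show ?case using eqv_add by (simp add: act_add lin_add[OF lin_psi])
next
  case (2 t r)
  obtain gs where t: "t = Word gs" by (cases t)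
  show ?case unfolding t
  proof (induction gs)
    case Nil
    then show ?case by (simp add: single_Word_Nil act_scalar lin_scale[OF lin_psi] oneV_def psi_wV)
  next
    case (Cons g gs)
    have "psi (act (single (Word (g # gs)) r) oneV) \<doteq> gen g * psi (act (single (Word gs) r) oneV)"
      unfolding single_Word_Cons act_mult act_gen by (rule psi_gact)
    also have "\<dots> \<doteq> single (Word (g # gs)) r"
      unfolding single_Word_Cons using eqv_mult[OF eqv_refl Cons] .
    finally show ?case .
  qed
qed

text \<open>One direction is \<open>act_ideal\<close>, the other \<open>psi_act\<close>. So
  \<open>x \<mapsto> act x oneV\<close> induces a linear isomorphism of the quotient with the
  model.\<close>

lemma eqv_iff_act: "x \<doteq> y \<longleftrightarrow> act x oneV = act y oneV"
proof
  assume "x \<doteq> y"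
  then show "act x oneV = act y oneV"
    using act_ideal[of "x - y" oneV] by (simp add: eqv_def act_diff)
next
  assume "act x oneV = act y oneV"
  then show "x \<doteq> y" using psi_act[of x] psi_act[of y] eqv_sym eqv_trans by metis
qed

lemma eqv_act: "x \<doteq> y \<Longrightarrow> act x v = act y v"
  using act_ideal[of "x - y" v] by (simp add: eqv_def act_diff)

text \<open>The product of the quotient, transported to normal forms.\<close>

definition mulV (infixl "\<star>" 70) where "mulV u v = act (psi u) v"

lemma act_eq_mulV: "act x v = act x oneV \<star> v"
  unfolding mulV_def using eqv_act[OF eqv_sym[OF psi_act]] .

lemma mulV_act: "act x oneV \<star> act y oneV = act (x * y) oneV"
  by (simp add: act_eq_mulV[symmetric] act_mult)

lemma mulV_gen: "opA oneV \<star> v = opA v" "opB oneV \<star> v = opB v" "opS oneV \<star> v = opS v"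
  using act_eq_mulV[of "gen Gen_A" v] act_eq_mulV[of "gen Gen_B" v] act_eq_mulV[of "gen Gen_Bstar" v]
  by (simp_all add: act_gen)

lemma mulV_algebra:
  "(u + v) \<star> t = u \<star> t + v \<star> t" "t \<star> (u + v) = t \<star> u + t \<star> v"
  "scaleV r u \<star> v = scaleV r (u \<star> v)" "u \<star> scaleV r v = scaleV r (u \<star> v)"
  "(u \<star> v) \<star> t = u \<star> (v \<star> t)" "oneV \<star> v = v" "v \<star> oneV = v"
proof -
  show "(u \<star> v) \<star> t = u \<star> (v \<star> t)"
    using mulV_act[of "psi u * psi v" "psi t"] mulV_act[of "psi u" "psi v * psi t"]
      mulV_act[of "psi u" "psi v"] mulV_act[of "psi v" "psi t"]
    by (simp add: act_psi mult.assoc)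
  show "oneV \<star> v = v"
    using act_eq_mulV[of "scalar 1" v] by (simp add: act_scalar scaleV_simps)
qed (simp_all add: mulV_def lin_add[OF lin_psi] lin_scale[OF lin_psi] lin_add[OF lin_act] lin_scale[OF lin_act]
    act_add act_mult act_scalar act_psi)

end

section \<open>Automorphisms\<close>

context podles_model
begin

lemma mulV_sum_left: "(\<Sum>i\<in>I. f i) \<star> v = (\<Sum>i\<in>I. f i \<star> v)"
  by (induction I rule: infinite_finite_induct) (use mulV_algebra(3)[of 0 0 v] in \<open>simp_all add: mulV_algebra scaleV_simps\<close>)

lemma opA_mulV: "opA u \<star> v = opA (u \<star> v)"
  using mulV_algebra(5)[of "opA oneV" u v] by (simp add: mulV_gen)

lemma opB_mulV: "opB u \<star> v = opB (u \<star> v)"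
  using mulV_algebra(5)[of "opB oneV" u v] by (simp add: mulV_gen)

lemma opS_mulV: "opS u \<star> v = opS (u \<star> v)"
  using mulV_algebra(5)[of "opS oneV" u v] by (simp add: mulV_gen)

lemma smul_pCons: "smul (pCons a p) u = scaleV a u + opA (smul p u)"
  by (rule poly_mapping_eqI) (simp add: lookup_add)

lemma single_mulV: "single j p \<star> v = smul p (wV j \<star> v)"
proof (induction p)
  case 0
  then show ?case using mulV_algebra(3)[of 0 0 v] by (simp add: smul_simps scaleV_simps)
next
  case (pCons a p)
  have "single j (pCons a p) = scaleV a (wV j) + opA (single j p)"
    by (rule poly_mapping_eqI) (simp add: lookup_add wV_def lookup_single when_def)
  then show ?case by (simp add: smul_pCons mulV_algebra opA_mulV pCons.IH)
qed

lemma wV_pos_mulV: "j \<ge> 0 \<Longrightarrow> wV (j + 1) \<star> v = opB (wV j \<star> v)"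
  by (simp add: opB_mulV flip: opB_wV)

lemma wV_neg_mulV: "j \<le> 0 \<Longrightarrow> wV (j - 1) \<star> v = opS (wV j \<star> v)"
  by (simp add: opS_mulV flip: opS_wV)

lemma wV_0_mulV: "wV 0 \<star> v = v"
  using mulV_algebra(6) by (simp add: oneV_def)

lemma dil_eq_0_iff: "r \<noteq> 0 \<Longrightarrow> dil r p = 0 \<longleftrightarrow> p = 0"
  by (simp add: poly_eq_iff coeff_dil)

lemma pa_nonzero: "pa \<noteq> 0"
  by (simp add: pa_def)

lemma lookup_opB_0_iff: "lookup (opB v) l = 0 \<longleftrightarrow> lookup v (l - 1) = 0"
  using q_nonzero by (simp add: lookup_opB dil_eq_0_iff pa_nonzero)

lemma lookup_opS_0_iff: "lookup (opS v) l = 0 \<longleftrightarrow> lookup v (l + 1) = 0"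
  using q_nonzero by (simp add: lookup_opS dil_eq_0_iff pa_nonzero)

text \<open>The algebra is graded with \<open>B\<close>, \<open>A\<close>, \<open>S\<close> in
  degrees 1, 0, -1. Multiplication by \<open>w j\<close> shifts the degree and changes coefficients
  only by dilations and nonzero polynomial factors, so no component is lost.\<close>

lemma lookup_wV_mulV_0_iff: "lookup (wV j \<star> v) l = 0 \<longleftrightarrow> lookup v (l - j) = 0"
proof (induction j arbitrary: l rule: int_induct[where k = 0])
  case base
  then show ?case by (simp add: wV_0_mulV)
next
  case (step1 j)
  then show ?case by (simp add: wV_pos_mulV lookup_opB_0_iff) (simp add: algebra_simps)
next
  case (step2 j)
  then show ?case by (simp add: wV_neg_mulV lookup_opS_0_iff) (simp add: algebra_simps)
qed

lemma lookup_single_mulV_0_iff: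
  "lookup (single j p \<star> v) l = 0 \<longleftrightarrow> p = 0 \<or> lookup v (l - j) = 0"
  by (simp add: single_mulV lookup_wV_mulV_0_iff)

lemma mulV_expand: "lookup (u \<star> v) l =
    (\<Sum>j\<in>keys u. lookup (single j (lookup u j) \<star> v) l)"
  by (subst poly_mapping_sum_single[of u]) (simp add: mulV_sum_left lookup_sum)

lemma mulV_unique_lookup:
  assumes "\<And>j. j \<in> keys u \<Longrightarrow> j \<noteq> a \<Longrightarrow> lookup v (l - j) = 0"
  shows "lookup (u \<star> v) l =
    lookup (single a (lookup u a) \<star> v) l"
proof -
  have "lookup (u \<star> v) l = (\<Sum>j\<in>keys u. if j = a then
      lookup (single a (lookup u a) \<star> v) l else 0)"
    unfolding mulV_expand[of u v l] using assms by (intro sum.cong) (auto simp: lookup_single_mulV_0_iff)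
  also have "\<dots> = lookup (single a (lookup u a) \<star> v) l"
    using lookup_single_mulV_0_iff[of a "lookup u a" v l]
    by (cases "a \<in> keys u") (simp_all add: in_keys_iff)
  finally show ?thesis .
qed

text \<open>The extreme components of a product arise from a single pair of components, so nothing
  can cancel there.\<close>

lemma mulV_top_key:
  assumes "u \<noteq> 0" "v \<noteq> 0"
  shows "Max (keys u) + Max (keys v) \<in> keys (u \<star> v)"
    "Min (keys u) + Min (keys v) \<in> keys (u \<star> v)"
proof -
  have ne: "keys u \<noteq> {}" "keys v \<noteq> {}"
    using assms keys_eq_empty by auto
  have Max: "Max (keys u) \<in> keys u" "Max (keys v) \<in> keys v"
    and Min: "Min (keys u) \<in> keys u" "Min (keys v) \<in> keys v"
    using ne by simp_all
  have z: "lookup v l = 0" if "l < Min (keys v) \<or> l > Max (keys v)" for l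
  proof (rule ccontr)
    assume "lookup v l \<noteq> 0"
    then have "l \<in> keys v" by (simp add: in_keys_iff)
    then show False
      using that Min_le[OF finite_keys, of l v] Max_ge[OF finite_keys, of l v] by linarith
  qed
  have "lookup (u \<star> v) (Max (keys u) + Max (keys v)) \<noteq> 0"
  proof (subst mulV_unique_lookup[where a = "Max (keys u)"])
    fix j assume "j \<in> keys u" "j \<noteq> Max (keys u)"
    moreover from this have "j \<le> Max (keys u)" by simp
    ultimately have "j < Max (keys u)" by linarith
    then show "lookup v (Max (keys u) + Max (keys v) - j) = 0"
      by (intro z) simp
  qed (use Max in \<open>simp add: lookup_single_mulV_0_iff in_keys_iff\<close>)
  then show "Max (keys u) + Max (keys v) \<in> keys (u \<star> v)"
    by (simp add: in_keys_iff)
  have "lookup (u \<star> v) (Min (keys u) + Min (keys v)) \<noteq> 0"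
  proof (subst mulV_unique_lookup[where a = "Min (keys u)"])
    fix j assume "j \<in> keys u" "j \<noteq> Min (keys u)"
    moreover from this have "j \<ge> Min (keys u)" by simp
    ultimately have "j > Min (keys u)" by linarith
    then show "lookup v (Min (keys u) + Min (keys v) - j) = 0"
      by (intro z) simp
  qed (use Min in \<open>simp add: lookup_single_mulV_0_iff in_keys_iff\<close>)
  then show "Min (keys u) + Min (keys v) \<in> keys (u \<star> v)"
    by (simp add: in_keys_iff)
qed

abbreviation "genA \<equiv> opA oneV"
abbreviation "genB \<equiv> opB oneV"
abbreviation "genS \<equiv> opS oneV"

lemma wV_mulV_genA: "wV j \<star> genA = scaleV (q powi (2 * j)) (opA (wV j))"
proof (induction j rule: int_induct[where k = 0])
  case base
  then show ?case by (simp add: wV_0_mulV oneV_def scaleV_simps)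
next
  case (step1 j)
  then show ?case using q_nonzero
    by (simp add: wV_pos_mulV lin_scale[OF lin_opB] opB_opA opB_wV scaleV_simps power_int_add distrib_left)
next
  case (step2 j)
  have "opS (opA u) = scaleV (1 / q^2) (opA (opS u))" for u
    using q_nonzero by (simp add: opA_opS scaleV_simps)
  then show ?case using q_nonzero step2
    by (simp add: wV_neg_mulV lin_scale[OF lin_opS] opS_wV scaleV_simps power_int_diff right_diff_distrib)
qed

lemma genA_eq: "genA = single 0 [:0, 1:]"
  by (rule poly_mapping_eqI) (simp add: oneV_def wV_def lookup_single when_def lookup_one)

lemma genB_eq: "genB = wV 1" and genS_eq: "genS = wV (- 1)"
  using opB_wV[of 0] opS_wV[of 0] by (simp_all add: oneV_def)

lemma lookup_mulV_genA: "lookup (u \<star> genA) j = [:0, q powi (2 * j):] * lookup u j"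
proof -
  have "lookup (u \<star> genA) j = lookup u j * lookup (wV j \<star> genA) j"
    using mulV_unique_lookup[of u j genA j] unfolding single_mulV
    by (simp add: genA_eq lookup_single when_def)
  then show ?thesis
    by (simp add: wV_mulV_genA) (simp add: wV_def)
qed

text \<open>In each degree, \<open>A\<close> commutes up to a power of \<open>q\<close>. An
  automorphism preserves this kind of normality, which is how the image of \<open>A\<close> is
  located.\<close>

lemma genA_normal: "\<exists>y. genA \<star> u = y \<star> genA"
proof (induction u rule: V_induct)
  case (1 u v)
  then show ?case by (metis mulV_algebra(1,2))
next
  case (2 r u)
  then show ?case by (metis mulV_algebra(3,4))
next
  case (3 u)
  then obtain y where "genA \<star> u = y \<star> genA" by blast
  then have "genA \<star> opA u = opA y \<star> genA" by (simp add: mulV_gen(1) opA_mulV[of y])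
  then show ?case by blast
next
  case (4 j)
  have "genA \<star> wV j = scaleV (q powi (- 2 * j)) (wV j) \<star> genA"
    using q_nonzero by (simp add: mulV_algebra wV_mulV_genA scaleV_simps mulV_gen power_int_minus)
  then show ?case by blast
qed

text \<open>Comparing degrees makes \<open>p\<close> a constant \<open>b\<close>. Then
  \<open>b r^i = 1\<close> for every exponent \<open>i\<close> that occurs in \<open>f\<close>,
  which leaves room for one exponent only.\<close>

lemma dil_selfsimilar_monom:
  assumes "f = p * dil r f" "f \<noteq> 0" "r \<noteq> 0" "\<And>m. m > 0 \<Longrightarrow> r ^ m \<noteq> 1"
  obtains a i where "a \<noteq> 0" "f = Polynomial.monom a i"
proof -
  have "p \<noteq> 0" using assms(1,2) by auto
  moreover have "Polynomial.degree (dil r f) = Polynomial.degree f"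
    using assms(3) by (simp add: dil_def degree_pcompose)
  ultimately have "Polynomial.degree p = 0"
    using degree_mult_eq[of p "dil r f"] assms(1,2,3) by (simp add: dil_eq_0_iff)
  then obtain b where p: "p = [:b:]" by (rule degree_eq_zeroE)
  have b: "b * r ^ i = 1" if "Polynomial.coeff f i \<noteq> 0" for i
  proof -
    have "Polynomial.coeff f i = b * (r ^ i * Polynomial.coeff f i)"
      using arg_cong[OF assms(1), of "\<lambda>f. Polynomial.coeff f i"] by (simp add: p coeff_dil)
    then show ?thesis using that by simp
  qed
  have unique: "i \<le> j" if "Polynomial.coeff f i \<noteq> 0" "Polynomial.coeff f j \<noteq> 0" for i j
  proof (rule ccontr)
    assume "\<not> i \<le> j"
    then have "r ^ i = r ^ j * r ^ (i - j)" by (simp flip: power_add)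
    moreover have "r ^ i = r ^ j" using b[OF that(1)] b[OF that(2)] by (metis mult_cancel_left zero_neq_one mult_zero_left)
    ultimately have "r ^ (i - j) = 1" using assms(3) by simp
    then show False using assms(4)[of "i - j"] \<open>\<not> i \<le> j\<close> by simp
  qed
  let ?n = "Polynomial.degree f"
  have lc: "Polynomial.coeff f ?n \<noteq> 0" using assms(2) by simp
  have "f = Polynomial.monom (Polynomial.coeff f ?n) ?n"
    using unique lc by (intro poly_eqI) (metis coeff_monom le_antisym)
  then show ?thesis using that lc by blast
qed

text \<open>Degrees make \<open>p\<close> a constant, so coefficients can be compared. Only the
  squares of \<open>s\<close> and \<open>t\<close> are determined: for \<open>c = d\<close> the
  polynomial \<open>pa\<close> is even, in accordance with the automorphisms that send
  \<open>A\<close> to \<open>-A\<close>.\<close>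

lemma pa_dil_proportional:
  assumes "dil s pa = p * dil t pa" "s \<noteq> 0" "t \<noteq> 0" "c + d \<noteq> 0"
  shows "s^2 = t^2"
proof -
  have deg: "Polynomial.degree (dil r pa) = 2" if "r \<noteq> 0" for r
    using that by (simp add: dil_def degree_pcompose pa_def)
  have "p \<noteq> 0" using assms deg[of s] by auto
  then have "Polynomial.degree (dil s pa) = Polynomial.degree p + Polynomial.degree (dil t pa)"
    unfolding assms(1) using assms(3) by (intro degree_mult_eq) (simp_all add: dil_eq_0_iff pa_nonzero)
  then have "Polynomial.degree p = 0" using assms(2,3) deg by simp
  then obtain b where p: "p = [:b:]" by (rule degree_eq_zeroE)
  have co: "s ^ i * Polynomial.coeff pa i = b * (t ^ i * Polynomial.coeff pa i)" for i
    using arg_cong[OF assms(1), of "\<lambda>f. Polynomial.coeff f i"] by (simp add: p coeff_dil)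
  have 2: "s^2 = b * t^2" using co[of 2] by (simp add: pa_def numeral_2_eq_2)
  have 1: "s * (c - d) = b * t * (c - d)" using co[of 1] by (simp add: pa_def)
  have 0: "c * d = b * (c * d)" using co[of 0] by (simp add: pa_def)
  show ?thesis
  proof (rule ccontr)
    assume "s^2 \<noteq> t^2"
    \<comment> \<open>With \<open>b \<noteq> 1\<close> the constant term gives
      \<open>c d = 0\<close>. If \<open>c \<noteq> d\<close>, the linear term gives
      \<open>s = b t\<close>, which is incompatible with \<open>s^2 = b t^2\<close>; if
      \<open>c = d\<close>, both are 0, against \<open>c + d \<noteq> 0\<close>.\<close>
    then have "b \<noteq> 1" using 2 by auto
    then have "c * d = 0" using 0 by auto
    have "c = d"
    proof (rule ccontr)
      assume "c \<noteq> d"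
      then have "s = b * t" using 1 by simp
      then have "b * b * t^2 = b * t^2" using 2 by (simp add: power2_eq_square algebra_simps)
      then have "b = 0 \<or> b = 1" using assms(3) by simp
      then show False using \<open>b \<noteq> 1\<close> \<open>s = b * t\<close> assms(2) by simp
    qed
    then show False using \<open>c * d = 0\<close> assms(4) by simp
  qed
qed

lemma wV_mulV_genB: "j \<ge> 0 \<Longrightarrow> wV j \<star> genB = wV (j + 1)"
proof (induction j rule: int_ge_induct)
  case base
  then show ?case by (simp add: wV_0_mulV oneV_def opB_wV)
next
  case (step j)
  then show ?case by (simp add: wV_pos_mulV opB_wV)
qed

lemma wV_mulV_genS: "j \<le> 0 \<Longrightarrow> wV j \<star> genS = wV (j - 1)"
proof (induction j rule: int_le_induct)
  case base
  then show ?case by (simp add: wV_0_mulV oneV_def opS_wV)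
next
  case (step j)
  then show ?case by (simp add: wV_neg_mulV opS_wV)
qed

text \<open>Here \<open>B^(n+1) S = B^n a(q^2 A)\<close>, and each remaining \<open>B\<close>
  dilates the coefficient once more by \<open>q^2\<close>. The counterpart below rests on
  \<open>S^(n+1) B = S^n a(A)\<close>.\<close>

lemma lookup_wV_mulV_genS: "lookup (wV (int n + 1) \<star> genS) (int n) = dil ((q^2) ^ Suc n) pa"
proof (induction n)
  case 0
  then show ?case
    using wV_pos_mulV[of 0 genS] by (simp add: wV_0_mulV lookup_opB) (simp add: genS_eq wV_def)
next
  case (Suc n)
  have "wV (int (Suc n) + 1) \<star> genS = opB (wV (int n + 1) \<star> genS)"
    using wV_pos_mulV[of "int n + 1" genS] by (simp add: algebra_simps)
  then show ?case using Suc by (simp add: lookup_opB dil_dil)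
qed

lemma lookup_wV_mulV_genB: "lookup (wV (- int n - 1) \<star> genB) (- int n) = dil ((1 / q^2) ^ n) pa"
proof (induction n)
  case 0
  then show ?case
    using wV_neg_mulV[of 0 genB] by (simp add: wV_0_mulV lookup_opS dil_1) (simp add: genB_eq wV_def)
next
  case (Suc n)
  have "wV (- int (Suc n) - 1) \<star> genB = opS (wV (- int n - 1) \<star> genB)"
    using wV_neg_mulV[of "- int n - 1" genB] by (simp add: algebra_simps)
  then show ?case using Suc by (simp add: lookup_opS dil_dil)
qed

end

section \<open>Normal elements and automorphisms for generic parameters\<close>

locale podles_generic = podles_model q c d for q c d :: "'k::field" +
  assumes q_not_root: "m > 0 \<Longrightarrow> q ^ m \<noteq> 1"
    and cd_nonzero: "c + d \<noteq> 0"
begin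

lemma q_powi_inj: "q powi m = q powi n \<Longrightarrow> m = n"
proof -
  have aux: "m \<le> n" if "q powi m = q powi n" for m n
  proof (rule ccontr)
    assume "\<not> m \<le> n"
    have "q powi (m - n) = 1" using that q_nonzero by (simp add: power_int_diff)
    then have "q ^ nat (m - n) = 1" using \<open>\<not> m \<le> n\<close> by (simp add: power_int_def)
    then show False using q_not_root[of "nat (m - n)"] \<open>\<not> m \<le> n\<close> by simp
  qed
  show "q powi m = q powi n \<Longrightarrow> m = n" using aux[of m n] aux[of n m] by simp
qed

text \<open>Since \<open>x A\<close> has the same support as \<open>x\<close>, the extreme degrees
  of \<open>y\<close> are both 0. Then the coefficient of \<open>y\<close> equals
  \<open>q^(2 j) A\<close> for every degree \<open>j\<close> in the support of \<open>x\<close>, and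
  these are pairwise distinct.\<close>

lemma normal_homogeneous:
  assumes "x \<noteq> 0" "x \<star> genA = y \<star> x"
  obtains j f where "f \<noteq> 0" "x = single j f"
proof -
  have keys: "keys (x \<star> genA) = keys x"
    using q_nonzero by (auto simp: in_keys_iff lookup_mulV_genA)
  have ne: "keys x \<noteq> {}" using assms(1) keys_eq_empty by auto
  have "y \<noteq> 0"
  proof
    assume "y = 0"
    then have "y \<star> x = 0" using mulV_algebra(3)[of 0 0 x] by (simp add: scaleV_simps)
    then have "keys x = {}" using keys assms(2) by simp
    then show False using ne by simp
  qed
  then have ney: "keys y \<noteq> {}" using keys_eq_empty by auto
  have "Max (keys y) + Max (keys x) \<le> Max (keys x)"
    "Min (keys y) + Min (keys x) \<ge> Min (keys x)" 
    using mulV_top_key[OF \<open>y \<noteq> 0\<close> assms(1), THEN Max_ge[OF finite_keys]]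
      mulV_top_key[OF \<open>y \<noteq> 0\<close> assms(1), THEN Min_le[OF finite_keys]] keys assms(2) by simp_all
  then have ky: "j = 0" if "j \<in> keys y" for j
    using Max_ge[OF finite_keys that] Min_le[OF finite_keys that] by linarith
  have "lookup (y \<star> x) j = lookup y 0 * lookup x j" for j
    using mulV_unique_lookup[of y 0 x j] ky by (simp add: single_mulV wV_0_mulV)
  then have eq: "[:0, q powi (2 * j):] = lookup y 0" if "j \<in> keys x" for j
    using that unfolding assms(2)[symmetric] lookup_mulV_genA mult_cancel_right in_keys_iff by blast
  obtain j where j: "j \<in> keys x" using ne by blast
  have "i = j" if "i \<in> keys x" for i
  proof -
    have "[:0, q powi (2 * i):] = [:0, q powi (2 * j):]" unfolding eq[OF that] eq[OF j] ..
    then show ?thesis using q_powi_inj[of "2 * i" "2 * j"] by simp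
  qed
  then have "x = single j (lookup x j)"
    by (intro poly_mapping_eqI) (auto simp: lookup_single when_def in_keys_iff)
  then show ?thesis using that[of "lookup x j" j] j by (simp add: in_keys_iff)
qed

text \<open>Let \<open>x = f(A) w j\<close>. Normality tested on the letter that lengthens
  \<open>w j\<close> makes \<open>f\<close> a multiple of one of its own dilations, hence a
  monomial. If \<open>j \<noteq> 0\<close>, normality tested on the letter that shortens
  \<open>w j\<close> makes two dilations of \<open>a\<close> proportional, which would turn
  \<open>q\<close> into a root of unity.\<close>

lemma normal_element:
  assumes "x \<noteq> 0" "\<And>u. \<exists>y. x \<star> u = y \<star> x"
  obtains a i where "a \<noteq> 0" "x = single 0 (Polynomial.monom a i)"
proof -
  obtain j f where f: "f \<noteq> 0" and x: "x = single j f"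
    using normal_homogeneous[OF assms(1)] assms(2)[of genA] by blast
  obtain y where y: "x \<star> genB = y \<star> x" using assms(2) by blast
  obtain z where z: "x \<star> genS = z \<star> x" using assms(2) by blast
  \<comment> \<open>Since \<open>x\<close> is homogeneous of degree \<open>j\<close>, only the
    component of \<open>u\<close> in degree \<open>l\<close> contributes.\<close>
  have "lookup (u \<star> x) (l + j) = lookup u l * lookup (wV l \<star> x) (l + j)" for u l
    using mulV_unique_lookup[of u l x "l + j"] by (simp add: x lookup_single when_def) (simp add: single_mulV)
  from this[of y 1] this[of z "- 1"]
  have yx: "f * lookup (wV j \<star> genB) (j + 1) = lookup y 1 * lookup (opB x) (j + 1)"
    and zx: "f * lookup (wV j \<star> genS) (j - 1) = lookup z (- 1) * lookup (opS x) (j - 1)"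
    using wV_pos_mulV[of 0 x] wV_neg_mulV[of 0 x]
    by (simp_all flip: y z add: wV_0_mulV add.commute) (simp_all add: x single_mulV)
  have opx: "lookup (opB x) (j + 1) = (if j \<ge> 0 then 1 else dil (q^2) pa) * dil (q^2) f"
    "lookup (opS x) (j - 1) = (if j \<ge> 1 then pa else 1) * dil (1 / q^2) f"
    by (simp_all add: x lookup_opB lookup_opS)
  have root: "(q^2) ^ m \<noteq> 1" "(1 / q^2) ^ m \<noteq> 1" if "m > 0" for m
    using q_not_root[of "2 * m"] that q_nonzero by (simp_all add: power_mult power_one_over)
  obtain a i where a: "a \<noteq> 0" and fm: "f = Polynomial.monom a i"
  proof (cases "j \<ge> 0")
    case True
    then have "f = lookup y 1 * dil (q^2) f"
      using yx opx(1) wV_mulV_genB[of j] by (simp add: wV_def)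
    then show ?thesis using dil_selfsimilar_monom[of f _ "q^2"] f root(1) q_nonzero that by auto
  next
    case False
    then have "f = lookup z (- 1) * dil (1 / q^2) f"
      using zx opx(2) wV_mulV_genS[of j] by (simp add: wV_def)
    then show ?thesis using dil_selfsimilar_monom[of f _ "1 / q^2"] f root(2) q_nonzero that by auto
  qed
  have dil_f: "dil r f = Polynomial.smult (r ^ i) f" for r
    by (simp add: poly_eq_iff coeff_dil fm)
  have "j = 0"
  proof (rule ccontr)
    assume "j \<noteq> 0"
    then consider n where "j = int n + 1" | n where "j = - int n - 1"
      by (metis int_cases int_Suc diff_conv_add_uminus minus_add_distrib of_nat_0 old.nat.exhaust uminus_add_conv_diff add.commute)
    then show False
    proof cases
      case 1
      then have "f * dil ((q^2) ^ Suc n) pa = f * (Polynomial.smult ((1 / q^2) ^ i) (lookup z (- 1)) * pa)"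
        using zx opx(2) lookup_wV_mulV_genS[of n] by (simp add: dil_f algebra_simps)
      then have "dil ((q^2) ^ Suc n) pa = Polynomial.smult ((1 / q^2) ^ i) (lookup z (- 1)) * dil 1 pa"
        using f unfolding mult_cancel_left dil_1 by blast
      then have "((q^2) ^ Suc n)^2 = 1^2"
        by (rule pa_dil_proportional) (use q_nonzero cd_nonzero in auto)
      then have "q ^ (2 * Suc n * 2) = 1" by (simp only: power_mult one_power2)
      moreover have "q ^ (2 * Suc n * 2) \<noteq> 1" by (rule q_not_root) simp
      ultimately show False by blast
    next
      case 2
      then have "f * dil ((1 / q^2) ^ n) pa = f * (Polynomial.smult ((q^2) ^ i) (lookup y 1) * dil (q^2) pa)"
      proof -
        have j1: "j + 1 = - int n" and neg: "\<not> 0 \<le> j" using 2 by simp_all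
        have "f * dil ((1 / q^2) ^ n) pa = lookup y 1 * lookup (opB x) (j + 1)"
          using yx lookup_wV_mulV_genB[of n] unfolding j1 2 by simp
        then show ?thesis unfolding opx(1) using neg by (simp add: dil_f algebra_simps)
      qed
      then have "dil ((1 / q^2) ^ n) pa = Polynomial.smult ((q^2) ^ i) (lookup y 1) * dil (q^2) pa"
        using f unfolding mult_cancel_left by blast
      then have "((1 / q^2) ^ n)^2 = (q^2)^2"
        by (rule pa_dil_proportional) (use q_nonzero cd_nonzero in auto)
      then have "(q^2) ^ (n * 2) * (q^2)^2 = 1"
        using q_nonzero by (simp add: power_one_over field_simps power_mult)
      then have "q ^ (2 * (n * 2 + 2)) = 1" by (simp only: power_mult[of q 2] power_add)
      moreover have "q ^ (2 * (n * 2 + 2)) \<noteq> 1" by (rule q_not_root) simp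
      ultimately show False by blast
    qed
  qed
  then show ?thesis using that a x fm by blast
qed

lemma single_0_mulV: "single 0 p \<star> single 0 p' = single 0 (p * p')"
  by (simp add: single_mulV wV_0_mulV smul_simps)

text \<open>The image of \<open>A\<close> is normal, hence of the form \<open>a A^n\<close>, and the
  same for the inverse forces \<open>n = 1\<close>. Commutation with \<open>A\<close> puts the
  images of \<open>B\<close> and \<open>S\<close> in degrees 1 and -1, and the image of
  \<open>S B = a(A)\<close> leaves only constants as their coefficients.\<close>

theorem automorphism_diagonal:
  assumes add: "\<And>u v. \<sigma> (u + v) = \<sigma> u + \<sigma> v" and scale: "\<And>r u. \<sigma> (scaleV r u) = scaleV r (\<sigma> u)"
    and mult: "\<And>u v. \<sigma> (u \<star> v) = \<sigma> u \<star> \<sigma> v" and bij: "bij \<sigma>"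
  shows "\<exists>a. \<sigma> (single j (Polynomial.monom 1 i)) = scaleV a (single j (Polynomial.monom 1 i))"
proof -
  \<comment> \<open>The image of the unit is a unit for the whole image, which is everything by
    surjectivity.\<close>
  have one: "\<tau> oneV = oneV" if surj: "surj \<tau>" and mult: "\<And>u v. \<tau> (u \<star> v) = \<tau> u \<star> \<tau> v" for \<tau> :: "(int \<Rightarrow>\<^sub>0 'k poly) \<Rightarrow> int \<Rightarrow>\<^sub>0 'k poly"
  proof -
    obtain v where v: "oneV = \<tau> v" using surjD[OF surj, of oneV] by blast
    have "\<tau> oneV = \<tau> oneV \<star> oneV" by (simp only: mulV_algebra)
    also have "\<dots> = \<tau> oneV \<star> \<tau> v" by (simp only: v[symmetric])
    also have "\<dots> = \<tau> (oneV \<star> v)" by (simp only: mult)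
    also have "\<dots> = oneV" by (simp only: mulV_algebra v[symmetric])
    finally show ?thesis .
  qed
  have image_A: "\<exists>a n. a \<noteq> 0 \<and> (\<forall>b m. \<tau> (single 0 (Polynomial.monom b m)) = single 0 (Polynomial.monom (b * a ^ m) (n * m)))"
    if scale: "\<And>r u. \<tau> (scaleV r u) = scaleV r (\<tau> u)"
      and mult: "\<And>u v. \<tau> (u \<star> v) = \<tau> u \<star> \<tau> v" and bij: "bij \<tau>" for \<tau> :: "(int \<Rightarrow>\<^sub>0 'k poly) \<Rightarrow> int \<Rightarrow>\<^sub>0 'k poly"
  proof -
    have \<tau>0: "\<tau> 0 = 0" using scale[of 0 0] by (simp add: scaleV_simps)
    have "genA \<noteq> 0" using arg_cong[of genA 0 "\<lambda>u. lookup u 0"] by (auto simp: genA_eq)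
    then have "\<tau> genA \<noteq> \<tau> 0" using injD[OF bij_is_inj[OF bij]] by blast
    moreover have "\<exists>y. \<tau> genA \<star> u = y \<star> \<tau> genA" for u
    proof -
      obtain u' where "u = \<tau> u'" using surjD[OF bij_is_surj[OF bij], of u] by blast
      moreover obtain y where "genA \<star> u' = y \<star> genA" using genA_normal by blast
      ultimately have "\<tau> genA \<star> u = \<tau> y \<star> \<tau> genA" using mult[of genA u'] mult[of y genA] by simp
      then show ?thesis by blast
    qed
    ultimately obtain a n where a: "a \<noteq> 0" "\<tau> genA = single 0 (Polynomial.monom a n)"
      using normal_element[of "\<tau> genA"] unfolding \<tau>0 by blast
    have "\<tau> (single 0 (Polynomial.monom b m)) = single 0 (Polynomial.monom (b * a ^ m) (n * m))" for b m
    proof (induction m)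
      case 0
      have "single 0 (Polynomial.monom b 0) = scaleV b oneV"
        by (intro poly_mapping_eqI) (simp add: oneV_def wV_def lookup_single when_def monom_0 lookup_one)
      then show ?case using one[OF bij_is_surj[OF bij] mult] scale by (simp add: monom_0)
    next
      case (Suc m)
      have "single 0 (Polynomial.monom b (Suc m)) = genA \<star> single 0 (Polynomial.monom b m)"
        unfolding genA_eq single_0_mulV by (simp add: monom_Suc)
      then show ?case
        using Suc by (simp add: mult a(2) single_0_mulV mult_monom algebra_simps)
    qed
    then show ?thesis using a(1) by blast
  qed
  obtain a n where a: "a \<noteq> 0" "\<And>b m. \<sigma> (single 0 (Polynomial.monom b m)) = single 0 (Polynomial.monom (b * a ^ m) (n * m))"
    using image_A[OF scale mult bij] by blast
  define \<tau> where "\<tau> = inv_into UNIV \<sigma>"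
  have \<tau>\<sigma>: "\<tau> (\<sigma> u) = u" and \<sigma>\<tau>: "\<sigma> (\<tau> u) = u" for u
    using bij by (simp_all add: \<tau>_def bij_is_inj bij_is_surj surj_f_inv_f)
  have "\<tau> (scaleV r u) = scaleV r (\<tau> u)" "\<tau> (u \<star> v) = \<tau> u \<star> \<tau> v" for r u v
    using scale[of r "\<tau> u"] mult[of "\<tau> u" "\<tau> v"] \<tau>\<sigma> \<sigma>\<tau> by metis+
  moreover have "bij \<tau>" using bij by (simp add: \<tau>_def bij_imp_bij_inv)
  ultimately obtain a' n' where "\<And>b m. \<tau> (single 0 (Polynomial.monom b m)) = single 0 (Polynomial.monom (b * a' ^ m) (n' * m))"
    using image_A by blast
  then have "single 0 (Polynomial.monom (a' * a ^ n') (n * n')) = single (0::int) (Polynomial.monom 1 1)"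
    using \<sigma>\<tau>[of "single 0 (Polynomial.monom 1 1)"] a(2) by simp
  then have "Polynomial.monom (a' * a ^ n') (n * n') = Polynomial.monom 1 1"
    by (metis lookup_single_eq)
  then have "n * n' = 1" by (metis degree_monom_eq monom_eq_0_iff one_neq_zero)
  then have n: "n = 1" by simp
  have \<sigma>A: "\<sigma> genA = scaleV a genA"
    using a(2)[of 1 1] by (simp add: n genA_eq scaleV_def smul_simps monom_altdef)
  have \<sigma>_opA: "\<sigma> (opA u) = scaleV a (opA (\<sigma> u))" for u
    using mult[of genA u] by (simp add: mulV_gen \<sigma>A mulV_algebra)
  have keys_single: "u = single l (lookup u l)"
    if "\<And>i. lookup u i \<noteq> 0 \<Longrightarrow> i = l" for u :: "int \<Rightarrow>\<^sub>0 'k poly" and l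
    using that by (intro poly_mapping_eqI) (auto simp: lookup_single when_def)
  have scale_cancel: "u = v" if "scaleV a u = scaleV a v" for u v
  proof -
    have "scaleV (1 / a) (scaleV a u) = scaleV (1 / a) (scaleV a v)" using that by simp
    then show ?thesis using a(1) by (simp add: scaleV_simps)
  qed
  have "\<sigma> genB \<star> \<sigma> genA = scaleV (q^2) (\<sigma> genA \<star> \<sigma> genB)"
    using mult[of genB genA] mult[of genA genB] scale by (simp add: mulV_gen opB_opA)
  then have YA: "\<sigma> genB \<star> genA = scaleV (q^2) (opA (\<sigma> genB))"
  proof -
    assume "\<sigma> genB \<star> \<sigma> genA = scaleV (q^2) (\<sigma> genA \<star> \<sigma> genB)"
    then have "scaleV a (\<sigma> genB \<star> genA) = scaleV a (scaleV (q^2) (opA (\<sigma> genB)))"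
      by (simp add: \<sigma>A mulV_algebra mulV_gen scaleV_simps mult.commute)
    then show ?thesis using scale_cancel by blast
  qed
  have "i = 1" if "lookup (\<sigma> genB) i \<noteq> 0" for i
  proof -
    have "[:0, q powi (2 * i):] * lookup (\<sigma> genB) i = [:0, q powi 2:] * lookup (\<sigma> genB) i"
      using lookup_mulV_genA[of "\<sigma> genB" i] YA by simp
    then have "[:0, q powi (2 * i):] = [:0, q powi 2:]"
      using that unfolding mult_cancel_right by blast
    then show ?thesis using q_powi_inj[of "2 * i" 2] by simp
  qed
  then obtain p where p: "\<sigma> genB = single 1 p" using keys_single by blast
  have "\<sigma> genA \<star> \<sigma> genS = scaleV (q^2) (\<sigma> genS \<star> \<sigma> genA)"
    using mult[of genA genS] mult[of genS genA] scale by (simp add: mulV_gen opA_opS)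
  then have AZ: "opA (\<sigma> genS) = scaleV (q^2) (\<sigma> genS \<star> genA)"
  proof -
    assume "\<sigma> genA \<star> \<sigma> genS = scaleV (q^2) (\<sigma> genS \<star> \<sigma> genA)"
    then have "scaleV a (opA (\<sigma> genS)) = scaleV a (scaleV (q^2) (\<sigma> genS \<star> genA))"
      by (simp add: \<sigma>A mulV_algebra mulV_gen scaleV_simps mult.commute)
    then show ?thesis using scale_cancel by blast
  qed
  have "i = - 1" if "lookup (\<sigma> genS) i \<noteq> 0" for i
  proof -
    have "[:0, q powi (2 * i + 2):] * lookup (\<sigma> genS) i = [:0, q powi 0:] * lookup (\<sigma> genS) i"
      using arg_cong[OF AZ, of "\<lambda>u. lookup u i"] q_nonzero
      by (simp add: lookup_mulV_genA power_int_add mult.commute)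
    then have "[:0, q powi (2 * i + 2):] = [:0, q powi 0:]"
      using that unfolding mult_cancel_right by blast
    then have "q powi (2 * i + 2) = q powi 0" by simp
    then show ?thesis using q_powi_inj[of "2 * i + 2" 0] by simp
  qed
  then obtain r where r: "\<sigma> genS = single (- 1) r" using keys_single by blast
  have \<sigma>1: "\<sigma> oneV = oneV" using one bij mult bij_is_surj by blast
  have "\<sigma> genS \<star> \<sigma> genB = \<sigma> (opS (opB oneV))" using mult[of genS genB] by (simp add: mulV_gen)
  also have "\<dots> = scaleV (c * d) oneV + scaleV (c - d) (scaleV a genA) - scaleV a (opA (scaleV a genA))"
  proof -
    have "\<sigma> (u - v) = \<sigma> u - \<sigma> v" for u v using add[of "u - v" v] by simp
    then show ?thesis unfolding opS_opB by (simp add: add scale \<sigma>1 \<sigma>A \<sigma>_opA)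
  qed
  finally have "lookup (\<sigma> genS \<star> \<sigma> genB) 0 = dil a pa"
    by (simp add: lookup_add lookup_minus pa_def dil_pCons) (simp add: oneV_def wV_def lookup_one one_pCons)
  moreover have "lookup (\<sigma> genS \<star> \<sigma> genB) 0 = r * (pa * dil (1 / q^2) p)"
    using wV_neg_mulV[of 0 "\<sigma> genB"] unfolding r single_mulV
    by (simp add: wV_0_mulV lookup_opS) (simp add: p)
  ultimately have eq: "dil a pa = (r * dil (1 / q^2) p) * pa" by (simp add: algebra_simps)
  have deg: "Polynomial.degree (dil s f) = Polynomial.degree f" if "s \<noteq> 0" for s f
    using that by (simp add: dil_def degree_pcompose)
  have nz: "r \<noteq> 0" "dil (1 / q^2) p \<noteq> 0"
    using eq a(1) pa_nonzero by (auto simp: dil_eq_0_iff)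
  \<comment> \<open>Dilation by a nonzero factor keeps the degree, so \<open>dil a pa\<close> and
    \<open>pa\<close> have equal degrees and the other two factors are constants.\<close>
  have "Polynomial.degree (dil a pa) = Polynomial.degree r + Polynomial.degree (dil (1 / q^2) p) + Polynomial.degree pa"
    unfolding eq using nz pa_nonzero by (simp add: degree_mult_eq)
  then have "Polynomial.degree r = 0" "Polynomial.degree p = 0"
    using deg a(1) q_nonzero by simp_all
  then obtain r0 p0 where rp: "r = [:r0:]" "p = [:p0:]" by (metis degree_eq_zeroE)
  have \<sigma>_opB: "\<sigma> (opB u) = scaleV p0 (opB (\<sigma> u))" and \<sigma>_opS: "\<sigma> (opS u) = scaleV r0 (opS (\<sigma> u))" for u
  proof -
    have "\<sigma> genB = scaleV p0 genB" "\<sigma> genS = scaleV r0 genS"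
      unfolding p r rp by (simp_all add: genB_eq genS_eq scaleV_def wV_def smul_simps)
    then show "\<sigma> (opB u) = scaleV p0 (opB (\<sigma> u))" "\<sigma> (opS u) = scaleV r0 (opS (\<sigma> u))"
      using mult[of genB u] mult[of genS u] by (simp_all add: mulV_gen mulV_algebra)
  qed
  have w: "\<exists>b. \<sigma> (wV j) = scaleV b (wV j)"
  proof (induction j rule: int_induct[where k = 0])
    case base
    then show ?case using \<sigma>1 scaleV_simps(4) by (metis oneV_def)
  next
    case (step1 j)
    then obtain b where "\<sigma> (wV j) = scaleV b (wV j)" by blast
    then have "\<sigma> (wV (j + 1)) = scaleV (p0 * b) (wV (j + 1))"
      using \<sigma>_opB[of "wV j"] step1(1) by (simp add: opB_wV lin_scale[OF lin_opB] scaleV_simps)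
    then show ?case by blast
  next
    case (step2 j)
    then obtain b where "\<sigma> (wV j) = scaleV b (wV j)" by blast
    then have "\<sigma> (wV (j - 1)) = scaleV (r0 * b) (wV (j - 1))"
      using \<sigma>_opS[of "wV j"] step2(1) by (simp add: opS_wV lin_scale[OF lin_opS] scaleV_simps)
    then show ?case by blast
  qed
  show ?thesis
  proof (induction i)
    case 0
    have "single j (Polynomial.monom 1 0) = (wV j :: int \<Rightarrow>\<^sub>0 'k poly)" by (simp add: wV_def monom_0 one_pCons)
    then show ?case using w by simp
  next
    case (Suc i)
    then obtain b where b: "\<sigma> (single j (Polynomial.monom 1 i)) = scaleV b (single j (Polynomial.monom 1 i))"
      by blast
    have "single j (Polynomial.monom 1 (Suc i)) = opA (single j (Polynomial.monom (1 :: 'k) i))"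
      by (simp add: opA_def smul_simps monom_Suc)
    then have "\<sigma> (single j (Polynomial.monom 1 (Suc i))) = scaleV (a * b) (single j (Polynomial.monom 1 (Suc i)))"
      using \<sigma>_opA b by (simp add: lin_scale[OF lin_opA] scaleV_simps)
    then show ?case by blast
  qed
qed

end

section \<open>Duality between chains and cochains\<close>

text \<open>The pairing of the free vector space with its dual: a functional is the same as an
  arbitrary function on the basis.\<close>

definition ev :: "('b \<Rightarrow> 'k::field) \<Rightarrow> ('b \<Rightarrow>\<^sub>0 'k) \<Rightarrow> 'k" where
  "ev f x = (\<Sum>t\<in>keys x. lookup x t * f t)"

lemma ev_superset:
  assumes "finite J" "keys x \<subseteq> J"
  shows "ev f x = (\<Sum>t\<in>J. lookup x t * f t)"
  unfolding ev_def using assms by (intro sum.mono_neutral_left) (auto simp: in_keys_iff)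

lemma ev_add: "ev f (x + y) = ev f x + ev f y"
proof -
  have J: "ev f z = (\<Sum>t\<in>keys x \<union> keys y. lookup z t * f t)"
    if "keys z \<subseteq> keys x \<union> keys y" for z
    using that by (intro ev_superset) auto
  show ?thesis
    unfolding J[OF keys_add] J[OF Un_upper1] J[OF Un_upper2]
    by (simp add: lookup_add sum.distrib distrib_right)
qed

lemma ev_single [simp]: "ev f (single t r) = r * f t"
  using ev_superset[of "{t}" "single t r" f] by simp

lemma ev_0 [simp]: "ev f 0 = 0"
  by (simp add: ev_def)

lemma ev_smul: "ev f (smul r x) = r * ev f x"
  using ev_superset[of "keys x" "smul r x" f]
  by (simp add: ev_def sum_distrib_left mult.assoc subset_iff in_keys_iff)

lemma ev_diff: "ev f (x - y) = ev f x - ev f y"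
  using ev_add[of f "x - y" y] by simp

lemma ev_sum: "ev f (sum g I) = (\<Sum>i\<in>I. ev f (g i))"
  by (induction I rule: infinite_finite_induct) (simp_all add: ev_add)

lemma ev_cong: "(\<And>t. t \<in> keys x \<Longrightarrow> f t = g t) \<Longrightarrow> ev f x = ev g x"
  by (simp add: ev_def)

lemma ev_lin_ext: "ev f (lin_ext g x) = ev (\<lambda>t. ev f (g t)) x"
  by (simp add: lin_ext_def ev_sum ev_def[of _ x] flip: smul_def) (simp add: ev_smul)

lemma lin_ext_superset:
  assumes "finite J" "keys x \<subseteq> J"
  shows "lin_ext g x = (\<Sum>t\<in>J. smul (lookup x t) (g t))"
  unfolding lin_ext_def smul_def[symmetric] using assms
  by (intro sum.mono_neutral_left) (auto simp: in_keys_iff smul_simps)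

lemma lin_ext_add: "lin_ext g (x + y) = lin_ext g x + lin_ext g y"
proof -
  have J: "lin_ext g z = (\<Sum>t\<in>keys x \<union> keys y. smul (lookup z t) (g t))"
    if "keys z \<subseteq> keys x \<union> keys y" for z
    using that by (intro lin_ext_superset) auto
  show ?thesis
    unfolding J[OF keys_add] J[OF Un_upper1] J[OF Un_upper2]
    by (simp add: lookup_add sum.distrib smul_simps)
qed

lemma lin_ext_single: "lin_ext g (single t r) = smul r (g t)"
  using lin_ext_superset[of "{t}" "single t r" g] by simp

lemma lin_ext_0 [simp]: "lin_ext g 0 = 0"
  by (simp add: lin_ext_def)

lemma lin_ext_smul: "lin_ext g (smul r x) = smul r (lin_ext g x)"
  by (induction x rule: poly_mapping_induct) (simp_all add: lin_ext_add smul_simps lin_ext_single)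

lemma lin_ext_diff: "lin_ext g (x - y) = lin_ext g x - lin_ext g y"
  using lin_ext_add[of g "x - y" y] by simp

lemma lin_ext_keys:
  assumes "\<And>t. t \<in> keys x \<Longrightarrow> keys (g t) \<subseteq> K"
  shows "keys (lin_ext g x) \<subseteq> K"
proof -
  have "keys (\<Sum>t\<in>J. smul (r t) (g t)) \<subseteq> K" if "J \<subseteq> keys x" for J r
  proof -
    have "finite J" using finite_subset[OF that finite_keys] .
    then show ?thesis using that
    proof induction
      case (insert t J)
      have "keys (smul (r t) (g t)) \<subseteq> keys (g t)"
        by (auto simp: in_keys_iff)
      then show ?case
        using insert assms[of t] keys_add[of "smul (r t) (g t)" "\<Sum>t\<in>J. smul (r t) (g t)"] by auto
    qed simp
  qed
  from this[OF order.refl] show ?thesis by (subst lin_ext_superset[OF finite_keys order.refl])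
qed

text \<open>Adjoining \<open>z\<close> to a basis of \<open>U\<close> keeps it independent, so some
  linear functional is 0 on \<open>U\<close> and 1 at \<open>z\<close>; its values at the unit
  vectors give \<open>f\<close>.\<close>

lemma separating_functional:
  fixes U :: "('b \<Rightarrow>\<^sub>0 'k::field) set"
  assumes "0 \<in> U" "\<And>x y. x \<in> U \<Longrightarrow> y \<in> U \<Longrightarrow> x + y \<in> U" "\<And>r x. x \<in> U \<Longrightarrow> smul r x \<in> U" "z \<notin> U"
  shows "\<exists>f. (\<forall>x\<in>U. ev f x = 0) \<and> ev f z = 1"
proof -
  interpret V: vector_space "smul :: 'k \<Rightarrow> ('b \<Rightarrow>\<^sub>0 'k) \<Rightarrow> _"
    by unfold_locales (simp_all add: smul_simps)
  interpret K: vector_space "(*) :: 'k \<Rightarrow> 'k \<Rightarrow> 'k"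
    by unfold_locales (simp_all add: algebra_simps)
  interpret P: vector_space_pair "smul :: 'k \<Rightarrow> ('b \<Rightarrow>\<^sub>0 'k) \<Rightarrow> _" "(*) :: 'k \<Rightarrow> 'k \<Rightarrow> 'k" ..
  have sub: "V.subspace U" using assms(1-3) by (simp add: V.subspace_def)
  obtain I where I: "I \<subseteq> U" "V.independent I" "U \<subseteq> V.span I"
    using V.maximal_independent_subset[of U] by blast
  have "V.span I = U" using I V.span_minimal[OF I(1) sub] by blast
  then have "V.independent (insert z I)"
    using I(2) assms(4) V.independent_insertI by blast
  from P.linear_independent_extend[OF this, of "\<lambda>b. if b = z then 1 else 0"] obtain h where
    h: "Vector_Spaces.linear smul (*) h" "\<And>b. b \<in> insert z I \<Longrightarrow> h b = (if b = z then 1 else 0)" by blast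
  interpret h: Vector_Spaces.linear smul "(*)" h by (rule h(1))
  have "z \<notin> I" using I(1) assms(4) by blast
  then have "h b = 0" if "b \<in> I" for b using h(2)[of b] that by auto
  then have "h x = 0" if "x \<in> U" for x
    using P.linear_eq_0_on_span[OF h(1), of I x] that \<open>V.span I = U\<close> by blast
  moreover have "ev (\<lambda>t. h (single t 1)) x = h x" for x
  proof (induction x rule: poly_mapping_induct)
    case (2 t r)
    have "h (single t r) = r * h (single t 1)"
      using h.scale[of r "single t 1"] by (simp add: smul_simps)
    then show ?case by simp
  qed (simp add: ev_add h.add)
  ultimately show ?thesis using h(2)[of z] by (intro exI[of _ "\<lambda>t. h (single t 1)"]) simp
qed

context twisted_algebra
begin

text \<open>Unrolls the recursion into an alternating sum over faces, the form in which the boundary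
  of chains is given.\<close>

lemma inner_diff_sum:
  assumes "length l = Suc n"
  shows "inner_diff f a l = (\<Sum>j<n. (- 1) ^ j * f a (take j l @ [l ! j \<star> l ! Suc j] @ drop (j + 2) l))
    + (- 1) ^ n * f (\<sigma> (l ! n) \<star> a) (take n l)"
  using assms
proof (induction n arbitrary: l f)
  case 0
  then obtain b where "l = [b]" by (cases l) auto
  then show ?case by simp
next
  case (Suc n)
  then obtain b c l' where l: "l = b # c # l'" by (cases l; cases "tl l") auto
  show ?case
    using Suc.IH[of "c # l'" "\<lambda>a l. f a (b # l)"] Suc.prems
    unfolding l by (simp add: sum.lessThan_Suc_shift sum_negf del: sum.lessThan_Suc)
qed

lemma codiff_sum:
  assumes "length l = Suc n"
  shows "codiff f a l = (\<Sum>j\<le>n. (- 1) ^ j *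
      (let us = take j (a # l) @ [(a # l) ! j \<star> (a # l) ! Suc j] @ drop (j + 2) (a # l) in f (hd us) (tl us)))
    + (- 1) ^ Suc n * f (\<sigma> (l ! n) \<star> a) (take n l)"
proof -
  obtain b l' where l: "l = b # l'" using assms by (cases l) auto
  show ?thesis
    unfolding l codiff.simps inner_diff_sum[OF assms[unfolded l]]
    by (simp add: sum.atMost_shift sum_negf)
qed

end

text \<open>Separates computations in \<open>'v\<close> from the algebra \<open>R\<close>, whose
  elements will be cosets. All tuples over \<open>R\<close> are written through the isomorphism
  \<open>\<kappa>\<close>.\<close>

locale algebra_model = twisted_algebra sc mul one \<sigma>V
  for sc :: "'k::field \<Rightarrow> 'v::ab_group_add \<Rightarrow> 'v" and mul (infixl "\<star>" 70) and one \<sigma>V +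
  fixes R :: "('k, 'a) module" and \<kappa> :: "'v \<Rightarrow> 'a" and \<sigma> :: "'a \<Rightarrow> 'a"
  assumes \<kappa>_bij: "bij_betw \<kappa> UNIV (carrier R)"
    and \<kappa>_add: "\<kappa> (u + v) = \<kappa> u \<oplus>\<^bsub>R\<^esub> \<kappa> v"
    and \<kappa>_scale: "\<kappa> (sc r u) = r \<odot>\<^bsub>R\<^esub> \<kappa> u"
    and \<kappa>_mult: "\<kappa> (u \<star> v) = \<kappa> u \<otimes>\<^bsub>R\<^esub> \<kappa> v"
    and \<kappa>_twist: "\<kappa> (\<sigma>V u) = \<sigma> (\<kappa> u)"
begin

definition multilinear :: "nat \<Rightarrow> ('a list \<Rightarrow> 'k) \<Rightarrow> bool" where
  "multilinear m f \<longleftrightarrow> (\<forall>us vs. length us + length vs + 1 = m \<longrightarrow> klin (\<lambda>x. f (map \<kappa> (us @ x # vs))))"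

abbreviation "tuples m \<equiv> carrier (tuple_space R m)"
abbreviation "mrel m \<equiv> multilinear_relations R m"

lemma tuples_def: "tuples m = {x. keys x \<subseteq> {as. length as = m \<and> set as \<subseteq> carrier R}}"
  by (simp add: tuple_space_def)

lemma carrier_\<kappa>: "carrier R = range \<kappa>"
  using \<kappa>_bij by (simp add: bij_betw_def)

lemma tuple_eq_map:
  assumes "set as \<subseteq> carrier R"
  shows "\<exists>us. as = map \<kappa> us"
  using assms
proof (induction as)
  case (Cons x as)
  then obtain us u where "as = map \<kappa> us" "x = \<kappa> u" by (auto simp: carrier_\<kappa>)
  then have "x # as = map \<kappa> (u # us)" by simp
  then show ?case by (rule exI)
qed simp

lemma tuples_group: "comm_group (tuple_space R m)"
proof (rule comm_groupI)
  fix x y assume "x \<in> tuples m" "y \<in> tuples m"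
  then show "x \<otimes>\<^bsub>tuple_space R m\<^esub> y \<in> tuples m"
    using order.trans[OF keys_add Un_least, of x _ y] by (simp add: tuple_space_def)
next
  fix x assume "x \<in> tuples m"
  then have "- x \<in> tuples m" "- x \<otimes>\<^bsub>tuple_space R m\<^esub> x = \<one>\<^bsub>tuple_space R m\<^esub>"
    by (auto simp: tuple_space_def)
  then show "\<exists>y\<in>tuples m. y \<otimes>\<^bsub>tuple_space R m\<^esub> x = \<one>\<^bsub>tuple_space R m\<^esub>" by blast
qed (auto simp: tuple_space_def add_ac)

lemma tuple_space_simps [simp]:
  "x \<otimes>\<^bsub>tuple_space R m\<^esub> y = x + y" "\<one>\<^bsub>tuple_space R m\<^esub> = 0"
  by (simp_all add: tuple_space_def)

lemma tuple_space_inv: "x \<in> tuples m \<Longrightarrow> inv\<^bsub>tuple_space R m\<^esub> x = - x"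
  using group.inv_equality[OF comm_group.axioms(2)[OF tuples_group], of m "- x" x]
  by (auto simp: tuples_def)

lemma tuples_closed:
  "x \<in> tuples m \<Longrightarrow> y \<in> tuples m \<Longrightarrow> x + y \<in> tuples m" "x \<in> tuples m \<Longrightarrow> y \<in> tuples m \<Longrightarrow> x - y \<in> tuples m"
  "x \<in> tuples m \<Longrightarrow> smul r x \<in> tuples m" "0 \<in> tuples m"
proof -
  show "x \<in> tuples m \<Longrightarrow> y \<in> tuples m \<Longrightarrow> x + y \<in> tuples m"
    unfolding tuples_def mem_Collect_eq by (rule order.trans[OF keys_add Un_least])
  show "x \<in> tuples m \<Longrightarrow> y \<in> tuples m \<Longrightarrow> x - y \<in> tuples m"
    unfolding tuples_def mem_Collect_eq by (rule order.trans[OF keys_diff Un_least])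
  have "keys (smul r x) \<subseteq> keys x"
    by (auto simp: in_keys_iff)
  then show "x \<in> tuples m \<Longrightarrow> smul r x \<in> tuples m"
    unfolding tuples_def mem_Collect_eq by (rule order.trans)
qed (simp add: tuples_def)

lemma tuples_single: "length us = m \<Longrightarrow> single (map \<kappa> us) s \<in> tuples m"
  by (auto simp: tuples_def carrier_\<kappa>)

text \<open>The generators of \<open>multilinear_relations\<close>, pulled back along
  \<open>\<kappa>\<close>, with the varying entry singled out by a prefix and a suffix as in
  \<open>cochain\<close> instead of by a list update.\<close>

inductive_set mgen :: "nat \<Rightarrow> ('a list \<Rightarrow>\<^sub>0 'k) set" for m where
  add: "length us + length vs + 1 = m \<Longrightarrow> single (map \<kappa> (us @ (u + v) # vs)) s
    - single (map \<kappa> (us @ u # vs)) s - single (map \<kappa> (us @ v # vs)) s \<in> mgen m"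
| scale: "length us + length vs + 1 = m \<Longrightarrow> single (map \<kappa> (us @ sc r u # vs)) s
    - single (map \<kappa> (us @ u # vs)) (s * r) \<in> mgen m"

lemma mrel_eq: "mrel m = generate (tuple_space R m) (mgen m)"
proof -
  have upd: "(map \<kappa> us)[i := \<kappa> x] = map \<kappa> (take i us @ x # drop (Suc i) us)" if "i < length us" for us i x
    using that by (simp add: upd_conv_take_nth_drop take_map drop_map)
  have "mgen m = {single (as[i := x \<oplus>\<^bsub>R\<^esub> y]) s
         - single (as[i := x]) s - single (as[i := y]) s | as i x y s.
         length as = m \<and> set as \<subseteq> carrier R \<and> i < m \<and> x \<in> carrier R \<and> y \<in> carrier R} \<union>
      {single (as[i := r \<odot>\<^bsub>R\<^esub> x]) s - single (as[i := x]) (s * r) | as i x r s.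
         length as = m \<and> set as \<subseteq> carrier R \<and> i < m \<and> x \<in> carrier R}" (is "_ = ?G1 \<union> ?G2")
  proof (intro equalityI subsetI)
    fix g assume "g \<in> mgen m"
    then show "g \<in> ?G1 \<union> ?G2"
    proof cases
      case (add us vs u v s)
      have "(map \<kappa> (us @ u # vs))[length us := \<kappa> x] = map \<kappa> (us @ x # vs)" for x
        by (subst upd) auto
      then have "g = single ((map \<kappa> (us @ u # vs))[length us := \<kappa> u \<oplus>\<^bsub>R\<^esub> \<kappa> v]) s
         - single ((map \<kappa> (us @ u # vs))[length us := \<kappa> u]) s
         - single ((map \<kappa> (us @ u # vs))[length us := \<kappa> v]) s"
        unfolding add(1) \<kappa>_add[symmetric] by simp
      moreover have "length (map \<kappa> (us @ u # vs)) = m" "set (map \<kappa> (us @ u # vs)) \<subseteq> carrier R" "length us < m"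
        "\<kappa> u \<in> carrier R" "\<kappa> v \<in> carrier R" using add(2) by (auto simp: carrier_\<kappa>)
      ultimately show ?thesis by blast
    next
      case (scale us vs r u s)
      have "(map \<kappa> (us @ u # vs))[length us := \<kappa> x] = map \<kappa> (us @ x # vs)" for x
        by (subst upd) auto
      then have "g = single ((map \<kappa> (us @ u # vs))[length us := r \<odot>\<^bsub>R\<^esub> \<kappa> u]) s
         - single ((map \<kappa> (us @ u # vs))[length us := \<kappa> u]) (s * r)"
        unfolding scale(1) \<kappa>_scale[symmetric] by simp
      moreover have "length (map \<kappa> (us @ u # vs)) = m" "set (map \<kappa> (us @ u # vs)) \<subseteq> carrier R" "length us < m"
        "\<kappa> u \<in> carrier R" using scale(2) by (auto simp: carrier_\<kappa>)
      ultimately show ?thesis by blast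
    qed
  next
    fix g assume "g \<in> ?G1 \<union> ?G2"
    then show "g \<in> mgen m"
    proof
      assume "g \<in> ?G1"
      then obtain as i x y s where g: "g = single (as[i := x \<oplus>\<^bsub>R\<^esub> y]) s
         - single (as[i := x]) s - single (as[i := y]) s"
         "length as = m" "set as \<subseteq> carrier R" "i < m" "x \<in> carrier R" "y \<in> carrier R" by blast
      moreover obtain us u v where us: "as = map \<kappa> us" "x = \<kappa> u" "y = \<kappa> v"
        using tuple_eq_map[OF g(3)] g(5,6) unfolding carrier_\<kappa> by blast
      ultimately show ?thesis
        using mgen.add[of "take i us" "drop (Suc i) us" m u v s]
        unfolding us \<kappa>_add[symmetric] by (auto simp: upd simp del: map_append list.map)
    next
      assume "g \<in> ?G2"
      then obtain as i x r s where g: "g = single (as[i := r \<odot>\<^bsub>R\<^esub> x]) s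
         - single (as[i := x]) (s * r)"
         "length as = m" "set as \<subseteq> carrier R" "i < m" "x \<in> carrier R" by blast
      moreover obtain us u where us: "as = map \<kappa> us" "x = \<kappa> u"
        using tuple_eq_map[OF g(3)] g(5) unfolding carrier_\<kappa> by blast
      ultimately show ?thesis
        using mgen.scale[of "take i us" "drop (Suc i) us" m r u s]
        unfolding us \<kappa>_scale[symmetric] by (auto simp: upd simp del: map_append list.map)
    qed
  qed
  then show ?thesis by (simp add: multilinear_relations_def)
qed

lemma mgen_tuples: "mgen m \<subseteq> tuples m"
proof
  fix g assume "g \<in> mgen m"
  then show "g \<in> tuples m"
    by cases (auto intro!: tuples_closed(2) tuples_single simp del: map_append list.map)
qed

lemma mrel_subgroup: "subgroup (mrel m) (tuple_space R m)"
  unfolding mrel_eq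
  by (rule group.generate_is_subgroup[OF comm_group.axioms(2)[OF tuples_group] mgen_tuples])

lemma mrel_tuples: "x \<in> mrel m \<Longrightarrow> x \<in> tuples m"
  using subgroup.subset[OF mrel_subgroup] by blast

lemma mrel_closed:
  "x \<in> mrel m \<Longrightarrow> y \<in> mrel m \<Longrightarrow> x + y \<in> mrel m" "0 \<in> mrel m" "x \<in> mrel m \<Longrightarrow> - x \<in> mrel m"
  using subgroup.m_closed[OF mrel_subgroup, of x m y] subgroup.one_closed[OF mrel_subgroup, of m]
    subgroup.m_inv_closed[OF mrel_subgroup, of x m] tuple_space_inv[OF mrel_tuples, of x m]
  by auto

lemma mrel_diff: "x \<in> mrel m \<Longrightarrow> y \<in> mrel m \<Longrightarrow> x - y \<in> mrel m"
  using mrel_closed(1)[of x m "- y"] mrel_closed(3) by simp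

lemma mgen_smul: "g \<in> mgen m \<Longrightarrow> smul r g \<in> mgen m"
proof (induction rule: mgen.induct)
  case (add us vs u v s)
  from mgen.add[OF this, of u v "r * s"] show ?case by (simp add: smul_simps)
next
  case (scale us vs r' u s)
  from mgen.scale[OF this, of r' u "r * s"] show ?case by (simp add: smul_simps mult.assoc)
qed

lemma mrel_smul: "x \<in> mrel m \<Longrightarrow> smul r x \<in> mrel m"
  unfolding mrel_eq
proof (induction rule: generate.induct)
  case one
  show ?case
    using generate.one[of "tuple_space R m" "mgen m"] unfolding tuple_space_simps smul_simps(6) .
next
  case (incl h)
  then show ?case by (intro generate.incl mgen_smul)
next
  case (inv h)
  have "inv\<^bsub>tuple_space R m\<^esub> (smul r h) = smul r (inv\<^bsub>tuple_space R m\<^esub> h)"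
    using subsetD[OF mgen_tuples inv] tuples_closed(3)[of h m r] by (simp add: tuple_space_inv smul_simps)
  then show ?case using generate.inv[OF mgen_smul[OF inv], of "tuple_space R m" r] by (simp only:)
next
  case (eng h1 h2)
  show ?case using generate.eng[OF eng.IH] unfolding tuple_space_simps smul_simps(1) .
qed

lemma multilinear_mrel:
  assumes "multilinear m f" "x \<in> mrel m"
  shows "ev f x = 0"
proof -
  have gen: "ev f g = 0" if "g \<in> mgen m" for g
    using that
  proof cases
    case (add us vs u v s)
    then have "klin (\<lambda>x. f (map \<kappa> (us @ x # vs)))" using assms(1) by (auto simp: multilinear_def)
    from lin_add[OF this, of u v] show ?thesis unfolding add(1) by (simp add: ev_diff distrib_left)
  next
    case (scale us vs r u s)
    then have "klin (\<lambda>x. f (map \<kappa> (us @ x # vs)))" using assms(1) by (auto simp: multilinear_def)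
    from lin_scale[OF this, of r u] show ?thesis unfolding scale(1) by (simp add: ev_diff algebra_simps)
  qed
  show ?thesis using assms(2) unfolding mrel_eq
  proof (induction rule: generate.induct)
    case (inv h)
    have "ev f (- h) = - ev f h" using ev_diff[of f 0 h] by simp
    then show ?case using inv gen mgen_tuples by (simp add: tuple_space_inv subset_iff)
  qed (simp_all add: gen ev_add)
qed

lemma multilinearI:
  assumes "\<And>g. g \<in> mrel m \<Longrightarrow> ev f g = 0"
  shows "multilinear m f"
  unfolding multilinear_def
proof (intro allI impI linI)
  fix us vs :: "'v list" and u v assume l: "length us + length vs + 1 = m"
  have "ev f g = 0" if "g \<in> mgen m" for g using assms[unfolded mrel_eq, OF generate.incl[OF that]] .
  from this[OF mgen.add[OF l, of u v 1]]
  show "f (map \<kappa> (us @ (u + v) # vs)) = f (map \<kappa> (us @ u # vs)) + f (map \<kappa> (us @ v # vs))"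
    by (simp add: ev_diff ev_add diff_diff_eq)
next
  fix us vs :: "'v list" and r u assume l: "length us + length vs + 1 = m"
  have "ev f g = 0" if "g \<in> mgen m" for g using assms[unfolded mrel_eq, OF generate.incl[OF that]] .
  from this[OF mgen.scale[OF l, of r u 1]]
  show "f (map \<kappa> (us @ sc r u # vs)) = r * f (map \<kappa> (us @ u # vs))"
    by (simp add: ev_diff algebra_simps)
qed

text \<open>A functional that vanishes on the relations is multilinear, and functionals separate a
  subspace from outside points. So membership can be tested on multilinear forms, without touching
  generators.\<close>

lemma mrelI:
  assumes "\<And>f. multilinear m f \<Longrightarrow> ev f x = 0"
  shows "x \<in> mrel m"
proof (rule ccontr)
  assume "x \<notin> mrel m"
  then have "\<exists>f. (\<forall>y\<in>mrel m. ev f y = 0) \<and> ev f x = 1"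
    by (intro separating_functional mrel_closed mrel_smul)
  then obtain f where "\<And>y. y \<in> mrel m \<Longrightarrow> ev f y = 0" "ev f x = 1"
    by blast
  then show False using assms[OF multilinearI[of m f]] by simp
qed

end

section \<open>Boundary and twist on tuples\<close>

lemma lin_ext_cong: "(\<And>t. t \<in> keys x \<Longrightarrow> f t = g t) \<Longrightarrow> lin_ext f x = lin_ext g x"
  unfolding lin_ext_def by (intro sum.cong) simp_all

lemma lin_ext_lin_ext: "lin_ext h (lin_ext g x) = lin_ext (\<lambda>t. lin_ext h (g t)) x"
  by (induction x rule: poly_mapping_induct) (simp_all add: lin_ext_add lin_ext_single lin_ext_smul)

lemma lin_ext_sum: "lin_ext g (sum h I) = (\<Sum>i\<in>I. lin_ext g (h i))"
  by (induction I rule: infinite_finite_induct) (simp_all add: lin_ext_add)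

context twisted_algebra
begin

definition face :: "nat \<Rightarrow> 'v list \<Rightarrow> 'v list" where
  "face j us = take j us @ [us ! j \<star> us ! Suc j] @ drop (j + 2) us"

definition last_face :: "nat \<Rightarrow> 'v list \<Rightarrow> 'v list" where
  "last_face n us = (\<sigma> (us ! Suc n) \<star> us ! 0) # take n (drop 1 us)"

lemma length_face: "length us = n + 2 \<Longrightarrow> j \<le> n \<Longrightarrow> length (face j us) = Suc n"
  by (simp add: face_def)

lemma length_last_face: "length us = n + 2 \<Longrightarrow> length (last_face n us) = Suc n"
  by (simp add: last_face_def)

lemma face_twist: "length us = n + 2 \<Longrightarrow> j \<le> n \<Longrightarrow> map \<sigma> (face j us) = face j (map \<sigma> us)"
  by (simp add: face_def twist_mul take_map drop_map)

lemma last_face_twist: "length us = n + 2 \<Longrightarrow> map \<sigma> (last_face n us) = last_face n (map \<sigma> us)"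
  by (simp add: last_face_def twist_mul take_map drop_map nth_map)

end

context algebra_model
begin

definition to_cochain :: "nat \<Rightarrow> ('a list \<Rightarrow> 'k) \<Rightarrow> 'v \<Rightarrow> 'v list \<Rightarrow> 'k" where
  "to_cochain m f a l = (if length l = m then f (map \<kappa> (a # l)) else 0)"

definition from_cochain :: "('v \<Rightarrow> 'v list \<Rightarrow> 'k) \<Rightarrow> 'a list \<Rightarrow> 'k" where
  "from_cochain g as = g (inv_into UNIV \<kappa> (hd as)) (map (inv_into UNIV \<kappa>) (tl as))"

lemma \<kappa>_inv [simp]: "inv_into UNIV \<kappa> (\<kappa> u) = u"
  using \<kappa>_bij by (simp add: bij_betw_def)

lemma from_cochain_map: "from_cochain g (map \<kappa> (a # l)) = g a l"
  by (simp add: from_cochain_def comp_def)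

lemma to_cochain_cochain:
  assumes "multilinear (Suc m) f"
  shows "to_cochain m f \<in> cochain m"
proof -
  have 1: "klin (\<lambda>x. f (map \<kappa> (us @ x # vs)))" if "length us + length vs = m" for us vs
    using assms that by (simp add: multilinear_def del: map_append list.map)
  have "klin (\<lambda>a. to_cochain m f a l)" for l
    using 1[of "[]" l] by (cases "length l = m") (simp_all add: to_cochain_def klin_zero)
  moreover have "klin (\<lambda>b. to_cochain m f a (xs @ b # ys))" for a xs ys
    using 1[of "a # xs" ys] by (cases "length (xs @ a # ys) = m") (simp_all add: to_cochain_def klin_zero)
  ultimately show ?thesis by (simp add: cochain_def to_cochain_def)
qed

lemma from_cochain_multilinear:
  assumes "g \<in> cochain m"
  shows "multilinear (Suc m) (from_cochain g)"
  unfolding multilinear_def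
proof (intro allI impI)
  fix us vs :: "'v list"
  show "klin (\<lambda>x. from_cochain g (map \<kappa> (us @ x # vs)))"
  proof (cases us)
    case Nil
    show ?thesis unfolding Nil append_Nil from_cochain_map by (rule cochainD(2)[OF assms])
  next
    case (Cons a us')
    show ?thesis
      using cochainD(3)[OF assms, of a us' vs] unfolding Cons append_Cons from_cochain_map .
  qed
qed

lemma to_from_cochain: "g \<in> cochain m \<Longrightarrow> to_cochain m (from_cochain g) = g"
  unfolding to_cochain_def[abs_def] from_cochain_map by (intro ext) (simp add: cochainD(1))

lemma boundary_tuple_map:
  assumes "length us = n + 2"
  shows "boundary_tuple R \<sigma> n (map \<kappa> us) =
    (\<Sum>j\<le>n. single (map \<kappa> (face j us)) ((- 1) ^ j))
    + single (map \<kappa> (last_face n us)) ((- 1) ^ Suc n)"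
proof -
  have inner: "take j (map \<kappa> us) @ [map \<kappa> us ! j \<otimes>\<^bsub>R\<^esub> map \<kappa> us ! Suc j] @ drop (j + 2) (map \<kappa> us) = map \<kappa> (face j us)"
    if "j \<le> n" for j
    using assms that by (simp add: face_def take_map drop_map \<kappa>_mult)
  have outer: "(\<sigma> (map \<kappa> us ! Suc n) \<otimes>\<^bsub>R\<^esub> map \<kappa> us ! 0) # take n (drop 1 (map \<kappa> us)) = map \<kappa> (last_face n us)"
    using assms by (simp add: last_face_def take_map drop_map \<kappa>_mult \<kappa>_twist)
  show ?thesis
    unfolding boundary_tuple_def outer by (intro arg_cong2[of _ _ _ _ "(+)"] sum.cong refl) (simp only: inner atMost_iff)
qed

text \<open>Face by face, \<open>codiff\<close> is the transpose of the boundary; this links chains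
  to the cochains treated above.\<close>

lemma ev_boundary_tuple:
  assumes "length l = Suc n"
  shows "ev f (boundary_tuple R \<sigma> n (map \<kappa> (a # l))) = codiff (to_cochain n f) a l"
proof -
  have len: "length (a # l) = n + 2" using assms by simp
  have hdtl: "to_cochain n f (hd us) (tl us) = f (map \<kappa> us)" if "length us = Suc n" for us
    using that by (cases us) (simp_all add: to_cochain_def)
  have "codiff (to_cochain n f) a l = (\<Sum>j\<le>n. (- 1) ^ j * to_cochain n f (hd (face j (a # l))) (tl (face j (a # l))))
      + (- 1) ^ Suc n * to_cochain n f (hd (last_face n (a # l))) (tl (last_face n (a # l)))"
    unfolding codiff_sum[OF assms] Let_def face_def last_face_def by simp
  also have "\<dots> = (\<Sum>j\<le>n. (- 1) ^ j * f (map \<kappa> (face j (a # l)))) + (- 1) ^ Suc n * f (map \<kappa> (last_face n (a # l)))"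
    using hdtl[OF length_face[OF len]] hdtl[OF length_last_face[OF len]] by simp
  also have "\<dots> = ev f (boundary_tuple R \<sigma> n (map \<kappa> (a # l)))"
    unfolding boundary_tuple_map[OF len] ev_add ev_sum ev_single ..
  finally show ?thesis by simp
qed

abbreviation "bd n \<equiv> lin_ext (boundary_tuple R \<sigma> n)"
abbreviation "tw \<equiv> lin_ext (\<lambda>as. single (map \<sigma> as) (1 :: 'k))"

lemma map_twist: "map \<sigma> (map \<kappa> us) = map \<kappa> (map \<sigma>V us)"
  by (simp add: \<kappa>_twist)

lemma multilinear_boundary:
  assumes "multilinear (Suc n) f"
  shows "multilinear (Suc (Suc n)) (\<lambda>as. ev f (boundary_tuple R \<sigma> n as))"
  unfolding multilinear_def
proof (intro allI impI)
  fix us vs :: "'v list"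
  assume l: "length us + length vs + 1 = Suc (Suc n)"
  note c = codiff_cochain[OF to_cochain_cochain[OF assms]]
  show "klin (\<lambda>x. ev f (boundary_tuple R \<sigma> n (map \<kappa> (us @ x # vs))))"
  proof (cases us)
    case Nil
    then have len: "length vs = Suc n" using l by simp
    show ?thesis unfolding Nil append_Nil ev_boundary_tuple[OF len] by (rule cochainD(2)[OF c])
  next
    case (Cons a us')
    then have len: "length (us' @ x # vs) = Suc n" for x using l by simp
    show ?thesis unfolding Cons append_Cons ev_boundary_tuple[OF len] by (rule cochainD(3)[OF c])
  qed
qed

lemma multilinear_twist:
  assumes "multilinear m f"
  shows "multilinear m (\<lambda>as. f (map \<sigma> as))"
  unfolding multilinear_def
proof (intro allI impI)
  fix us vs :: "'v list"
  assume "length us + length vs + 1 = m"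
  then have "klin (\<lambda>x. f (map \<kappa> (map \<sigma>V us @ x # map \<sigma>V vs)))"
    using assms by (simp add: multilinear_def del: map_append list.map)
  from klin_twist[OF this]
  show "klin (\<lambda>x. f (map \<sigma> (map \<kappa> (us @ x # vs))))"
    unfolding map_twist by simp
qed

text \<open>By duality: a multilinear form composed with the boundary is again multilinear.\<close>

lemma bd_mrel: "x \<in> mrel (Suc (Suc n)) \<Longrightarrow> bd n x \<in> mrel (Suc n)"
  by (rule mrelI) (simp add: ev_lin_ext multilinear_mrel[OF multilinear_boundary])

lemma ev_tw: "ev f (tw x) = ev (\<lambda>as. f (map \<sigma> as)) x"
  by (simp add: ev_lin_ext)

lemma tw_mrel: "x \<in> mrel m \<Longrightarrow> tw x \<in> mrel m"
  by (rule mrelI) (simp add: ev_tw multilinear_mrel[OF multilinear_twist])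

lemma tuples_keys:
  assumes "x \<in> tuples m" "as \<in> keys x"
  shows "\<exists>us. as = map \<kappa> us \<and> length us = m"
proof -
  have "set as \<subseteq> carrier R" "length as = m" using assms by (auto simp: tuples_def)
  then show ?thesis using tuple_eq_map[of as] by auto
qed

lemma tuples_sum: "(\<And>i. i \<in> I \<Longrightarrow> g i \<in> tuples m) \<Longrightarrow> sum g I \<in> tuples m"
  by (induction I rule: infinite_finite_induct) (auto intro: tuples_closed)

lemma boundary_tuple_tuples:
  assumes "length us = n + 2"
  shows "boundary_tuple R \<sigma> n (map \<kappa> us) \<in> tuples (Suc n)"
  unfolding boundary_tuple_map[OF assms]
  by (intro tuples_closed(1) tuples_sum tuples_single length_face[OF assms] length_last_face[OF assms]) simp

lemma lin_ext_tuples: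
  assumes "x \<in> tuples m" "\<And>us. length us = m \<Longrightarrow> g (map \<kappa> us) \<in> tuples m'"
  shows "lin_ext g x \<in> tuples m'"
  unfolding tuples_def mem_Collect_eq
proof (rule lin_ext_keys)
  fix t assume "t \<in> keys x"
  then obtain us where "t = map \<kappa> us" "length us = m" using tuples_keys[OF assms(1)] by blast
  then show "keys (g t) \<subseteq> {as. length as = m' \<and> set as \<subseteq> carrier R}"
    using assms(2)[of us] by (simp add: tuples_def)
qed

lemma bd_tuples: "x \<in> tuples (Suc (Suc n)) \<Longrightarrow> bd n x \<in> tuples (Suc n)"
  by (erule lin_ext_tuples) (simp add: boundary_tuple_tuples)

lemma tw_tuples: "x \<in> tuples m \<Longrightarrow> tw x \<in> tuples m"
  by (erule lin_ext_tuples) (simp only: map_twist, rule tuples_single, simp)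

lemma tw_bd:
  assumes "x \<in> tuples (Suc (Suc n))"
  shows "tw (bd n x) = bd n (tw x)"
proof -
  have "tw (boundary_tuple R \<sigma> n t) = bd n (single (map \<sigma> t) 1)" if t: "t \<in> keys x" for t
  proof -
    obtain us where us: "t = map \<kappa> us" "length us = Suc (Suc n)" using tuples_keys[OF assms t] by blast
    then have l: "length us = n + 2" by simp
    have l': "length (map \<sigma>V us) = n + 2" using l by simp
    have "tw (boundary_tuple R \<sigma> n t) = (\<Sum>j\<le>n. single (map \<kappa> (map \<sigma>V (face j us))) ((- 1) ^ j))
      + single (map \<kappa> (map \<sigma>V (last_face n us))) ((- 1) ^ Suc n)"
      unfolding us(1) boundary_tuple_map[OF l] lin_ext_add lin_ext_sum lin_ext_single smul_simps map_twist
      by simp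
    also have "\<dots> = boundary_tuple R \<sigma> n (map \<kappa> (map \<sigma>V us))"
      unfolding boundary_tuple_map[OF l'] using face_twist[OF l] last_face_twist[OF l] by simp
    also have "\<dots> = bd n (single (map \<sigma> t) 1)"
      unfolding us(1) map_twist lin_ext_single smul_simps ..
    finally show ?thesis .
  qed
  then show ?thesis unfolding lin_ext_lin_ext by (rule lin_ext_cong)
qed

text \<open>A polynomial in the twist, given by its roots \<open>ws\<close>; these will be
  eigenvalues other than 1.\<close>

definition tw_poly :: "'k list \<Rightarrow> ('a list \<Rightarrow>\<^sub>0 'k) \<Rightarrow> 'a list \<Rightarrow>\<^sub>0 'k" where
  "tw_poly ws x = foldr (\<lambda>w x. tw x - smul w x) ws x"

lemma tw_poly_simps [simp]: "tw_poly [] x = x" "tw_poly (w # ws) x = tw (tw_poly ws x) - smul w (tw_poly ws x)"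
  by (simp_all add: tw_poly_def)

lemma tw_poly_add: "tw_poly ws (x + y) = tw_poly ws x + tw_poly ws y"
  by (induction ws) (simp_all add: lin_ext_add smul_simps)

lemma tw_poly_tw: "tw_poly ws (tw x) = tw (tw_poly ws x)"
  by (induction ws) (simp_all add: lin_ext_diff lin_ext_smul)

lemma tw_poly_smul: "tw_poly ws (smul r x) = smul r (tw_poly ws x)"
  by (induction ws) (simp_all add: lin_ext_smul smul_simps mult.commute)

lemma tw_poly_diff: "tw_poly ws (x - y) = tw_poly ws x - tw_poly ws y"
  using tw_poly_add[of ws "x - y" y] by simp

lemma tw_poly_commute: "tw_poly ws (tw_poly ws' x) = tw_poly ws' (tw_poly ws x)"
  by (induction ws) (simp_all add: tw_poly_diff tw_poly_tw tw_poly_smul)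

lemma tw_poly_append: "tw_poly (ws @ ws') x = tw_poly ws (tw_poly ws' x)"
  by (simp add: tw_poly_def)

lemma tw_poly_mrel: "x \<in> mrel m \<Longrightarrow> tw_poly ws x \<in> mrel m"
  by (induction ws) (auto intro: mrel_diff tw_mrel mrel_smul)

lemma tw_poly_tuples: "x \<in> tuples m \<Longrightarrow> tw_poly ws x \<in> tuples m"
  by (induction ws) (auto intro: tuples_closed tw_tuples)

lemma tw_poly_bd: "x \<in> tuples (Suc (Suc n)) \<Longrightarrow> tw_poly ws (bd n x) = bd n (tw_poly ws x)"
  by (induction ws) (simp_all add: lin_ext_diff lin_ext_smul tw_bd tw_poly_tuples)

text \<open>
  Since \<open>1 \<notin> set ws\<close>, the operator \<open>tw_poly ws\<close> is a nonzero scalar on any functional invariant under the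
  twist, whereas it kills \<open>y - tw y\<close> modulo the multilinearity relations.
\<close>

definition annihilated :: "nat \<Rightarrow> ('a list \<Rightarrow>\<^sub>0 'k) \<Rightarrow> bool" where
  "annihilated m y \<longleftrightarrow> (\<exists>ws. 1 \<notin> set ws \<and> tw_poly ws (y - tw y) \<in> mrel m)"

lemma annihilated_add:
  assumes "annihilated m y" "annihilated m y'"
  shows "annihilated m (y + y')"
proof -
  obtain ws ws' where w: "1 \<notin> set ws" "tw_poly ws (y - tw y) \<in> mrel m" "1 \<notin> set ws'" "tw_poly ws' (y' - tw y') \<in> mrel m"
    using assms by (auto simp: annihilated_def)
  have "y + y' - tw (y + y') = (y - tw y) + (y' - tw y')" by (simp add: lin_ext_add)
  then have "tw_poly (ws @ ws') (y + y' - tw (y + y')) = tw_poly ws' (tw_poly ws (y - tw y)) + tw_poly ws (tw_poly ws' (y' - tw y'))"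
    by (simp only: tw_poly_append tw_poly_add tw_poly_commute[of ws ws'])
  also have "\<dots> \<in> mrel m" by (rule mrel_closed(1)[OF tw_poly_mrel[OF w(2)] tw_poly_mrel[OF w(4)]])
  finally show ?thesis using w(1,3) unfolding annihilated_def by (intro exI[of _ "ws @ ws'"]) auto
qed

lemma annihilated_mrel: "y \<in> mrel m \<Longrightarrow> annihilated m y"
  unfolding annihilated_def by (intro exI[of _ "[]"]) (simp add: mrel_diff tw_mrel)

text \<open>A tensor of eigenvectors is an eigenvector whose eigenvalue \<open>r\<close> is the
  product. If \<open>r = 1\<close>, the difference from its twist already vanishes in the tensor
  power; otherwise the factor \<open>tw - r\<close> kills it.\<close>

lemma annihilated_eigen:
  assumes eigen: "\<forall>u\<in>set us. \<exists>r. \<sigma>V u = sc r u" and m: "length us = m"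
  shows "annihilated m (single (map \<kappa> us) s)"
proof -
  \<comment> \<open>The twist is applied to one entry at a time, and linearity in that entry
    extracts its eigenvalue.\<close>
  have "\<exists>r. \<forall>f. multilinear m f \<longrightarrow> f (map \<kappa> (map \<sigma>V (take i us) @ drop i us)) = r * f (map \<kappa> us)" if "i \<le> m" for i
    using that
  proof (induction i)
    case 0
    show ?case by (intro exI[of _ 1]) simp
  next
    case (Suc i)
    then obtain r where r: "\<And>f. multilinear m f \<Longrightarrow> f (map \<kappa> (map \<sigma>V (take i us) @ drop i us)) = r * f (map \<kappa> us)"
      by auto
    have i: "i < length us" using Suc.prems m by simp
    then obtain r' where r': "\<sigma>V (us ! i) = sc r' (us ! i)" using eigen by force
    have "f (map \<kappa> (map \<sigma>V (take (Suc i) us) @ drop (Suc i) us)) = (r' * r) * f (map \<kappa> us)" if f: "multilinear m f" for f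
    proof -
      have "klin (\<lambda>x. f (map \<kappa> (map \<sigma>V (take i us) @ x # drop (Suc i) us)))"
        using f i m by (simp add: multilinear_def del: map_append list.map)
      from lin_scale[OF this, of r' "us ! i"] show ?thesis
        using r[OF f] i by (simp add: take_Suc_conv_app_nth r' Cons_nth_drop_Suc)
    qed
    then show ?case by blast
  qed
  from this[of m] obtain r where r: "\<And>f. multilinear m f \<Longrightarrow> f (map \<kappa> (map \<sigma>V us)) = r * f (map \<kappa> us)"
    using m by auto
  let ?y = "single (map \<kappa> us) s"
  have *: "tw ?y - smul r ?y \<in> mrel m"
  proof (rule mrelI)
    fix f assume "multilinear m f"
    then show "ev f (tw ?y - smul r ?y) = 0"
      unfolding ev_diff ev_smul ev_tw ev_single map_twist by (simp only: r mult.left_commute diff_self)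
  qed
  show ?thesis
  proof (cases "r = 1")
    case True
    then have "?y - tw ?y \<in> mrel m" using mrel_closed(3)[OF *] by (simp add: smul_simps)
    then show ?thesis unfolding annihilated_def by (intro exI[of _ "[]"]) simp
  next
    case False
    have "tw_poly [r] (?y - tw ?y) = (tw ?y - smul r ?y) - tw (tw ?y - smul r ?y)"
      by (simp only: tw_poly_simps lin_ext_diff lin_ext_smul smul_simps(8)) (simp add: algebra_simps)
    also have "\<dots> \<in> mrel m" by (rule mrel_diff[OF * tw_mrel[OF *]])
    finally show ?thesis using False unfolding annihilated_def by (intro exI[of _ "[r]"]) simp
  qed
qed

text \<open>The eigenvectors of the twist span the algebra, stated as the induction principle in
  which this is used.\<close>

definition twist_diagonal :: bool where
  "twist_diagonal \<longleftrightarrow> (\<forall>P. (\<forall>u v. P u \<longrightarrow> P v \<longrightarrow> P (u + v)) \<longrightarrow> (\<forall>r u. P u \<longrightarrow> P (sc r u)) \<longrightarrow>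
    (\<forall>u r. \<sigma>V u = sc r u \<longrightarrow> P u) \<longrightarrow> (\<forall>u. P u))"

lemma twist_diagonal_induct:
  assumes twist_diagonal "\<And>u v. P u \<Longrightarrow> P v \<Longrightarrow> P (u + v)" "\<And>r u. P u \<Longrightarrow> P (sc r u)"
    "\<And>u r. \<sigma>V u = sc r u \<Longrightarrow> P u"
  shows "P u"
  using assms(1)[unfolded twist_diagonal_def, rule_format, of P u] assms(2-4) by blast

lemma annihilated_tuples:
  assumes diag: twist_diagonal
    and y: "y \<in> tuples m"
  shows "annihilated m y"
proof -
  \<comment> \<open>The entries of \<open>vs\<close> are eigenvectors already. The last entry of
    \<open>us\<close> is decomposed into eigenvectors and moved over to \<open>vs\<close>.\<close>
  have single: "\<forall>s. annihilated m (single (map \<kappa> (us @ vs)) s)"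
    if "length us + length vs = m" "\<forall>v\<in>set vs. \<exists>r. \<sigma>V v = sc r v" for us vs
    using that
  proof (induction us arbitrary: vs rule: rev_induct)
    case Nil
    then show ?case using annihilated_eigen by simp
  next
    case (snoc x us)
    have l: "length us + length vs + 1 = m" using snoc.prems by simp
    have "\<forall>s. annihilated m (single (map \<kappa> (us @ x # vs)) s)"
    proof (induction x rule: twist_diagonal_induct[OF diag])
      case (1 u v)
      show ?case
      proof
        fix s
        have "single (map \<kappa> (us @ (u + v) # vs)) s - single (map \<kappa> (us @ u # vs)) s
          - single (map \<kappa> (us @ v # vs)) s \<in> mrel m" (is "?g \<in> _")
          unfolding mrel_eq by (intro generate.incl mgen.add l)
        from annihilated_add[OF annihilated_mrel[OF this] annihilated_add[OF 1(1)[rule_format, of s] 1(2)[rule_format, of s]]]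
        have "annihilated m (?g + (single (map \<kappa> (us @ u # vs)) s + single (map \<kappa> (us @ v # vs)) s))" .
        then show "annihilated m (single (map \<kappa> (us @ (u + v) # vs)) s)" by simp
      qed
    next
      case (2 r u)
      show ?case
      proof
        fix s
        have "single (map \<kappa> (us @ sc r u # vs)) s - single (map \<kappa> (us @ u # vs)) (s * r) \<in> mrel m"
          (is "?g \<in> _")
          unfolding mrel_eq by (intro generate.incl mgen.scale l)
        from annihilated_add[OF annihilated_mrel[OF this] 2[rule_format, of "s * r"]]
        have "annihilated m (?g + single (map \<kappa> (us @ u # vs)) (s * r))" .
        then show "annihilated m (single (map \<kappa> (us @ sc r u # vs)) s)" by simp
      qed
    next
      case (3 u r)
      then have "\<forall>v\<in>set (u # vs). \<exists>r. \<sigma>V v = sc r v" using snoc.prems by auto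
      then show ?case using snoc.IH[of "u # vs"] l by simp
    qed
    then show ?case by simp
  qed
  have "annihilated m (\<Sum>t\<in>J. single t (lookup y t))" if "J \<subseteq> keys y" for J
  proof -
    have "finite J" using finite_subset[OF that finite_keys] .
    then show ?thesis using that
    proof induction
      case empty
      then show ?case using annihilated_mrel[OF mrel_closed(2)] by simp
    next
      case (insert t J)
      then obtain us where "t = map \<kappa> us" "length us = m" using tuples_keys[OF y, of t] by blast
      then have "annihilated m (single t (lookup y t))" using single[of us "[]"] by simp
      then show ?case using insert annihilated_add by simp
    qed
  qed
  from this[OF order.refl] show ?thesis using poly_mapping_sum_single[of y] by simp
qed

text \<open>Under an invariant functional \<open>tw\<close> acts as 1, so each factor
  \<open>tw - w\<close> contributes \<open>1 - w\<close>.\<close>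

lemma ev_tw_poly:
  assumes "\<And>x. x \<in> tuples m \<Longrightarrow> ev f (tw x) = ev f x" "x \<in> tuples m"
  shows "ev f (tw_poly ws x) = prod_list (map (\<lambda>w. 1 - w) ws) * ev f x"
  by (induction ws) (simp_all add: ev_diff ev_smul assms(1)[OF tw_poly_tuples[OF assms(2)]] algebra_simps)

text \<open>Otherwise a functional \<open>f\<close> separates \<open>z\<close> from the boundaries
  and the coinvariant relations. It is an invariant cocycle, so it factors as \<open>G\<close> after
  the boundary. But \<open>G\<close> need not be invariant, and \<open>ev G (y - tw y)\<close> need
  not vanish. Applying \<open>tw_poly\<close> with the \<open>ws\<close> that annihilate
  \<open>y\<close> removes this term, while \<open>ev f z\<close> is only multiplied by a nonzero
  scalar.\<close>

theorem cycle_is_boundary: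
  assumes exact: "\<And>f. f \<in> cochain (Suc m) \<Longrightarrow> codiff f = 0 \<Longrightarrow> \<exists>g\<in>cochain m. f = codiff g"
    and diag: twist_diagonal
    and z: "z \<in> tuples (Suc (Suc m))" and y: "y \<in> tuples (Suc m)"
    and zy: "bd m z - (y - tw y) \<in> mrel (Suc m)"
  shows "\<exists>w\<in>tuples (Suc (Suc (Suc m))). \<exists>y'\<in>tuples (Suc (Suc m)). z - bd (Suc m) w - (y' - tw y') \<in> mrel (Suc (Suc m))"
proof -
  define bdry where "bdry x \<longleftrightarrow> (\<exists>w\<in>tuples (Suc (Suc (Suc m))). \<exists>y'\<in>tuples (Suc (Suc m)).
      x - bd (Suc m) w - (y' - tw y') \<in> mrel (Suc (Suc m)))" for x
  have bdryI: "bdry (bd (Suc m) w + (y' - tw y') + x)"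
    if "w \<in> tuples (Suc (Suc (Suc m)))" "y' \<in> tuples (Suc (Suc m))" "x \<in> mrel (Suc (Suc m))" for w y' x
    unfolding bdry_def using that by (intro bexI[of _ w] bexI[of _ y']) (auto simp: algebra_simps)
  have bdryE: "\<exists>w\<in>tuples (Suc (Suc (Suc m))). \<exists>y'\<in>tuples (Suc (Suc m)). \<exists>x'\<in>mrel (Suc (Suc m)).
      x = bd (Suc m) w + (y' - tw y') + x'" if "bdry x" for x
  proof -
    from that obtain w y' where wy: "w \<in> tuples (Suc (Suc (Suc m)))" "y' \<in> tuples (Suc (Suc m))"
      "x - bd (Suc m) w - (y' - tw y') \<in> mrel (Suc (Suc m))" unfolding bdry_def by blast
    have "x = bd (Suc m) w + (y' - tw y') + (x - bd (Suc m) w - (y' - tw y'))" by simp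
    with wy show ?thesis by blast
  qed
  have "bdry z"
  proof (rule ccontr)
    assume "\<not> bdry z"
    have "\<exists>f. (\<forall>x\<in>{x. bdry x}. ev f x = 0) \<and> ev f z = 1"
    proof (rule separating_functional)
      show "0 \<in> {x. bdry x}" using bdryI[of 0 0 0] by (simp add: tuples_closed mrel_closed)
    next
      fix x x' assume "x \<in> {x. bdry x}" "x' \<in> {x. bdry x}"
      then obtain w y1 r w' y1' r' where
        x: "w \<in> tuples (Suc (Suc (Suc m)))" "y1 \<in> tuples (Suc (Suc m))" "r \<in> mrel (Suc (Suc m))" "x = bd (Suc m) w + (y1 - tw y1) + r"
        "w' \<in> tuples (Suc (Suc (Suc m)))" "y1' \<in> tuples (Suc (Suc m))" "r' \<in> mrel (Suc (Suc m))" "x' = bd (Suc m) w' + (y1' - tw y1') + r'"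
        using bdryE[of x] bdryE[of x'] by blast
      have "x + x' = bd (Suc m) (w + w') + ((y1 + y1') - tw (y1 + y1')) + (r + r')"
        unfolding x(4,8) by (simp add: lin_ext_add)
      then show "x + x' \<in> {x. bdry x}"
        using bdryI[OF tuples_closed(1)[OF x(1,5)] tuples_closed(1)[OF x(2,6)] mrel_closed(1)[OF x(3,7)]] by simp
    next
      fix s x assume "x \<in> {x. bdry x}"
      then obtain w y1 r where
        x: "w \<in> tuples (Suc (Suc (Suc m)))" "y1 \<in> tuples (Suc (Suc m))" "r \<in> mrel (Suc (Suc m))" "x = bd (Suc m) w + (y1 - tw y1) + r"
        using bdryE[of x] by blast
      have "smul s x = bd (Suc m) (smul s w) + (smul s y1 - tw (smul s y1)) + smul s r"
        unfolding x(4) by (simp add: lin_ext_smul smul_simps)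
      then show "smul s x \<in> {x. bdry x}"
        using bdryI[OF tuples_closed(3)[OF x(1)] tuples_closed(3)[OF x(2)] mrel_smul[OF x(3)]] by simp
    qed (use \<open>\<not> bdry z\<close> in simp)
    then obtain f where f: "\<And>x. bdry x \<Longrightarrow> ev f x = 0" "ev f z = 1" by blast
    have f_mrel: "ev f x = 0" if "x \<in> mrel (Suc (Suc m))" for x
      using f(1)[OF bdryI[OF tuples_closed(4) tuples_closed(4) that]] by simp
    have f_bd: "ev f (bd (Suc m) w) = 0" if "w \<in> tuples (Suc (Suc (Suc m)))" for w
      using f(1)[OF bdryI[OF that tuples_closed(4) mrel_closed(2)]] by simp
    have f_tw: "ev f (tw x) = ev f x" if "x \<in> tuples (Suc (Suc m))" for x
      using f(1)[OF bdryI[OF tuples_closed(4) that mrel_closed(2)]] by (simp add: ev_diff)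
    have fm: "multilinear (Suc (Suc m)) f" using multilinearI f_mrel .
    define F where "F = to_cochain (Suc m) f"
    have F: "F \<in> cochain (Suc m)" unfolding F_def by (rule to_cochain_cochain[OF fm])
    have "codiff F a l = 0" for a l
    proof (cases "length l = Suc (Suc m)")
      case True
      have "codiff F a l = ev f (bd (Suc m) (single (map \<kappa> (a # l)) 1))"
        unfolding F_def ev_boundary_tuple[OF True, symmetric] lin_ext_single smul_simps ..
      also have "\<dots> = 0" using True by (intro f_bd tuples_single) simp
      finally show ?thesis .
    next
      case False
      then show ?thesis using cochainD(1)[OF codiff_cochain[OF F]] by blast
    qed
    then have "codiff F = 0" by (simp add: fun_eq_iff)
    then obtain g where g: "g \<in> cochain m" "F = codiff g" using exact[OF F] by blast
    define G where "G = from_cochain g"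
    have G: "multilinear (Suc m) G" unfolding G_def by (rule from_cochain_multilinear[OF g(1)])
    have fG: "ev f x = ev G (bd m x)" if x: "x \<in> tuples (Suc (Suc m))" for x
      unfolding ev_lin_ext
    proof (rule ev_cong)
      fix t assume "t \<in> keys x"
      then obtain us where us: "t = map \<kappa> us" "length us = Suc (Suc m)" using tuples_keys[OF x] by blast
      then obtain a l where al: "us = a # l" "length l = Suc m" by (cases us) auto
      have "f t = F a l" by (simp add: F_def to_cochain_def us al)
      also have "\<dots> = ev G (boundary_tuple R \<sigma> m t)"
        unfolding us(1) al(1) ev_boundary_tuple[OF al(2)] G_def to_from_cochain[OF g(1)] g(2) ..
      finally show "f t = ev G (boundary_tuple R \<sigma> m t)" .
    qed
    obtain ws where ws: "1 \<notin> set ws" "tw_poly ws (y - tw y) \<in> mrel (Suc m)"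
      using annihilated_tuples[OF diag y] unfolding annihilated_def by blast
    have "prod_list (map (\<lambda>w. 1 - w) ws) * ev f z = ev f (tw_poly ws z)"
      using ev_tw_poly[OF f_tw z] by simp
    also have "\<dots> = ev G (tw_poly ws (bd m z))"
      using fG[OF tw_poly_tuples[OF z]] tw_poly_bd[OF z] by simp
    also have "tw_poly ws (bd m z) = tw_poly ws (y - tw y) + tw_poly ws (bd m z - (y - tw y))"
      by (simp flip: tw_poly_add)
    also have "ev G \<dots> = 0"
      using multilinear_mrel[OF G mrel_closed(1)[OF ws(2) tw_poly_mrel[OF zy]]] .
    finally have "prod_list (map (\<lambda>w. 1 - w) ws) = 0" using f(2) by simp
    then show False using ws(1) by (auto simp: prod_list_zero_iff)
  qed
  then show ?thesis unfolding bdry_def .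
qed

end

section \<open>Passage to the quotient groups\<close>

text \<open>The image of the coset of \<open>x\<close> lies in the coset of \<open>f x\<close> and
  contains \<open>f x\<close>; multiplying by \<open>N\<close> fills up that coset.\<close>

lemma induced_rcoset:
  assumes "group G" "group H" "f \<in> hom G H" "subgroup M G" "subgroup N H" "f ` M \<subseteq> N" "x \<in> carrier G"
  shows "induced H N f (M #>\<^bsub>G\<^esub> x) = N #>\<^bsub>H\<^esub> f x"
proof -
  interpret G: group G by fact
  interpret H: group H by fact
  have M: "m \<in> carrier G" if "m \<in> M" for m using subgroup.mem_carrier[OF assms(4) that] .
  have N: "n \<in> carrier H" if "n \<in> N" for n using subgroup.mem_carrier[OF assms(5) that] .
  have fc: "f y \<in> carrier H" if "y \<in> carrier G" for y using assms(3) that by (auto simp: hom_def)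
  have f: "f (m \<otimes>\<^bsub>G\<^esub> x) = f m \<otimes>\<^bsub>H\<^esub> f x" if "m \<in> M" for m
    using hom_mult[OF assms(3) M[OF that] assms(7)] .
  have f1: "f \<one>\<^bsub>G\<^esub> = \<one>\<^bsub>H\<^esub>" by (rule hom_one[OF assms(3,1,2)])
  show ?thesis
  proof (intro equalityI subsetI)
    fix y assume "y \<in> induced H N f (M #>\<^bsub>G\<^esub> x)"
    then obtain n m where nm: "n \<in> N" "m \<in> M" "y = n \<otimes>\<^bsub>H\<^esub> f (m \<otimes>\<^bsub>G\<^esub> x)"
      by (auto simp: induced_def set_mult_def r_coset_def)
    have fm: "f m \<in> N" using assms(6) nm(2) by blast
    have "y = (n \<otimes>\<^bsub>H\<^esub> f m) \<otimes>\<^bsub>H\<^esub> f x"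
      unfolding nm(3) f[OF nm(2)] by (rule H.m_assoc[symmetric, OF N[OF nm(1)] N[OF fm] fc[OF assms(7)]])
    moreover have "n \<otimes>\<^bsub>H\<^esub> f m \<in> N" using subgroup.m_closed[OF assms(5) nm(1) fm] .
    ultimately show "y \<in> N #>\<^bsub>H\<^esub> f x" by (auto simp: r_coset_def)
  next
    fix y assume "y \<in> N #>\<^bsub>H\<^esub> f x"
    then obtain n where n: "n \<in> N" "y = n \<otimes>\<^bsub>H\<^esub> f x" by (auto simp: r_coset_def)
    have "x \<in> M #>\<^bsub>G\<^esub> x" using G.rcos_self[OF assms(7,4)] .
    then show "y \<in> induced H N f (M #>\<^bsub>G\<^esub> x)" using n by (auto simp: induced_def set_mult_def)
  qed
qed

lemma induced_hom:
  assumes "comm_group G" "comm_group H" "f \<in> hom G H" "subgroup M G" "subgroup N H" "f ` M \<subseteq> N"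
  shows "induced H N f \<in> hom (G Mod M) (H Mod N)"
proof -
  interpret G: comm_group G by fact
  interpret H: comm_group H by fact
  interpret M: normal M G by (rule G.subgroup_imp_normal[OF assms(4)])
  interpret N: normal N H by (rule H.subgroup_imp_normal[OF assms(5)])
  note ind = induced_rcoset[OF G.is_group H.is_group assms(3-6)]
  have fc: "f y \<in> carrier H" if "y \<in> carrier G" for y using assms(3) that by (auto simp: hom_def)
  show ?thesis
  proof (rule homI)
    fix C assume "C \<in> carrier (G Mod M)"
    then show "induced H N f C \<in> carrier (H Mod N)"
      using ind fc by (auto simp: carrier_FactGroup)
  next
    fix C D assume "C \<in> carrier (G Mod M)" "D \<in> carrier (G Mod M)"
    then obtain x y where "C = M #>\<^bsub>G\<^esub> x" "D = M #>\<^bsub>G\<^esub> y" "x \<in> carrier G" "y \<in> carrier G"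
      by (auto simp: carrier_FactGroup)
    then show "induced H N f (C \<otimes>\<^bsub>G Mod M\<^esub> D) = induced H N f C \<otimes>\<^bsub>H Mod N\<^esub> induced H N f D"
      using ind fc hom_mult[OF assms(3)] by (simp add: M.rcos_sum N.rcos_sum)
  qed
qed

text \<open>With \<open>K\<close> inside \<open>H\<close>, every coset of an element of
  \<open>K\<close> is \<open>H\<close> itself. In the application \<open>K\<close> consists of the
  cycles and \<open>H\<close> of the boundaries.\<close>

lemma trivial_group_Mod:
  assumes "group G" "subgroup H G" "K \<subseteq> H" "K \<noteq> {}"
  shows "trivial_group (G\<lparr>carrier := K\<rparr> Mod H)"
proof -
  interpret group G by fact
  have "H #>\<^bsub>G\<lparr>carrier := K\<rparr>\<^esub> a = H" if "a \<in> H" for a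
    using coset_join2[OF subgroup.mem_carrier[OF assms(2) that] assms(2) that] by (simp add: r_coset_def)
  then have car: "carrier (G\<lparr>carrier := K\<rparr> Mod H) = {H}"
    using assms(3,4) unfolding carrier_FactGroup by auto
  have HH: "H <#>\<^bsub>G\<^esub> H = H"
    by (rule subgroup_mult_id[OF assms(2)])
  have mult: "A <#>\<^bsub>G\<lparr>carrier := K\<rparr>\<^esub> B = A <#>\<^bsub>G\<^esub> B" for A B
    by (simp add: set_mult_def)
  have "group (G\<lparr>carrier := K\<rparr> Mod H)"
    by (rule groupI) (simp_all add: car HH mult)
  then show ?thesis by (simp add: trivial_group_def car)
qed

context algebra_model
begin

abbreviation "cls m x \<equiv> mrel m #>\<^bsub>tuple_space R m\<^esub> x"

lemma tensor_comm_group: "comm_group (tensor_power R m)"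
  unfolding tensor_power_def by (rule comm_group.abelian_FactGroup[OF tuples_group mrel_subgroup])

lemma tensor_carrier: "carrier (tensor_power R m) = cls m ` tuples m"
  by (simp add: tensor_power_def carrier_FactGroup)

lemma cls_hom: "cls m \<in> hom (tuple_space R m) (tensor_power R m)"
  unfolding tensor_power_def
  by (rule normal.r_coset_hom_Mod[OF comm_group.subgroup_imp_normal[OF tuples_group mrel_subgroup]])

lemma cls_group_hom: "group_hom (tuple_space R m) (tensor_power R m) (cls m)"
  unfolding group_hom_def group_hom_axioms_def
  using cls_hom tuples_group tensor_comm_group by (simp add: comm_group.axioms(2))

lemma cls_add: "x \<in> tuples m \<Longrightarrow> y \<in> tuples m \<Longrightarrow> cls m (x + y) = cls m x \<otimes>\<^bsub>tensor_power R m\<^esub> cls m y"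
  using hom_mult[OF cls_hom[of m], of x y] by simp

lemma cls_inv:
  assumes "x \<in> tuples m"
  shows "cls m (- x) = inv\<^bsub>tensor_power R m\<^esub> cls m x"
proof -
  interpret group_hom "tuple_space R m" "tensor_power R m" "cls m" by (rule cls_group_hom)
  show ?thesis using hom_inv[OF assms] tuple_space_inv[OF assms] by simp
qed

lemma cls_eqD:
  assumes "cls m x = cls m y" "x \<in> tuples m"
  shows "x - y \<in> mrel m"
proof -
  have "x \<in> cls m x"
    using group.rcos_self[OF comm_group.axioms(2)[OF tuples_group] assms(2) mrel_subgroup] .
  then have "x \<in> cls m y" using assms(1) by simp
  then show ?thesis by (auto simp: r_coset_def)
qed

lemma cls_mrel:
  assumes "x \<in> mrel m"
  shows "cls m x = \<one>\<^bsub>tensor_power R m\<^esub>"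
  using group.coset_join2[OF comm_group.axioms(2)[OF tuples_group] mrel_tuples[OF assms] mrel_subgroup assms]
  by (simp add: tensor_power_def)

lemma lin_ext_hom:
  assumes "\<And>x. x \<in> tuples m \<Longrightarrow> lin_ext g x \<in> tuples m'"
  shows "lin_ext g \<in> hom (tuple_space R m) (tuple_space R m')"
  using assms by (intro homI) (simp_all add: lin_ext_add)

abbreviation "tbd m \<equiv> induced (tuple_space R (Suc m)) (mrel (Suc m)) (bd m)"

lemma tbd_hom: "tbd m \<in> hom (tensor_power R (Suc (Suc m))) (tensor_power R (Suc m))"
  unfolding tensor_power_def
  by (rule induced_hom[OF tuples_group tuples_group lin_ext_hom mrel_subgroup mrel_subgroup])
    (auto simp: bd_tuples bd_mrel)

lemma tbd_cls: "x \<in> tuples (Suc (Suc m)) \<Longrightarrow> tbd m (cls (Suc (Suc m)) x) = cls (Suc m) (bd m x)"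
  by (rule induced_rcoset[OF comm_group.axioms(2)[OF tuples_group] comm_group.axioms(2)[OF tuples_group]
        lin_ext_hom mrel_subgroup mrel_subgroup]) (auto simp: bd_tuples bd_mrel)

lemma ttw_cls: "x \<in> tuples m \<Longrightarrow> tensor_power_map R \<sigma> m (cls m x) = cls m (tw x)"
  unfolding tensor_power_map_def
  by (rule induced_rcoset[OF comm_group.axioms(2)[OF tuples_group] comm_group.axioms(2)[OF tuples_group]
        lin_ext_hom mrel_subgroup mrel_subgroup]) (auto simp: tw_tuples tw_mrel)

abbreviation "coinv m \<equiv> coinvariant_relations R \<sigma> m"

lemma coinv_eq: "coinv m = (\<lambda>y. cls m (y - tw y)) ` tuples m"
proof -
  have "cls m y \<otimes>\<^bsub>tensor_power R m\<^esub> inv\<^bsub>tensor_power R m\<^esub> (tensor_power_map R \<sigma> m (cls m y)) = cls m (y - tw y)"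
    if y: "y \<in> tuples m" for y
  proof -
    have "- tw y \<in> tuples m" using tuples_closed(2)[OF tuples_closed(4) tw_tuples[OF y]] by simp
    from cls_add[OF y this] show ?thesis by (simp add: ttw_cls[OF y] cls_inv[OF tw_tuples[OF y]])
  qed
  then show ?thesis
    unfolding coinvariant_relations_def tensor_carrier image_image by (intro image_cong refl)
qed

lemma coinv_subgroup: "subgroup (coinv m) (tensor_power R m)"
proof -
  have "(\<lambda>y. cls m (y - tw y)) \<in> hom (tuple_space R m) (tensor_power R m)"
  proof (rule homI)
    fix x y assume xy: "x \<in> tuples m" "y \<in> tuples m"
    have eq: "(x + y) - tw (x + y) = (x - tw x) + (y - tw y)" by (simp add: lin_ext_add)
    show "cls m ((x \<otimes>\<^bsub>tuple_space R m\<^esub> y) - tw (x \<otimes>\<^bsub>tuple_space R m\<^esub> y)) =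
      cls m (x - tw x) \<otimes>\<^bsub>tensor_power R m\<^esub> cls m (y - tw y)"
      unfolding tuple_space_simps eq using xy by (intro cls_add tuples_closed(2) tw_tuples)
  qed (auto simp: tensor_carrier intro!: imageI tuples_closed(2) tw_tuples)
  then have "group_hom (tuple_space R m) (tensor_power R m) (\<lambda>y. cls m (y - tw y))"
    unfolding group_hom_def group_hom_axioms_def
    using tuples_group tensor_comm_group by (simp add: comm_group.axioms(2))
  from group_hom.img_is_subgroup[OF this] show ?thesis by (simp add: coinv_eq)
qed

abbreviation "hch n \<equiv> hochschild_chains R \<sigma> n"
abbreviation "ccls n x \<equiv> coinv (Suc n) #>\<^bsub>tensor_power R (Suc n)\<^esub> cls (Suc n) x"

lemma chains_comm_group: "comm_group (hch n)"
  unfolding hochschild_chains_def by (rule comm_group.abelian_FactGroup[OF tensor_comm_group coinv_subgroup])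

lemma chains_carrier: "carrier (hch n) = ccls n ` tuples (Suc n)"
  by (simp add: hochschild_chains_def carrier_FactGroup tensor_carrier image_image)

lemma ccls_add:
  assumes "x \<in> tuples (Suc n)" "y \<in> tuples (Suc n)"
  shows "ccls n (x + y) = ccls n x \<otimes>\<^bsub>hch n\<^esub> ccls n y"
proof -
  have "cls (Suc n) x \<in> carrier (tensor_power R (Suc n))" "cls (Suc n) y \<in> carrier (tensor_power R (Suc n))"
    using assms by (auto simp: tensor_carrier)
  from hom_mult[OF normal.r_coset_hom_Mod[OF comm_group.subgroup_imp_normal[OF tensor_comm_group coinv_subgroup]] this]
  show ?thesis unfolding hochschild_chains_def cls_add[OF assms] .
qed

text \<open>Together with \<open>ccls_oneI\<close> it translates vanishing in the iterated quotient
  into the statement on representatives used by \<open>cycle_is_boundary\<close>.\<close>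

lemma ccls_oneD:
  assumes "x \<in> tuples (Suc n)" "ccls n x = \<one>\<^bsub>hch n\<^esub>"
  shows "\<exists>y\<in>tuples (Suc n). x - (y - tw y) \<in> mrel (Suc n)"
proof -
  have "cls (Suc n) x \<in> coinv (Suc n)"
    using group.coset_join1[OF comm_group.axioms(2)[OF tensor_comm_group] _ _ coinv_subgroup, where x = "cls (Suc n) x"]
      assms by (simp add: hochschild_chains_def tensor_carrier)
  then obtain y where "y \<in> tuples (Suc n)" "cls (Suc n) x = cls (Suc n) (y - tw y)"
    by (auto simp: coinv_eq)
  then show ?thesis using cls_eqD[OF _ assms(1)] by blast
qed

lemma ccls_oneI:
  assumes "y \<in> tuples (Suc n)" "x - (y - tw y) \<in> mrel (Suc n)"
  shows "ccls n x = \<one>\<^bsub>hch n\<^esub>"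
proof -
  interpret Q: comm_group "tensor_power R (Suc n)" by (rule tensor_comm_group)
  have yt: "y - tw y \<in> tuples (Suc n)" using assms(1) by (intro tuples_closed(2) tw_tuples)
  have "cls (Suc n) x = cls (Suc n) ((y - tw y) + (x - (y - tw y)))" by simp
  also have "\<dots> = cls (Suc n) (y - tw y) \<otimes>\<^bsub>tensor_power R (Suc n)\<^esub> \<one>\<^bsub>tensor_power R (Suc n)\<^esub>"
    unfolding cls_add[OF yt mrel_tuples[OF assms(2)]] cls_mrel[OF assms(2)] ..
  also have "\<dots> = cls (Suc n) (y - tw y)" using yt by (intro Q.r_one) (auto simp: tensor_carrier)
  finally have "cls (Suc n) x \<in> coinv (Suc n)" using assms(1) by (auto simp: coinv_eq)
  then show ?thesis
    using Q.coset_join2[OF _ coinv_subgroup] subgroup.mem_carrier[OF coinv_subgroup]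
    by (simp add: hochschild_chains_def)
qed

lemma tbd_coinv: "tbd m ` coinv (Suc (Suc m)) \<subseteq> coinv (Suc m)"
proof
  fix C assume "C \<in> tbd m ` coinv (Suc (Suc m))"
  then obtain y where y: "y \<in> tuples (Suc (Suc m))" "C = tbd m (cls (Suc (Suc m)) (y - tw y))"
    by (auto simp: coinv_eq)
  then have "C = cls (Suc m) (bd m y - tw (bd m y))"
    by (simp add: tbd_cls tuples_closed(2) tw_tuples lin_ext_diff tw_bd)
  then show "C \<in> coinv (Suc m)" using bd_tuples[OF y(1)] by (auto simp: coinv_eq)
qed

lemma boundary_hom: "boundary R \<sigma> m \<in> hom (hch (Suc m)) (hch m)"
  unfolding hochschild_chains_def boundary_def
  by (rule induced_hom[OF tensor_comm_group tensor_comm_group tbd_hom coinv_subgroup coinv_subgroup tbd_coinv])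

lemma boundary_ccls: "x \<in> tuples (Suc (Suc m)) \<Longrightarrow> boundary R \<sigma> m (ccls (Suc m) x) = ccls m (bd m x)"
  unfolding boundary_def
  by (subst induced_rcoset[OF comm_group.axioms(2)[OF tensor_comm_group] comm_group.axioms(2)[OF tensor_comm_group]
        tbd_hom coinv_subgroup coinv_subgroup tbd_coinv]) (auto simp: tensor_carrier tbd_cls)

text \<open>A cycle is lifted to a representative \<open>z\<close>, whose boundary vanishes only up
  to some \<open>y - tw y\<close> and multilinearity. On that level \<open>cycle_is_boundary\<close>
  applies, and its result is projected back.\<close>

theorem twisted_HH_trivial:
  assumes exact: "\<And>f. f \<in> cochain (Suc m) \<Longrightarrow> codiff f = 0 \<Longrightarrow> \<exists>g\<in>cochain m. f = codiff g"
    and diag: twist_diagonal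
  shows "trivial_group (twisted_HH R \<sigma> (Suc m))"
proof -
  let ?H = "boundary R \<sigma> (Suc m) ` carrier (hch (Suc (Suc m)))"
  have "cycles R \<sigma> (Suc m) \<subseteq> ?H"
  proof
    fix C assume "C \<in> cycles R \<sigma> (Suc m)"
    then have C: "C \<in> carrier (hch (Suc m))" "boundary R \<sigma> m C = \<one>\<^bsub>hch m\<^esub>"
      by (simp_all add: kernel_def)
    then obtain z where z: "z \<in> tuples (Suc (Suc m))" "C = ccls (Suc m) z" by (auto simp: chains_carrier)
    then have "ccls m (bd m z) = \<one>\<^bsub>hch m\<^esub>" using C(2) boundary_ccls by simp
    from ccls_oneD[OF bd_tuples[OF z(1)] this] obtain y where
      "y \<in> tuples (Suc m)" "bd m z - (y - tw y) \<in> mrel (Suc m)" by blast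
    from cycle_is_boundary[OF exact diag z(1) this] obtain w y' where w: "w \<in> tuples (Suc (Suc (Suc m)))"
      "y' \<in> tuples (Suc (Suc m))" "z - bd (Suc m) w - (y' - tw y') \<in> mrel (Suc (Suc m))" by blast
    interpret Ch: comm_group "hch (Suc m)" by (rule chains_comm_group)
    have bw: "bd (Suc m) w \<in> tuples (Suc (Suc m))" using bd_tuples[OF w(1)] .
    have "C = ccls (Suc m) (bd (Suc m) w + (z - bd (Suc m) w))" using z(2) by simp
    also have "\<dots> = ccls (Suc m) (bd (Suc m) w) \<otimes>\<^bsub>hch (Suc m)\<^esub> \<one>\<^bsub>hch (Suc m)\<^esub>"
      unfolding ccls_add[OF bw tuples_closed(2)[OF z(1) bw]] ccls_oneI[OF w(2,3)] ..
    also have "\<dots> = ccls (Suc m) (bd (Suc m) w)" using bw by (intro Ch.r_one) (auto simp: chains_carrier)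
    also have "\<dots> = boundary R \<sigma> (Suc m) (ccls (Suc (Suc m)) w)" using boundary_ccls[OF w(1)] by simp
    finally show "C \<in> ?H" using w(1) by (auto simp: chains_carrier)
  qed
  moreover have "\<one>\<^bsub>hch (Suc m)\<^esub> \<in> cycles R \<sigma> (Suc m)"
    using hom_one[OF boundary_hom] comm_group.axioms(2)[OF chains_comm_group]
    by (simp add: kernel_def group.is_monoid monoid.one_closed)
  moreover have "group_hom (hch (Suc (Suc m))) (hch (Suc m)) (boundary R \<sigma> (Suc m))"
    unfolding group_hom_def group_hom_axioms_def
    using boundary_hom chains_comm_group by (simp add: comm_group.axioms(2))
  then have "subgroup ?H (hch (Suc m))" by (rule group_hom.img_is_subgroup)
  ultimately show ?thesis
    unfolding twisted_HH_def by (intro trivial_group_Mod comm_group.axioms(2)[OF chains_comm_group]) auto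
qed

end

section \<open>Identification of the model with the Podles algebra\<close>

lemma V_basis_induct:
  assumes "\<And>u v. P u \<Longrightarrow> P v \<Longrightarrow> P (u + v)" "\<And>r u. P u \<Longrightarrow> P (scaleV r u)"
    "\<And>j i. P (single j (Polynomial.monom 1 i))"
  shows "P (u :: int \<Rightarrow>\<^sub>0 'k::field poly)"
proof (induction u rule: poly_mapping_induct)
  case (2 j p)
  have monom: "P (single j (Polynomial.monom a i))" for a i
    using assms(2)[OF assms(3), of a j i] by (simp add: scaleV_def smul_simps smult_monom)
  have "P (single j (\<Sum>i\<le>n. Polynomial.monom (Polynomial.coeff p i) i))" for n
    by (induction n) (simp_all add: monom single_add assms(1))
  from this[of "Polynomial.degree p"] show ?case by (simp add: poly_as_sum_of_monoms)
qed (rule assms(1))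

context podles_model
begin

text \<open>The coset that belongs to a normal form, taken as a fibre of
  \<open>x \<mapsto> act x oneV\<close>, so that no representative has to be chosen; by
  \<open>coset_eq\<close> the cosets are such fibres.\<close>

definition to_coset :: "(int \<Rightarrow>\<^sub>0 'k poly) \<Rightarrow> 'k podles_free set" where
  "to_coset u = {x. act x oneV = u}"

lemma coset_eq: "ideal_pod +>\<^bsub>ring_of_type_algebra\<^esub> x = to_coset (act x oneV)"
proof -
  have "(\<exists>h\<in>ideal_pod. y = h + x) \<longleftrightarrow> y \<doteq> x" for y
    unfolding eqv_def by (metis add_diff_cancel diff_add_cancel)
  then show ?thesis
    by (auto simp: a_r_coset_def r_coset_def to_coset_def eqv_iff_act)
qed

lemma to_coset_eq: "to_coset u = ideal_pod +>\<^bsub>ring_of_type_algebra\<^esub> psi u"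
  by (simp add: coset_eq act_psi)

abbreviation "alg \<equiv> podles_algebra q c d"

lemma podles_algebra_simps:
  "carrier alg = carrier (ring_of_type_algebra Quot ideal_pod)"
  "monoid.mult alg = monoid.mult (ring_of_type_algebra Quot ideal_pod)"
  "ring.add alg = ring.add (ring_of_type_algebra Quot ideal_pod)"
  "module.smult alg = (\<lambda>r C. (ideal_pod +>\<^bsub>ring_of_type_algebra\<^esub> scalar r) \<otimes>\<^bsub>ring_of_type_algebra Quot ideal_pod\<^esub> C)"
  by (simp_all add: podles_algebra_def podles_ring_def ring.defs)

lemma to_coset_bij: "bij_betw to_coset UNIV (carrier alg)"
proof -
  have "inj to_coset"
  proof (rule injI)
    fix u v assume eq: "to_coset u = to_coset v"
    have "psi u \<in> to_coset u" by (simp add: to_coset_def act_psi)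
    then have "psi u \<in> to_coset v" by (simp only: eq)
    then show "u = v" by (simp add: to_coset_def act_psi)
  qed
  moreover have "carrier alg = range to_coset"
  proof -
    have "carrier alg = range (\<lambda>x. ideal_pod +>\<^bsub>ring_of_type_algebra\<^esub> x)"
      unfolding podles_algebra_simps FactRing_def A_RCOSETS_def RCOSETS_def a_r_coset_def[symmetric] by auto
    also have "\<dots> = range to_coset"
      unfolding coset_eq by (auto intro: range_eqI[of _ _ "psi _"] simp: act_psi)
    finally show ?thesis .
  qed
  ultimately show ?thesis by (simp add: bij_betw_def)
qed

lemma to_coset_add: "to_coset (u + v) = to_coset u \<oplus>\<^bsub>alg\<^esub> to_coset v"
  and to_coset_mult: "to_coset (u \<star> v) = to_coset u \<otimes>\<^bsub>alg\<^esub> to_coset v"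
  and to_coset_scale: "to_coset (scaleV r u) = r \<odot>\<^bsub>alg\<^esub> to_coset u"
proof -
  note hom = ideal.rcos_ring_hom[OF podles_ideal_ideal]
  have act_add': "act (psi u + psi v) oneV = u + v" by (simp add: act_add act_psi)
  have act_mult': "act (psi u * psi v) oneV = u \<star> v" by (simp add: act_mult act_psi mulV_def)
  have act_scale': "act (scalar r * psi u) oneV = scaleV r u" by (simp add: act_mult act_scalar act_psi)
  show "to_coset (u + v) = to_coset u \<oplus>\<^bsub>alg\<^esub> to_coset v"
    using ring_hom_add[OF hom, of "psi u" "psi v"]
    by (simp add: podles_algebra_simps to_coset_eq[of u] to_coset_eq[of v]) (simp add: coset_eq act_add')
  show "to_coset (u \<star> v) = to_coset u \<otimes>\<^bsub>alg\<^esub> to_coset v"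
    using ring_hom_mult[OF hom, of "psi u" "psi v"]
    by (simp add: podles_algebra_simps to_coset_eq[of u] to_coset_eq[of v]) (simp add: coset_eq act_mult')
  show "to_coset (scaleV r u) = r \<odot>\<^bsub>alg\<^esub> to_coset u"
    using ring_hom_mult[OF hom, of "scalar r" "psi u"]
    by (simp add: podles_algebra_simps to_coset_eq[of u]) (simp add: coset_eq act_scale')
qed

end

theorem proposition4p7:
  fixes q c d :: "'k::field_char_0"
    and \<sigma> :: "'k podles_free set \<Rightarrow> 'k podles_free set"
    and n :: nat
  assumes "q \<noteq> 0"
    and "\<forall>m::nat. m > 0 \<longrightarrow> q ^ m \<noteq> 1"
    and "c + d \<noteq> 0"
    and "\<sigma> \<in> algebra_automorphisms (podles_algebra q c d)"
    and "n \<ge> 3"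
  shows "trivial_group (twisted_HH (podles_algebra q c d) \<sigma> n)"
proof -
  interpret podles_generic q c d
    using assms by unfold_locales auto
  have \<sigma>: "\<sigma> \<in> ring_hom alg alg" "bij_betw \<sigma> (carrier alg) (carrier alg)"
    "\<And>r x. x \<in> carrier alg \<Longrightarrow> \<sigma> (r \<odot>\<^bsub>alg\<^esub> x) = r \<odot>\<^bsub>alg\<^esub> \<sigma> x"
    using assms(4) by (auto simp: algebra_automorphisms_def ring_iso_def)
  define \<iota> where "\<iota> = inv_into UNIV to_coset"
  \<comment> \<open>The automorphism is transported to normal forms, where
    \<open>automorphism_diagonal\<close> applies.\<close>
  define \<sigma>V where "\<sigma>V u = \<iota> (\<sigma> (to_coset u))" for u
  have car: "to_coset u \<in> carrier alg" for u using to_coset_bij by (auto simp: bij_betw_def)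
  have \<sigma>car: "\<sigma> x \<in> carrier alg" if "x \<in> carrier alg" for x
    using bij_betwE[OF \<sigma>(2)] that by blast
  have \<iota>: "to_coset (\<iota> x) = x" if "x \<in> carrier alg" for x
    using bij_betw_inv_into_right[OF to_coset_bij that] by (simp add: \<iota>_def)
  have \<iota>': "\<iota> (to_coset u) = u" for u
    using bij_betw_inv_into_left[OF to_coset_bij] by (simp add: \<iota>_def)
  have \<sigma>V: "to_coset (\<sigma>V u) = \<sigma> (to_coset u)" for u by (simp add: \<sigma>V_def \<iota> \<sigma>car car)
  have eqI: "u = v" if "to_coset u = to_coset v" for u v using that \<iota>' by metis
  have \<sigma>V_hom: "\<sigma>V (u + v) = \<sigma>V u + \<sigma>V v" "\<sigma>V (scaleV r u) = scaleV r (\<sigma>V u)"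
    "\<sigma>V (mulV u v) = mulV (\<sigma>V u) (\<sigma>V v)" for u v r
    using ring_hom_add[OF \<sigma>(1) car car] ring_hom_mult[OF \<sigma>(1) car car] \<sigma>(3)[OF car]
    by (auto intro!: eqI simp: \<sigma>V to_coset_add to_coset_mult to_coset_scale)
  have "bij \<sigma>V"
  proof -
    have "bij_betw (\<sigma> \<circ> to_coset) UNIV (carrier alg)" using bij_betw_trans[OF to_coset_bij \<sigma>(2)] .
    moreover have "bij_betw \<iota> (carrier alg) UNIV" unfolding \<iota>_def by (rule bij_betw_inv_into[OF to_coset_bij])
    ultimately have "bij_betw (\<iota> \<circ> (\<sigma> \<circ> to_coset)) UNIV UNIV" by (rule bij_betw_trans)
    then show ?thesis by (simp add: \<sigma>V_def[abs_def] comp_def)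
  qed
  interpret tw: podles_twisted scaleV mulV oneV \<sigma>V genA genB genS wV q c d
  proof unfold_locales
    show "\<exists>\<phi>. lin scaleV fscale \<phi> \<and> (\<forall>u. \<phi> (mulV genA u) = p (\<phi> u) + x u) \<and> (\<forall>j. \<phi> (wV j) = v j)"
      if "lin fscale fscale p" "lin scaleV fscale x" for p and x :: "(int \<Rightarrow>\<^sub>0 'k poly) \<Rightarrow> (int \<Rightarrow>\<^sub>0 'k poly) \<Rightarrow> (int \<Rightarrow>\<^sub>0 'k poly) list \<Rightarrow> 'k" and v
      unfolding mulV_gen
      by (rule V_extend[OF _ _ _ _ that]) (auto simp: fun_eq_iff fscale_def algebra_simps)
    show "P u" if "\<And>u v. P u \<Longrightarrow> P v \<Longrightarrow> P (u + v)" "\<And>r u. P u \<Longrightarrow> P (scaleV r u)"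
      "\<And>u. P u \<Longrightarrow> P (mulV genA u)" "\<And>j. P (wV j)" for P and u :: "int \<Rightarrow>\<^sub>0 'k poly"
      using that unfolding mulV_gen by (rule V_induct)
  qed (simp_all add: mulV_algebra \<sigma>V_hom q_nonzero cd_nonzero scaleV_simps mulV_gen opB_opA opA_opS opS_opB
      opB_opS opB_wV opS_wV flip: oneV_def)
  interpret alg: algebra_model scaleV mulV oneV \<sigma>V alg to_coset \<sigma>
    by unfold_locales (simp_all add: to_coset_bij to_coset_add to_coset_mult to_coset_scale \<sigma>V)
  \<comment> \<open>Degree at least 3 provides the three arguments that are contracted away in
    \<open>codiff_exact\<close>.\<close>
  obtain k where n: "n = Suc (Suc (Suc k))" using assms(5) by (metis numeral_3_eq_3 Suc_le_D Suc_le_mono)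
  show ?thesis
    unfolding n
  proof (rule alg.twisted_HH_trivial)
    show "\<exists>g\<in>tw.cochain (Suc (Suc k)). f = tw.codiff g" if "f \<in> tw.cochain (Suc (Suc (Suc k)))" "tw.codiff f = 0" for f
      using tw.codiff_exact[OF that] by blast
    show alg.twist_diagonal
      unfolding alg.twist_diagonal_def
    proof (intro allI impI)
      fix P and u :: "int \<Rightarrow>\<^sub>0 'k poly"
      assume P: "\<forall>u v. P u \<longrightarrow> P v \<longrightarrow> P (u + v)" "\<forall>r u. P u \<longrightarrow> P (scaleV r u)"
        "\<forall>u r. \<sigma>V u = scaleV r u \<longrightarrow> P u"
      show "P u"
      proof (rule V_basis_induct)
        show "P (single j (Polynomial.monom 1 i))" for j i
          using automorphism_diagonal[OF \<sigma>V_hom \<open>bij \<sigma>V\<close>, of j i] P(3) by blast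
      qed (use P in blast)+
    qed
  qed
qed

end
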